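(* Let $\mathbb{X}$ be a Banach space, $r_0\in(0,+\infty]$ and $I\subset\mathbb{R}$ an interval. Let $(V_t)_{t\in I}$ be a normal family of analytic vector fields in $\mathbb{F}_{r_0}(\mathbb{X},\mathbb{X})$ and let $X=\sum_{k=0}^\infty X_kz^k\in\mathbb{F}_{r_0}(\mathbb{R})$ be such that $0\le\|V_t^{(p)}\|_\otimes\le X_p$ for all $t\in I$, $p\in\mathbb{N}$. Assume that for all $r\in(0,r_0)$ and all $f\in\mathbb{F}^{(1)}_r(\mathbb{X})$ the map $I\ni t\mapsto V_t\cdot f\in\mathbb{F}_r(\mathbb{X})$ is measurable. Let $R\in(0,r_0)$. Then, for all $t_1,t_2\in I$ such that $e^{-|t_2-t_1|X}(R)$ exists and is positive, the operator $$U_{t_1}^{t_2}:=T\exp\left(\int_{t_1}^{t_2}d\tau\,V_\tau\cdot\right)$$ is a bounded operator from $\mathbb{F}_R(\mathbb{X})$ to $\mathbb{F}_{e^{-|t_2-t_1|X}(R)}(\mathbb{X})$ with norm at most $1$, i.e. $$\forall f\in\mathbb{F}_R(\mathbb{X}),\qquad[\![U_{t_1}^{t_2}f]\!]\left(e^{-|t_2-t_1|X}(R)\right)\le[\![f]\!](R).$$ Moreover, for any $\overline R$ with $R<\overline R<r_0$ and any $f\in\mathbb{F}_{\overline R}(\mathbb{X})$, the map $t\mapsto U_{t_1}^tf$ is locally Lipschitz continuous from $[t_1,t_2]$ to $\mathbb{F}_{e^{-|t_2-t_1|X}(R)}(\mathbb{X})$.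
   Context: For Banach spaces $\mathbb{X},\mathbb{Y}$, $\mathcal{Q}^p(\mathbb{X},\mathbb{Y})$ is the space of homogeneous polynomial maps $f(\varphi)=f_\otimes(\varphi\otimes\cdots\otimes\varphi)$ of degree $p$, where $f_\otimes:\mathbb{X}^{\otimes p}\to\mathbb{Y}$ is symmetric linear; $\|f\|_\otimes$ is the smallest constant such that $\|f_\otimes(\varphi_1\otimes\cdots\otimes\varphi_p)\|_{\mathbb{Y}}\le\|f\|_\otimes\|\varphi_1\|\cdots\|\varphi_p\|$. A formal series is $f=\sum_{p\ge0}f^{(p)}$ with $f^{(p)}\in\mathcal{Q}^p(\mathbb{X},\mathbb{Y})$, and $[\![f]\!](z)=\sum_p\|f^{(p)}\|_\otimes z^p$; $[\![f]\!]^{(k)}$ is the $k$-th derivative of $[\![f]\!]$. For $r\in(0,\infty)$, $\mathbb{F}_r(\mathbb{X},\mathbb{Y})$ is the Banach space of formal series with $[\![f]\!](r)<+\infty$, normed by $[\![f]\!](r)$; $\mathbb{F}^{(k)}_r(\mathbb{X},\mathbb{Y})=\{f\in\mathbb{F}_r(\mathbb{X},\mathbb{Y}):[\![f]\!]^{(k)}(r)<+\infty\}$; $\mathbb{F}_\infty=\bigcap_{r>0}\mathbb{F}_r$; $\mathbb{F}_r(\mathbb{X}):=\mathbb{F}_r(\mathbb{X},\mathbb{R})$. Elements of $\mathbb{F}_r(\mathbb{X},\mathbb{X})$ are called analytic vector fields. A family $(V_t)$ is normal if there is a power series $\sum_pX^{(p)}z^p$ (with the given radius of convergence) with $\|V_t^{(p)}\|_\otimes\le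 X^{(p)}$ for all $t,p$. For an analytic vector field $V$, $(V\cdot f)(\varphi)=\delta f_\varphi(V(\varphi))$ with $\delta f_\varphi$ the differential of $f$ at $\varphi$. The map $(t,z)\mapsto e^{-tX}(z)$ is the flow: $\gamma(t)=e^{-tX}(z)$ solves $\gamma'(t)=-X(\gamma(t))$, $\gamma(0)=z$. The chronological exponential is $$T\exp\int_{t_1}^{t_2}d\tau V_\tau\cdot=\sum_{k\ge0}\int_{t_1<\tau_1<\cdots<\tau_k<t_2}(V_{\tau_k}\cdot)\cdots(V_{\tau_1}\cdot)\,d\tau_1\cdots d\tau_k\quad(t_2>t_1),$$ and $\sum_{k\ge0}(-1)^k\int_{t_2<\tau_k<\cdots<\tau_1<t_1}(V_{\tau_k}\cdot)\cdots(V_{\tau_1}\cdot)\,d\tau_1\cdots d\tau_k$ for $t_2<t_1$, the $k=0$ term being the identity. $[t_1,t_2]$ denotes the closed interval with endpoints $t_1,t_2$. *)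

theory Defs
  imports "HOL-Analysis.Analysis"
begin

section \<open>Homogeneous polynomial maps and formal series\<close>

text \<open>A linear map on the \<open>p\<close>-fold algebraic tensor power is the same thing as a
  \<open>p\<close>-linear map; the arguments \<open>\<phi>\<^sub>1, \<dots>, \<phi>\<^sub>p\<close> are collected in a list of length \<open>p\<close>.
  Values of \<open>m\<close> on lists of other lengths are irrelevant.\<close>

definition sym_multilinear :: "nat \<Rightarrow> ('a::real_vector list \<Rightarrow> 'b::real_vector) \<Rightarrow> bool" where
  "sym_multilinear p m \<longleftrightarrow>
     (\<forall>xs ys. length xs + length ys + 1 = p \<longrightarrow> linear (\<lambda>x. m (xs @ x # ys))) \<and>
     (\<forall>xs ys. length xs = p \<longrightarrow> mset xs = mset ys \<longrightarrow> m xs = m ys)"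

definition polarizes :: "nat \<Rightarrow> ('a::real_vector list \<Rightarrow> 'b::real_vector) \<Rightarrow> ('a \<Rightarrow> 'b) \<Rightarrow> bool" where
  "polarizes p m f \<longleftrightarrow> sym_multilinear p m \<and> (\<forall>\<phi>. f \<phi> = m (replicate p \<phi>))"

definition tensor_bound ::
    "nat \<Rightarrow> ('a::real_normed_vector list \<Rightarrow> 'b::real_normed_vector) \<Rightarrow> real \<Rightarrow> bool" where
  "tensor_bound p m C \<longleftrightarrow>
     0 \<le> C \<and> (\<forall>xs. length xs = p \<longrightarrow> norm (m xs) \<le> C * prod_list (map norm xs))"

definition homog_poly ::
    "nat \<Rightarrow> ('a::real_normed_vector \<Rightarrow> 'b::real_normed_vector) set" where
  "homog_poly p = {f. \<exists>m C. polarizes p m f \<and> tensor_bound p m C}"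

text \<open>By polarization \<open>m\<close> is determined by \<open>f\<close> on lists of length \<open>p\<close>.
  The set below is closed, so the infimum is the smallest constant; it is only meaningful for
  \<open>f\<close> in \<^const>\<open>homog_poly\<close> \<open>p\<close>.\<close>

definition tnorm :: "nat \<Rightarrow> ('a::real_normed_vector \<Rightarrow> 'b::real_normed_vector) \<Rightarrow> real" where
  "tnorm p f = Inf {C. \<exists>m. polarizes p m f \<and> tensor_bound p m C}"

type_synonym ('a, 'b) fseries = "nat \<Rightarrow> 'a \<Rightarrow> 'b"

definition formal_series ::
    "('a::real_normed_vector, 'b::real_normed_vector) fseries set" where
  "formal_series = {f. \<forall>p. f p \<in> homog_poly p}"

text \<open>The \<open>k\<close>-th derivative at \<open>z \<ge> 0\<close> of the majorant \<open>\<Sum>p. tnorm p (f p) * z ^ p\<close>, as an element of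
  \<open>[0, \<infinity>]\<close>; at the boundary of the disc of convergence it is the termwise differentiated series.\<close>

definition majorant ::
    "nat \<Rightarrow> ('a::real_normed_vector, 'b::real_normed_vector) fseries \<Rightarrow> real \<Rightarrow> ennreal" where
  "majorant k f z = (\<Sum>p. ennreal ((diffs ^^ k) (\<lambda>p. tnorm p (f p)) p * z ^ p))"

abbreviation fs_norm ::
    "real \<Rightarrow> ('a::real_normed_vector, 'b::real_normed_vector) fseries \<Rightarrow> ennreal" where
  "fs_norm r f \<equiv> majorant 0 f r"

definition FS :: "real \<Rightarrow> ('a::real_normed_vector, 'b::real_normed_vector) fseries set" where
  "FS r = {f \<in> formal_series. fs_norm r f < \<infinity>}"

definition FSd ::
    "nat \<Rightarrow> real \<Rightarrow> ('a::real_normed_vector, 'b::real_normed_vector) fseries set" where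
  "FSd k r = {f \<in> FS r. majorant k f r < \<infinity>}"

definition FS_ext ::
    "ereal \<Rightarrow> ('a::real_normed_vector, 'b::real_normed_vector) fseries set" where
  "FS_ext r = (if r = \<infinity> then (\<Inter>s\<in>{0<..}. FS s) else FS (real_of_ereal r))"

definition fs_eval :: "('a, 'b::real_normed_vector) fseries \<Rightarrow> 'a \<Rightarrow> 'b" where
  "fs_eval f \<phi> = (\<Sum>p. f p \<phi>)"

definition fs_diff :: "('a, 'b::real_vector) fseries \<Rightarrow> ('a, 'b) fseries \<Rightarrow> ('a, 'b) fseries" where
  "fs_diff f g = (\<lambda>p \<phi>. f p \<phi> - g p \<phi>)"

definition fs_lincomb ::
    "real \<Rightarrow> ('a, 'b::real_vector) fseries \<Rightarrow> real \<Rightarrow> ('a, 'b) fseries \<Rightarrow> ('a, 'b) fseries" where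
  "fs_lincomb a f b g = (\<lambda>p \<phi>. a *\<^sub>R f p \<phi> + b *\<^sub>R g p \<phi>)"


section \<open>Action of vector fields and flows\<close>

text \<open>The formal series \<open>V \<cdot> f\<close>, i.e. \<open>\<phi> \<mapsto> \<delta>f\<^sub>\<phi> (V \<phi>)\<close> sorted by degree: the differential of
  \<open>f k\<close> at \<open>\<phi>\<close> is homogeneous of degree \<open>k - 1\<close> in \<open>\<phi>\<close> (and zero for \<open>k = 0\<close>), so its value on
  \<open>V l \<phi>\<close> contributes to the degree \<open>p = k + l - 1\<close>.\<close>

definition vf_act ::
    "('a, 'a) fseries \<Rightarrow> ('a::real_normed_vector, 'b::real_normed_vector) fseries \<Rightarrow> ('a, 'b) fseries" where
  "vf_act V f = (\<lambda>p \<phi>. \<Sum>k\<le>p + 1. frechet_derivative (f k) (at \<phi>) (V (p + 1 - k) \<phi>))"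

text \<open>\<open>flows_to Y D t z y\<close>: the integral curve of \<open>Y\<close> in the domain \<open>D\<close> started at \<open>z\<close> exists up to
  time \<open>t\<close>, where it has the value \<open>y\<close>.\<close>

definition flows_to :: "(real \<Rightarrow> real) \<Rightarrow> real set \<Rightarrow> real \<Rightarrow> real \<Rightarrow> real \<Rightarrow> bool" where
  "flows_to Y D t z y \<longleftrightarrow>
     (\<exists>\<gamma>. \<gamma> 0 = z \<and> \<gamma> t = y \<and>
        (\<forall>s\<in>closed_segment 0 t. \<gamma> s \<in> D \<and>
           (\<gamma> has_real_derivative Y (\<gamma> s)) (at s within closed_segment 0 t)))"


section \<open>Strong measurability and the Bochner integral in \<open>FS r\<close>\<close>

text \<open>The library's Bochner integral requires a second countable type, whereas \<^const>\<open>FS\<close> \<open>r\<close> is not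
  a type and is not separable in general. The definitions below follow
  \<^const>\<open>has_bochner_integral\<close>, with strong measurability in place of Borel measurability.\<close>

definition fs_measurable ::
    "'c measure \<Rightarrow> real \<Rightarrow> ('c \<Rightarrow> ('a::real_normed_vector, 'b::real_normed_vector) fseries) \<Rightarrow> bool" where
  "fs_measurable M r g \<longleftrightarrow>
     g \<in> space M \<rightarrow> FS r \<and>
     (\<exists>s. (\<forall>i. simple_function M (s i) \<and> s i \<in> space M \<rightarrow> FS r) \<and>
          (AE x in M. (\<lambda>i. fs_norm r (fs_diff (g x) (s i x))) \<longlonglongrightarrow> 0))"

definition fs_simple_integrable ::
    "'c measure \<Rightarrow> real \<Rightarrow> ('c \<Rightarrow> ('a::real_normed_vector, 'b::real_normed_vector) fseries) \<Rightarrow> bool" where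
  "fs_simple_integrable M r s \<longleftrightarrow>
     simple_function M s \<and> s \<in> space M \<rightarrow> FS r \<and>
     emeasure M {x \<in> space M. s x \<noteq> (\<lambda>p \<phi>. 0)} \<noteq> \<infinity>"

definition fs_simple_integral ::
    "'c measure \<Rightarrow> ('c \<Rightarrow> ('a, 'b::real_vector) fseries) \<Rightarrow> ('a, 'b) fseries" where
  "fs_simple_integral M s =
     (\<lambda>p \<phi>. \<Sum>c\<in>s ` space M. measure M {x \<in> space M. s x = c} *\<^sub>R c p \<phi>)"

definition has_fs_integral ::
    "'c measure \<Rightarrow> real \<Rightarrow> ('c \<Rightarrow> ('a::real_normed_vector, 'b::real_normed_vector) fseries) \<Rightarrow>
      ('a, 'b) fseries \<Rightarrow> bool" where
  "has_fs_integral M r g h \<longleftrightarrow>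
     fs_measurable M r g \<and> h \<in> FS r \<and>
     (\<exists>s. (\<forall>i. fs_simple_integrable M r (s i)) \<and>
          (\<lambda>i. \<integral>\<^sup>+x. fs_norm r (fs_diff (g x) (s i x)) \<partial>M) \<longlonglongrightarrow> 0 \<and>
          (\<lambda>i. fs_norm r (fs_diff h (fs_simple_integral M (s i)))) \<longlonglongrightarrow> 0)"


section \<open>The chronological exponential\<close>

text \<open>\<open>(V\<^bsub>\<tau> k\<^esub> \<cdot>) \<dots> (V\<^bsub>\<tau> 1\<^esub> \<cdot>) f\<close>\<close>

primrec vf_iter ::
    "(real \<Rightarrow> ('a, 'a) fseries) \<Rightarrow> (nat \<Rightarrow> real) \<Rightarrow> nat \<Rightarrow>
      ('a::real_normed_vector, 'b::real_normed_vector) fseries \<Rightarrow> ('a, 'b) fseries" where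
  "vf_iter V \<tau> 0 f = f"
| "vf_iter V \<tau> (Suc k) f = vf_act (V (\<tau> (Suc k))) (vf_iter V \<tau> k f)"

text \<open>\<open>t\<^sub>1 < \<tau> 1 < \<dots> < \<tau> k < t\<^sub>2\<close>, respectively \<open>t\<^sub>2 < \<tau> k < \<dots> < \<tau> 1 < t\<^sub>1\<close>. For \<open>k = 0\<close> this is a single
  point (of measure one below), for \<open>k \<ge> 1\<close> and \<open>t\<^sub>1 = t\<^sub>2\<close> it is empty.\<close>

definition time_simplex :: "nat \<Rightarrow> real \<Rightarrow> real \<Rightarrow> (nat \<Rightarrow> real) set" where
  "time_simplex k t1 t2 =
     (if t1 \<le> t2 then {\<tau> \<in> {1..k} \<rightarrow>\<^sub>E {t1<..<t2}. strict_mono_on {1..k} \<tau>}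
      else {\<tau> \<in> {1..k} \<rightarrow>\<^sub>E {t2<..<t1}. strict_antimono_on {1..k} \<tau>})"

definition simplex_measure :: "nat \<Rightarrow> real \<Rightarrow> real \<Rightarrow> (nat \<Rightarrow> real) measure" where
  "simplex_measure k t1 t2 =
     restrict_space (completion (\<Pi>\<^sub>M i\<in>{1..k}. lborel)) (time_simplex k t1 t2)"

text \<open>\<open>g\<close> is the value at \<open>f\<close> of the chronological exponential from \<open>t1\<close> to \<open>t2\<close>: all the integrals
  exist in \<open>FS r\<close>, and their signed sum converges to \<open>g\<close> in \<open>FS r\<close>. Changing \<open>r\<close> affects only
  whether \<open>g\<close> exists in \<open>FS r\<close>, not its value.\<close>

definition has_Texp ::
    "real \<Rightarrow> (real \<Rightarrow> ('a, 'a) fseries) \<Rightarrow> real \<Rightarrow> real \<Rightarrow>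
      ('a::real_normed_vector, 'b::real_normed_vector) fseries \<Rightarrow> ('a, 'b) fseries \<Rightarrow> bool" where
  "has_Texp r V t1 t2 f g \<longleftrightarrow>
     g \<in> FS r \<and>
     (\<exists>h. (\<forall>k. has_fs_integral (simplex_measure k t1 t2) r (\<lambda>\<tau>. vf_iter V \<tau> k f) (h k)) \<and>
          (\<lambda>n. fs_norm r (fs_diff g
              (\<lambda>p \<phi>. \<Sum>k<n. (if t1 \<le> t2 then 1 else (- 1) ^ k) *\<^sub>R h k p \<phi>))) \<longlonglongrightarrow> 0)"

definition Texp ::
    "real \<Rightarrow> (real \<Rightarrow> ('a, 'a) fseries) \<Rightarrow> real \<Rightarrow> real \<Rightarrow>
      ('a::real_normed_vector, 'b::real_normed_vector) fseries \<Rightarrow> ('a, 'b) fseries" where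
  "Texp r V t1 t2 f = (THE g. has_Texp r V t1 t2 f g)"

text \<open>Local Lipschitz continuity of a curve with values in \<open>FS r\<close>.\<close>

definition fs_locally_lipschitz_on ::
    "real \<Rightarrow> real set \<Rightarrow> (real \<Rightarrow> ('a::real_normed_vector, 'b::real_normed_vector) fseries) \<Rightarrow> bool" where
  "fs_locally_lipschitz_on r S u \<longleftrightarrow>
     u \<in> S \<rightarrow> FS r \<and>
     (\<forall>t\<in>S. \<exists>e>0. \<exists>L\<ge>0. \<forall>s\<in>S \<inter> ball t e. \<forall>s'\<in>S \<inter> ball t e.
        fs_norm r (fs_diff (u s) (u s')) \<le> ennreal (L * \<bar>s - s'\<bar>))"

end

theory Submission
  imports Defs
begin

text \<open>The statement is an exact exponential estimate for transport by a vector field. Write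
\<open>F(z)\<close> for the majorant series of \<open>f\<close>. The action of \<open>V\<^sub>t\<close> on \<open>f\<close> replaces \<open>F\<close> by a series dominated,
coefficient by coefficient, by \<open>X(z) F'(z)\<close>; call this operation \<open>A\<close> (\<open>transport\<close> below). Hence the \<open>k\<close>-fold
iterate is dominated by \<open>A\<^sup>k F\<close> uniformly in the times, the \<open>k\<close>-th ordered simplex over an interval of
length \<open>T\<close> has volume \<open>T\<^sup>k / k!\<close>, and the norm at \<open>\<rho>\<close> of the chronological exponential is at
most \<open>\<Sum>k. T\<^sup>k / k! * (A\<^sup>k F)(\<rho>)\<close>. Formally this is \<open>exp (T X d/dz) F\<close> at \<open>\<rho>\<close>, that is, \<open>F\<close> at the point
which the flow of \<open>X\<close> reaches from \<open>\<rho>\<close> in time \<open>T\<close>; by hypothesis this point is \<open>R\<close>.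

The inequality that is needed has an elementary proof (\<open>transport_exponential_bound\<close>). Let \<open>u\<close> be the
reversed flow, \<open>u' = X(u)\<close> with \<open>u(0) = \<rho>\<close> and \<open>u(T) = R\<close>. The derivative of
\<open>F(u(s)) - (\<Sum>k\<le>n. s\<^sup>k / k! * (A\<^sup>k F)(\<rho>))\<close> is the same expression for \<open>A F\<close> and \<open>n - 1\<close>, so all these
expressions are nonnegative by induction on \<open>n\<close>. Applied to \<open>A F\<close> in place of \<open>F\<close>, the estimate also
gives the Lipschitz constant \<open>(A F)(R)\<close>: it is finite as soon as \<open>f\<close> has a radius larger than \<open>R\<close>,
and the simplices for two end times differ in a set of volume at most \<open>T\<^sup>k / k!\<close> times \<open>k / T\<close> times the
distance of the end times.

The analytic content around this estimate is the following. Polarization identifies the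
symmetric form of a homogeneous polynomial with an explicit finite combination of point values, so that
forms may be integrated, summed and passed to limits pointwise (\<open>polarizes_polar\<close>, \<open>fs_integral_bound\<close>).
Strong measurability of the iterated action is obtained one time variable after
the other, each step costing an arbitrarily small part of the radius
(\<open>fs_measurable_operator\<close>, \<open>vf_iter_measurable\<close>). This needs \<open>\<rho> < R\<close>, which fails only if the interval
is trivial or \<open>X = 0\<close>; in these cases all terms beyond the zeroth vanish.\<close>

section \<open>Polarization\<close>

text \<open>The iterated finite difference of \<open>f\<close> at the origin in the directions of the list. On a
homogeneous polynomial of degree \<open>p\<close> it extracts \<open>p!\<close> times the polarized form.\<close>

primrec iter_diff :: "'a::real_vector list \<Rightarrow> ('a \<Rightarrow> 'b::real_vector) \<Rightarrow> 'b" where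
  "iter_diff [] f = f 0"
| "iter_diff (x # xs) f = iter_diff xs (\<lambda>\<phi>. f (\<phi> + x) - f \<phi>)"

definition polar :: "nat \<Rightarrow> ('a::real_vector \<Rightarrow> 'b::real_vector) \<Rightarrow> 'a list \<Rightarrow> 'b" where
  "polar p f xs = (1 / fact p) *\<^sub>R iter_diff xs f"

lemma iter_diff_sum:
  "iter_diff xs (\<lambda>\<phi>. \<Sum>i\<in>S. c i *\<^sub>R f i \<phi>) = (\<Sum>i\<in>S. c i *\<^sub>R iter_diff xs (f i))"
proof (induction xs arbitrary: f)
  case (Cons x xs)
  have "(\<lambda>\<phi>. (\<Sum>i\<in>S. c i *\<^sub>R f i (\<phi> + x)) - (\<Sum>i\<in>S. c i *\<^sub>R f i \<phi>))
      = (\<lambda>\<phi>. \<Sum>i\<in>S. c i *\<^sub>R (f i (\<phi> + x) - f i \<phi>))"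
    by (simp add: sum_subtractf scaleR_diff_right)
  then show ?case using Cons.IH[of "\<lambda>i \<phi>. f i (\<phi> + x) - f i \<phi>"] by simp
qed simp

lemma iter_diff_zero: "iter_diff xs (\<lambda>\<phi>. 0) = 0"
  by (induction xs) auto

lemma sym_multilinear_linear:
  assumes "sym_multilinear p m" "length xs + length ys + 1 = p"
  shows "linear (\<lambda>x. m (xs @ x # ys))"
  using assms unfolding sym_multilinear_def by blast

lemma sym_multilinear_perm:
  assumes "sym_multilinear p m" "length xs = p" "mset xs = mset ys"
  shows "m xs = m ys"
  using assms unfolding sym_multilinear_def by blast

text \<open>The trailing arguments \<open>ys\<close> let the induction expand one copy of \<open>\<phi> + x\<close> at a time and move the
result out of the way.\<close>

lemma sym_multilinear_binomial:
  assumes "sym_multilinear (p + length ys) m"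
  shows "m (replicate p (\<phi> + x) @ ys) =
    (\<Sum>j\<le>p. real (p choose j) *\<^sub>R m (replicate (p - j) x @ replicate j \<phi> @ ys))"
  using assms
proof (induction p arbitrary: ys)
  case (Suc p)
  define a where "a j = m (replicate (Suc p - j) x @ replicate j \<phi> @ ys)" for j
  have len: "sym_multilinear (p + length (z # ys)) m" for z
    using Suc.prems by simp
  have lin: "linear (\<lambda>z. m (replicate p (\<phi> + x) @ z # ys))"
    using Suc.prems by (intro sym_multilinear_linear[OF Suc.prems]) simp
  have "m (replicate (Suc p) (\<phi> + x) @ ys) = m (replicate p (\<phi> + x) @ (\<phi> + x) # ys)"
    by (simp add: replicate_app_Cons_same)
  also have "\<dots> = m (replicate p (\<phi> + x) @ \<phi> # ys) + m (replicate p (\<phi> + x) @ x # ys)"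
    using linear_add[OF lin] .
  also have "m (replicate p (\<phi> + x) @ \<phi> # ys) = (\<Sum>j\<le>p. real (p choose j) *\<^sub>R a (Suc j))"
    unfolding Suc.IH[OF len] a_def
    by (intro sum.cong refl) (simp add: replicate_app_Cons_same)
  also have "m (replicate p (\<phi> + x) @ x # ys) = (\<Sum>j\<le>p. real (p choose j) *\<^sub>R a j)"
    unfolding Suc.IH[OF len] a_def
    by (intro sum.cong refl arg_cong2[where f = scaleR]
        sym_multilinear_perm[OF Suc.prems]) (auto simp: Suc_diff_le)
  also have "(\<Sum>j\<le>p. real (p choose j) *\<^sub>R a (Suc j)) + (\<Sum>j\<le>p. real (p choose j) *\<^sub>R a j)
      = (\<Sum>j\<le>Suc p. real (Suc p choose j) *\<^sub>R a j)"
  proof -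
    have "(\<Sum>j\<le>p. real (p choose j) *\<^sub>R a j) = (\<Sum>j\<le>Suc p. real (p choose j) *\<^sub>R a j)"
      by simp
    also have "\<dots> = a 0 + (\<Sum>j\<le>p. real (p choose Suc j) *\<^sub>R a (Suc j))"
      by (subst sum.atMost_Suc_shift) simp
    finally have "(\<Sum>j\<le>p. real (p choose Suc j) *\<^sub>R a (Suc j)) = (\<Sum>j\<le>p. real (p choose j) *\<^sub>R a j) - a 0"
      by simp
    moreover have "(\<Sum>j\<le>Suc p. real (Suc p choose j) *\<^sub>R a j)
      = a 0 + (\<Sum>j\<le>p. real (p choose j) *\<^sub>R a (Suc j)) + (\<Sum>j\<le>p. real (p choose Suc j) *\<^sub>R a (Suc j))"
      by (subst sum.atMost_Suc_shift) (simp add: sum.distrib scaleR_add_left)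
    ultimately show ?thesis by simp
  qed
  finally show ?case unfolding a_def .
qed simp

text \<open>A difference in the direction \<open>x\<close> turns the diagonal of a form of degree \<open>p\<close> into \<open>p\<close> times the form
with one argument frozen to \<open>x\<close>, of degree \<open>p - 1\<close>, plus terms of degree below \<open>p - 1\<close>. The
remaining \<open>p - 1\<close> or more differences annihilate the latter.\<close>

lemma iter_diff_multilinear:
  assumes "sym_multilinear (p + length ys) m" "p \<le> length xs"
  shows "iter_diff xs (\<lambda>\<phi>. m (replicate p \<phi> @ ys)) =
    (if length xs = p then fact p *\<^sub>R m (xs @ ys) else 0)"
  using assms
proof (induction xs arbitrary: p ys)
  case (Cons x xs)
  show ?case
  proof (cases p)
    case 0
    then show ?thesis by (simp add: iter_diff_zero)
  next
    case (Suc q)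
    define g where "g j = (\<lambda>\<phi>. m (replicate j \<phi> @ replicate (p - j) x @ ys))" for j
    have eq: "m (replicate p (\<phi> + x) @ ys) - m (replicate p \<phi> @ ys)
        = (\<Sum>j\<le>q. real (p choose j) *\<^sub>R g j \<phi>)" for \<phi>
    proof -
      have "m (replicate p (\<phi> + x) @ ys) = (\<Sum>j\<le>p. real (p choose j) *\<^sub>R g j \<phi>)"
        unfolding sym_multilinear_binomial[OF Cons.prems(1)] g_def
        by (intro sum.cong refl arg_cong2[where f = scaleR]
            sym_multilinear_perm[OF Cons.prems(1)]) auto
      then show ?thesis by (simp add: Suc g_def)
    qed
    have it: "iter_diff xs (g j) = (if length xs = j then fact j *\<^sub>R m (xs @ replicate (p - j) x @ ys) else 0)"
      if "j \<le> q" for j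
      unfolding g_def using that Suc Cons.prems by (intro Cons.IH) auto
    have "iter_diff (x # xs) (\<lambda>\<phi>. m (replicate p \<phi> @ ys))
        = (\<Sum>j\<le>q. real (p choose j) *\<^sub>R iter_diff xs (g j))"
      by (simp add: eq iter_diff_sum)
    also have "\<dots> = (\<Sum>j\<le>q. if j = q then real (p choose q) *\<^sub>R iter_diff xs (g q) else 0)"
      using Cons.prems Suc by (intro sum.cong refl) (auto simp: it)
    also have "\<dots> = real p *\<^sub>R iter_diff xs (g q)"
      by (simp add: Suc)
    also have "\<dots> = (if length (x # xs) = p then fact p *\<^sub>R m ((x # xs) @ ys) else 0)"
    proof (cases "length xs = q")
      case True
      have "m (xs @ x # ys) = m (x # xs @ ys)"
        using True Suc by (intro sym_multilinear_perm[OF Cons.prems(1)]) auto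
      then show ?thesis using True Suc by (simp add: it)
    qed (simp add: it Suc)
    finally show ?thesis .
  qed
qed simp

text \<open>Uniqueness of the polarized form. Since \<^const>\<open>polar\<close> is a finite linear combination of values of
\<open>f\<close>, it commutes with every operation that acts pointwise on \<open>f\<close>.\<close>

lemma polarizes_polar:
  assumes "polarizes p m f" "length xs = p"
  shows "m xs = polar p f xs"
proof -
  have f: "f = (\<lambda>\<phi>. m (replicate p \<phi>))" and m: "sym_multilinear p m"
    using assms unfolding polarizes_def by auto
  show ?thesis
    using iter_diff_multilinear[of p "[]" m xs] m assms(2) unfolding f polar_def by simp
qed

lemma polarizes_cong:
  assumes "\<And>xs. length xs = p \<Longrightarrow> m xs = m' xs" "polarizes p m f"
  shows "polarizes p m' f"
proof -
  have "linear (\<lambda>x. m' (xs @ x # ys))" if "length xs + length ys + 1 = p" for xs ys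
  proof -
    have "(\<lambda>x. m' (xs @ x # ys)) = (\<lambda>x. m (xs @ x # ys))"
      using that by (intro ext assms(1)[symmetric]) simp
    then show ?thesis using assms(2) that unfolding polarizes_def sym_multilinear_def by simp
  qed
  moreover have "m' xs = m' ys" if "length xs = p" "mset xs = mset ys" for xs ys
  proof -
    have "m xs = m ys"
      using assms(2) that unfolding polarizes_def by (blast intro: sym_multilinear_perm)
    then show ?thesis
      using assms(1)[of xs] assms(1)[of ys] mset_eq_length[OF that(2)] that(1) by simp
  qed
  ultimately have "sym_multilinear p m'" unfolding sym_multilinear_def by blast
  then show ?thesis
    using assms unfolding polarizes_def by simp
qed

lemma homog_poly_polarizes:
  assumes "f \<in> homog_poly p"
  shows "polarizes p (polar p f) f"
proof -
  obtain m where m: "polarizes p m f" using assms unfolding homog_poly_def by blast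
  show ?thesis by (rule polarizes_cong[OF polarizes_polar[OF m] m])
qed

lemma tensor_bound_cong:
  assumes "\<And>xs. length xs = p \<Longrightarrow> m xs = m' xs"
  shows "tensor_bound p m C \<longleftrightarrow> tensor_bound p m' C"
  using assms unfolding tensor_bound_def by auto

lemma tnorm_set_eq:
  assumes "f \<in> homog_poly p"
  shows "{C. \<exists>m. polarizes p m f \<and> tensor_bound p m C} = {C. tensor_bound p (polar p f) C}"
proof (intro Collect_cong iffI)
  fix C assume "\<exists>m. polarizes p m f \<and> tensor_bound p m C"
  then obtain m where m: "polarizes p m f" "tensor_bound p m C" by blast
  then show "tensor_bound p (polar p f) C"
    using tensor_bound_cong[of p m "polar p f" C] polarizes_polar[OF m(1)] by simp
next
  fix C assume "tensor_bound p (polar p f) C"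
  then show "\<exists>m. polarizes p m f \<and> tensor_bound p m C"
    using homog_poly_polarizes[OF assms] by blast
qed

text \<open>The infimum that defines \<^const>\<open>tnorm\<close> is attained, because the bounds for the unique form \<open>polar p f\<close>
make up a closed set.\<close>

lemma tensor_bound_tnorm:
  assumes "f \<in> homog_poly p"
  shows "tensor_bound p (polar p f) (tnorm p f)"
proof -
  define S where "S = {C. tensor_bound p (polar p f) C}"
  have tn: "tnorm p f = Inf S"
    unfolding tnorm_def S_def tnorm_set_eq[OF assms] ..
  have ne: "S \<noteq> {}"
    using assms tnorm_set_eq[OF assms] unfolding homog_poly_def S_def by blast
  have "norm (polar p f xs) \<le> Inf S * prod_list (map norm xs)" if "length xs = p" for xs
  proof -
    have b: "norm (polar p f xs) \<le> C * prod_list (map norm xs)" if "C \<in> S" for C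
      using that \<open>length xs = p\<close> unfolding S_def tensor_bound_def by blast
    have "prod_list (map norm xs) \<ge> 0" by (induction xs) auto
    then consider "prod_list (map norm xs) = 0" | "prod_list (map norm xs) > 0" by linarith
    then show ?thesis
    proof cases
      case 1
      then show ?thesis using b ne by auto
    next
      case 2
      then have "norm (polar p f xs) / prod_list (map norm xs) \<le> Inf S"
        using b ne by (intro cInf_greatest) (auto simp: divide_simps)
      then show ?thesis using 2 by (simp add: divide_simps)
    qed
  qed
  moreover have "0 \<le> Inf S"
    using ne by (intro cInf_greatest) (auto simp: S_def tensor_bound_def)
  ultimately show ?thesis unfolding tn tensor_bound_def by blast
qed

lemma tnorm_nonneg: "f \<in> homog_poly p \<Longrightarrow> 0 \<le> tnorm p f"
  using tensor_bound_tnorm unfolding tensor_bound_def by blast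

lemma norm_polar_le:
  assumes "f \<in> homog_poly p" "length xs = p"
  shows "norm (polar p f xs) \<le> tnorm p f * prod_list (map norm xs)"
  using tensor_bound_tnorm assms unfolding tensor_bound_def by blast

lemma polarizes_bound:
  assumes "polarizes p m f" "tensor_bound p m C"
  shows "f \<in> homog_poly p" "tnorm p f \<le> C"
proof -
  show "f \<in> homog_poly p" using assms unfolding homog_poly_def by blast
  show "tnorm p f \<le> C" unfolding tnorm_def
    using assms by (intro cInf_lower bdd_belowI[of _ 0]) (auto simp: tensor_bound_def)
qed

lemma homog_poly_eval: "f \<in> homog_poly p \<Longrightarrow> f \<phi> = polar p f (replicate p \<phi>)"
  using homog_poly_polarizes unfolding polarizes_def by blast

lemma norm_homog_poly_le:
  assumes "f \<in> homog_poly p"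
  shows "norm (f \<phi>) \<le> tnorm p f * norm \<phi> ^ p"
  using norm_polar_le[OF assms, of "replicate p \<phi>"] homog_poly_eval[OF assms]
  by (simp add: prod_list_replicate)

lemma sym_multilinear_lincomb:
  assumes "sym_multilinear p m" "sym_multilinear p n"
  shows "sym_multilinear p (\<lambda>xs. a *\<^sub>R m xs + b *\<^sub>R n xs)"
proof -
  have "linear (\<lambda>x. a *\<^sub>R m (xs @ x # ys) + b *\<^sub>R n (xs @ x # ys))" if "length xs + length ys + 1 = p" for xs ys
    using sym_multilinear_linear[OF assms(1) that] sym_multilinear_linear[OF assms(2) that]
    by (intro linear_compose_add linear_compose_scale_right) auto
  moreover have "a *\<^sub>R m xs + b *\<^sub>R n xs = a *\<^sub>R m ys + b *\<^sub>R n ys"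
    if "length xs = p" "mset xs = mset ys" for xs ys
    using that assms[THEN sym_multilinear_perm] by metis
  ultimately show ?thesis unfolding sym_multilinear_def by blast
qed

lemma homog_poly_lincomb:
  assumes f: "f \<in> homog_poly p" and g: "g \<in> homog_poly p"
  shows "(\<lambda>\<phi>. a *\<^sub>R f \<phi> + b *\<^sub>R g \<phi>) \<in> homog_poly p"
    and "tnorm p (\<lambda>\<phi>. a *\<^sub>R f \<phi> + b *\<^sub>R g \<phi>) \<le> \<bar>a\<bar> * tnorm p f + \<bar>b\<bar> * tnorm p g"
proof -
  let ?m = "\<lambda>xs. a *\<^sub>R polar p f xs + b *\<^sub>R polar p g xs"
  have 1: "polarizes p ?m (\<lambda>\<phi>. a *\<^sub>R f \<phi> + b *\<^sub>R g \<phi>)"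
    using homog_poly_polarizes[OF f] homog_poly_polarizes[OF g]
    unfolding polarizes_def by (auto intro!: sym_multilinear_lincomb)
  have "norm (?m xs) \<le> (\<bar>a\<bar> * tnorm p f + \<bar>b\<bar> * tnorm p g) * prod_list (map norm xs)" if "length xs = p" for xs
  proof -
    have "norm (?m xs) \<le> \<bar>a\<bar> * norm (polar p f xs) + \<bar>b\<bar> * norm (polar p g xs)"
      by (rule norm_triangle_le) simp
    also have "\<dots> \<le> \<bar>a\<bar> * (tnorm p f * prod_list (map norm xs)) + \<bar>b\<bar> * (tnorm p g * prod_list (map norm xs))"
      using norm_polar_le[OF f that] norm_polar_le[OF g that]
      by (intro add_mono mult_left_mono) auto
    finally show ?thesis by (simp add: algebra_simps)
  qed
  then have 2: "tensor_bound p ?m (\<bar>a\<bar> * tnorm p f + \<bar>b\<bar> * tnorm p g)"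
    using tnorm_nonneg[OF f] tnorm_nonneg[OF g] unfolding tensor_bound_def by auto
  show "(\<lambda>\<phi>. a *\<^sub>R f \<phi> + b *\<^sub>R g \<phi>) \<in> homog_poly p"
    and "tnorm p (\<lambda>\<phi>. a *\<^sub>R f \<phi> + b *\<^sub>R g \<phi>) \<le> \<bar>a\<bar> * tnorm p f + \<bar>b\<bar> * tnorm p g"
    using polarizes_bound[OF 1 2] by auto
qed

lemma homog_poly_zero: "(\<lambda>\<phi>. 0) \<in> homog_poly p" and tnorm_zero: "tnorm p (\<lambda>\<phi>. 0) = 0"
proof -
  have 1: "polarizes p (\<lambda>xs. 0) (\<lambda>\<phi>. 0)"
    by (auto simp: polarizes_def sym_multilinear_def module_hom_zero intro: linear_zero)
  have 2: "tensor_bound p (\<lambda>xs. 0) 0" by (auto simp: tensor_bound_def)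
  show "(\<lambda>\<phi>. 0) \<in> homog_poly p" using polarizes_bound[OF 1 2] by simp
  then show "tnorm p (\<lambda>\<phi>. 0) = 0"
    using polarizes_bound[OF 1 2] tnorm_nonneg by (metis order_antisym)
qed

lemma homog_poly_eq_zero: "f \<in> homog_poly p \<Longrightarrow> tnorm p f = 0 \<Longrightarrow> f \<phi> = 0"
  using norm_homog_poly_le[of f p \<phi>] by simp

text \<open>In the binomial expansion of \<open>f (\<phi> + h)\<close> the term linear in \<open>h\<close> is the derivative, and every
further term carries at least two factors \<open>h\<close>.\<close>

lemma homog_poly_has_derivative:
  assumes f: "f \<in> homog_poly (Suc q)"
  shows "(f has_derivative (\<lambda>h. real (Suc q) *\<^sub>R polar (Suc q) f (h # replicate q \<phi>))) (at \<phi>)"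
proof -
  let ?p = "Suc q"
  let ?m = "polar ?p f"
  have m: "sym_multilinear ?p ?m" and fm: "\<And>\<phi>. f \<phi> = ?m (replicate ?p \<phi>)"
    using homog_poly_polarizes[OF f] unfolding polarizes_def by auto
  have lin: "linear (\<lambda>h. ?m (h # replicate q \<phi>))"
    using sym_multilinear_linear[OF m, of "[]" "replicate q \<phi>"] by simp
  have bl: "bounded_linear (\<lambda>h. real ?p *\<^sub>R ?m (h # replicate q \<phi>))"
  proof (rule bounded_linear_intro[where K = "real ?p * (tnorm ?p f * norm \<phi> ^ q)"])
    fix h
    have "norm (?m (h # replicate q \<phi>)) \<le> tnorm ?p f * (norm h * norm \<phi> ^ q)"
      using norm_polar_le[OF f, of "h # replicate q \<phi>"] by (simp add: prod_list_replicate)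
    then have "real ?p * norm (?m (h # replicate q \<phi>)) \<le> real ?p * (tnorm ?p f * (norm h * norm \<phi> ^ q))"
      by (intro mult_left_mono) auto
    then show "norm (real ?p *\<^sub>R ?m (h # replicate q \<phi>)) \<le> norm h * (real ?p * (tnorm ?p f * norm \<phi> ^ q))"
      by (simp add: mult_ac)
  qed (simp_all add: linear_add[OF lin] linear_scale[OF lin] scaleR_add_right)
  have expand: "f (\<phi> + h) - f \<phi> - real ?p *\<^sub>R ?m (h # replicate q \<phi>)
      = (\<Sum>j<q. real (?p choose j) *\<^sub>R ?m (replicate (?p - j) h @ replicate j \<phi>))" for h
  proof -
    have "f (\<phi> + h) = (\<Sum>j\<le>?p. real (?p choose j) *\<^sub>R ?m (replicate (?p - j) h @ replicate j \<phi>))"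
      using sym_multilinear_binomial[of ?p "[]" ?m \<phi> h] m fm[of "\<phi> + h"] by simp
    also have "\<dots> = (\<Sum>j<Suc ?p. real (?p choose j) *\<^sub>R ?m (replicate (?p - j) h @ replicate j \<phi>))"
      by (simp only: lessThan_Suc_atMost)
    finally show ?thesis by (simp add: fm[of \<phi>] del: replicate.simps) (simp add: algebra_simps)
  qed
  define B where "B h = (\<Sum>j<q. real (?p choose j) * (tnorm ?p f * (norm h ^ (q - j) * norm \<phi> ^ j)))" for h :: 'a
  have bnd: "norm (f (\<phi> + h) - f \<phi> - real ?p *\<^sub>R ?m (h # replicate q \<phi>)) / norm h \<le> B h" for h
  proof (cases "h = 0")
    case True
    then show ?thesis using tnorm_nonneg[OF f] by (auto simp: B_def intro!: sum_nonneg mult_nonneg_nonneg)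
  next
    case False
    have "norm (f (\<phi> + h) - f \<phi> - real ?p *\<^sub>R ?m (h # replicate q \<phi>))
       \<le> (\<Sum>j<q. real (?p choose j) * (tnorm ?p f * (norm h ^ (?p - j) * norm \<phi> ^ j)))"
      unfolding expand
    proof (intro sum_norm_le)
      fix j assume "j \<in> {..<q}"
      then have "norm (?m (replicate (?p - j) h @ replicate j \<phi>)) \<le> tnorm ?p f * (norm h ^ (?p - j) * norm \<phi> ^ j)"
        using norm_polar_le[OF f, of "replicate (?p - j) h @ replicate j \<phi>"]
        by (simp add: prod_list_replicate del: replicate.simps)
      then show "norm (real (?p choose j) *\<^sub>R ?m (replicate (?p - j) h @ replicate j \<phi>))
        \<le> real (?p choose j) * (tnorm ?p f * (norm h ^ (?p - j) * norm \<phi> ^ j))"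
        by (simp add: mult_left_mono del: replicate.simps)
    qed
    also have "\<dots> = B h * norm h"
      unfolding B_def sum_distrib_right
      by (intro sum.cong refl) (auto simp: Suc_diff_le)
    finally show ?thesis using False by (simp add: divide_simps)
  qed
  have "B \<midarrow>0\<rightarrow> (\<Sum>j<q. real (?p choose j) * (tnorm ?p f * (norm (0::'a) ^ (q - j) * norm \<phi> ^ j)))"
    unfolding B_def by (intro tendsto_intros)
  also have "(\<Sum>j<q. real (?p choose j) * (tnorm ?p f * (norm (0::'a) ^ (q - j) * norm \<phi> ^ j))) = 0"
    by (intro sum.neutral) auto
  finally have B0: "B \<midarrow>0\<rightarrow> 0" .
  have "(\<lambda>h. norm (f (\<phi> + h) - f \<phi> - real ?p *\<^sub>R ?m (h # replicate q \<phi>)) / norm h) \<midarrow>0\<rightarrow> 0"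
    by (rule tendsto_sandwich[OF _ _ tendsto_const B0])
      (use bnd in \<open>intro always_eventually allI; simp only: norm_ge_zero divide_nonneg_nonneg\<close>)+
  then show ?thesis
    unfolding has_derivative_at using bl by blast
qed

lemma homog_poly_0_has_derivative:
  assumes f: "f \<in> homog_poly 0"
  shows "(f has_derivative (\<lambda>h. 0)) (at \<phi>)"
proof -
  have "f = (\<lambda>\<phi>. polar 0 f [])"
    using homog_poly_eval[OF f] by auto
  then show ?thesis by (metis has_derivative_const)
qed

lemma homog_poly_differentiable:
  "f \<in> homog_poly p \<Longrightarrow> f differentiable (at \<phi>)"
  by (cases p) (auto intro: differentiableI homog_poly_has_derivative homog_poly_0_has_derivative)

section \<open>Symmetrization\<close>

lemma permute_list_update:
  assumes \<sigma>: "\<sigma> permutes {..<length zs}" and i: "i < length zs"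
  shows "permute_list \<sigma> (zs[i := x]) = (permute_list \<sigma> zs)[inv \<sigma> i := x]"
proof (rule nth_equalityI)
  fix j assume "j < length (permute_list \<sigma> (zs[i := x]))"
  then have j: "j < length zs" by simp
  have "inv \<sigma> i < length zs"
    using permutes_in_image[OF permutes_inv[OF \<sigma>], of i] i by simp
  moreover have "\<sigma> j < length zs"
    using permutes_in_image[OF \<sigma>, of j] j by simp
  moreover have "inv \<sigma> i = j \<longleftrightarrow> i = \<sigma> j"
    using permutes_inverses[OF \<sigma>] by metis
  ultimately show "permute_list \<sigma> (zs[i := x]) ! j = (permute_list \<sigma> zs)[inv \<sigma> i := x] ! j"
    using j \<sigma> by (simp add: permute_list_nth nth_list_update)
qed simp

text \<open>Averaging a multilinear map over all permutations of its arguments keeps the diagonal and does not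
increase the bound. This produces the symmetric form required by \<^const>\<open>homog_poly\<close> where only a
nonsymmetric one is at hand.\<close>

lemma homog_poly_symmetrize:
  fixes M :: "'a::real_normed_vector list \<Rightarrow> 'b::real_normed_vector"
  assumes lin: "\<And>zs i. length zs = n \<Longrightarrow> i < n \<Longrightarrow> linear (\<lambda>x. M (zs[i := x]))"
    and bound: "\<And>zs. length zs = n \<Longrightarrow> norm (M zs) \<le> C * prod_list (map norm zs)"
    and C: "0 \<le> C" and f: "\<And>\<phi>. f \<phi> = M (replicate n \<phi>)"
  shows "f \<in> homog_poly n" "tnorm n f \<le> C"
proof -
  define P where "P = {\<sigma>. \<sigma> permutes {..<n}}"
  have finP: "finite P" unfolding P_def by (simp add: finite_permutations)
  have cardP: "card P = fact n" unfolding P_def by (simp add: card_permutations)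
  define S where "S zs = (1 / fact n) *\<^sub>R (\<Sum>\<sigma>\<in>P. M (permute_list \<sigma> zs))" for zs
  have "linear (\<lambda>x. S (xs @ x # ys))" if len: "length xs + length ys + 1 = n" for xs ys
  proof -
    have "linear (\<lambda>x. M (permute_list \<sigma> (xs @ x # ys)))" if "\<sigma> \<in> P" for \<sigma>
    proof -
      let ?zs = "xs @ 0 # ys"
      have \<sigma>: "\<sigma> permutes {..<length ?zs}" using that len by (simp add: P_def)
      have eq: "xs @ x # ys = ?zs[length xs := x]" for x by simp
      define ws where "ws = permute_list \<sigma> ?zs"
      have upd: "permute_list \<sigma> (xs @ x # ys) = ws[inv \<sigma> (length xs) := x]" for x
        unfolding ws_def by (subst eq[of x], rule permute_list_update[OF \<sigma>]) simp
      have "inv \<sigma> (length xs) < n"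
        using permutes_in_image[OF permutes_inv[OF \<sigma>], of "length xs"] len by simp
      moreover have "length ws = n" using len by (simp add: ws_def)
      ultimately show ?thesis unfolding upd by (intro lin)
    qed
    then show ?thesis unfolding S_def
      by (intro linear_compose_scale_right linear_compose_sum) auto
  qed
  moreover have "S xs = S ys" if len: "length xs = n" and eq: "mset xs = mset ys" for xs ys
  proof -
    have len': "length ys = n" using mset_eq_length[OF eq] len by simp
    obtain \<pi> where \<pi>: "\<pi> permutes {..<length ys}" "permute_list \<pi> ys = xs"
      using mset_eq_permutation[OF eq] by blast
    have "(\<Sum>\<sigma>\<in>P. M (permute_list \<sigma> xs)) = (\<Sum>\<sigma>\<in>P. M (permute_list (\<pi> \<circ> \<sigma>) ys))"
      using \<pi> len' by (intro sum.cong refl) (auto simp: permute_list_compose P_def)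
    also have "\<dots> = (\<Sum>\<sigma>\<in>P. M (permute_list \<sigma> ys))"
      unfolding P_def using \<pi>(1) len'
      by (intro setum_permutations_compose_left[symmetric]) simp
    finally show ?thesis unfolding S_def by simp
  qed
  ultimately have "sym_multilinear n S" unfolding sym_multilinear_def by blast
  moreover have "f \<phi> = S (replicate n \<phi>)" for \<phi>
  proof -
    have "permute_list \<sigma> (replicate n \<phi>) = replicate n \<phi>" if "\<sigma> \<in> P" for \<sigma>
    proof -
      have "set (permute_list \<sigma> (replicate n \<phi>)) = set (replicate n \<phi>)"
        using that by (intro set_permute_list) (simp add: P_def)
      then show ?thesis
        by (metis length_permute_list length_replicate replicate_length_same in_set_replicate)
    qed
    then have "(\<Sum>\<sigma>\<in>P. M (permute_list \<sigma> (replicate n \<phi>))) = (\<Sum>\<sigma>\<in>P. M (replicate n \<phi>))"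
      by (intro sum.cong) auto
    then show ?thesis by (simp add: S_def f cardP sum_constant_scaleR)
  qed
  ultimately have 1: "polarizes n S f" unfolding polarizes_def by blast
  have "norm (S xs) \<le> C * prod_list (map norm xs)" if len: "length xs = n" for xs
  proof -
    have "norm (M (permute_list \<sigma> xs)) \<le> C * prod_list (map norm xs)" if "\<sigma> \<in> P" for \<sigma>
    proof -
      have "mset (map norm (permute_list \<sigma> xs)) = mset (map norm xs)"
        using that len by (simp add: P_def)
      then have "prod_list (map norm (permute_list \<sigma> xs)) = prod_list (map norm xs)"
        by (metis prod_mset_prod_list)
      then show ?thesis using bound[of "permute_list \<sigma> xs"] len by simp
    qed
    then have "norm (\<Sum>\<sigma>\<in>P. M (permute_list \<sigma> xs)) \<le> (\<Sum>\<sigma>\<in>P. C * prod_list (map norm xs))"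
      by (intro sum_norm_le)
    then show ?thesis by (simp add: S_def cardP divide_simps mult.commute)
  qed
  then have 2: "tensor_bound n S C" using C unfolding tensor_bound_def by blast
  show "f \<in> homog_poly n" "tnorm n f \<le> C" using polarizes_bound[OF 1 2] by auto
qed

section \<open>The action of a vector field on homogeneous components\<close>

text \<open>If \<open>m\<close> polarizes \<open>f\<close>, the derivative is \<open>k * m (v \<phi>, \<phi>, \<dots>, \<phi>)\<close>. Polarizing \<open>v\<close> in the
first slot with the last \<open>l\<close> of \<open>k - 1 + l\<close> arguments gives a multilinear map with the claimed bound, which is then
symmetrized.\<close>

lemma frechet_derivative_homog_poly:
  fixes f :: "'a::real_normed_vector \<Rightarrow> 'b::real_normed_vector" and v :: "'a \<Rightarrow> 'a"
  assumes f: "f \<in> homog_poly k" and v: "v \<in> homog_poly l" and n: "n + 1 = k + l"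
  shows "(\<lambda>\<phi>. frechet_derivative f (at \<phi>) (v \<phi>)) \<in> homog_poly n"
    and "tnorm n (\<lambda>\<phi>. frechet_derivative f (at \<phi>) (v \<phi>)) \<le> real k * tnorm k f * tnorm l v"
proof -
  have "(\<lambda>\<phi>. frechet_derivative f (at \<phi>) (v \<phi>)) \<in> homog_poly n \<and>
    tnorm n (\<lambda>\<phi>. frechet_derivative f (at \<phi>) (v \<phi>)) \<le> real k * tnorm k f * tnorm l v"
  proof (cases k)
    case 0
    have "frechet_derivative f (at \<phi>) = (\<lambda>h. 0)" for \<phi>
      using homog_poly_0_has_derivative f 0 frechet_derivative_at by metis
    then show ?thesis by (simp add: homog_poly_zero tnorm_zero 0)
  next
    case (Suc q)
    have n': "n = q + l" using n Suc by simp
    let ?v = "polar l v" and ?f = "polar k f"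
    have mf: "sym_multilinear k ?f" and mv: "sym_multilinear l ?v"
      using homog_poly_polarizes f v unfolding polarizes_def by blast+
    define M where "M zs = real k *\<^sub>R ?f (?v (drop q zs) # take q zs)" for zs
    have lin: "linear (\<lambda>x. M (zs[i := x]))" if "length zs = n" "i < n" for zs i
    proof (cases "i < q")
      case True
      have "linear (\<lambda>x. ?f ((?v (drop q zs) # take i zs) @ x # drop (Suc i) (take q zs)))"
        using True that n' Suc by (intro sym_multilinear_linear[OF mf]) auto
      moreover have "M (zs[i := x]) = real k *\<^sub>R ?f ((?v (drop q zs) # take i zs) @ x # drop (Suc i) (take q zs))" for x
      proof -
        have "take q (zs[i := x]) = (take q zs)[i := x]" by (rule take_update_swap)
        also have "\<dots> = take i (take q zs) @ x # drop (Suc i) (take q zs)"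
          using True that n' by (intro upd_conv_take_nth_drop) simp
        also have "take i (take q zs) = take i zs" using True by (simp add: min_def)
        finally show ?thesis using True by (simp add: M_def)
      qed
      ultimately show ?thesis by (simp add: linear_compose_scale_right)
    next
      case False
      define ws where "ws = drop q zs"
      have ws: "length ws = l" "i - q < l" using that n' False by (auto simp: ws_def)
      have "linear (\<lambda>x. ?v (take (i - q) ws @ x # drop (Suc (i - q)) ws))"
        using ws by (intro sym_multilinear_linear[OF mv]) auto
      moreover have "linear (\<lambda>y. ?f ([] @ y # take q zs))"
        using that n' Suc by (intro sym_multilinear_linear[OF mf]) auto
      ultimately have "linear (\<lambda>x. ?f ([] @ ?v (take (i - q) ws @ x # drop (Suc (i - q)) ws) # take q zs))"
        using linear_compose[unfolded o_def] by blast
      moreover have "M (zs[i := x]) = real k *\<^sub>R ?f ([] @ ?v (take (i - q) ws @ x # drop (Suc (i - q)) ws) # take q zs)" for x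
      proof -
        have "drop q (zs[i := x]) = ws[i - q := x]"
          using False by (simp add: ws_def drop_update_swap)
        also have "\<dots> = take (i - q) ws @ x # drop (Suc (i - q)) ws"
          using ws by (simp add: upd_conv_take_nth_drop)
        finally show ?thesis using False by (simp add: M_def)
      qed
      ultimately show ?thesis by (simp add: linear_compose_scale_right)
    qed
    have bound: "norm (M zs) \<le> (real k * tnorm k f * tnorm l v) * prod_list (map norm zs)"
      if "length zs = n" for zs
    proof -
      have nn: "0 \<le> prod_list (map norm (take q zs))" by (intro prod_list_nonneg) auto
      have "norm (M zs) = real k * norm (?f (?v (drop q zs) # take q zs))"
        by (simp add: M_def)
      also have "\<dots> \<le> real k * (tnorm k f * (norm (?v (drop q zs)) * prod_list (map norm (take q zs))))"
        using norm_polar_le[OF f, of "?v (drop q zs) # take q zs"] that n' Suc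
        by (intro mult_left_mono) auto
      also have "\<dots> \<le> real k * (tnorm k f * ((tnorm l v * prod_list (map norm (drop q zs))) * prod_list (map norm (take q zs))))"
        using norm_polar_le[OF v, of "drop q zs"] that n' nn tnorm_nonneg[OF f]
        by (intro mult_left_mono mult_right_mono) auto
      also have "\<dots> = (real k * tnorm k f * tnorm l v) * (prod_list (map norm (take q zs)) * prod_list (map norm (drop q zs)))"
        by simp
      also have "prod_list (map norm (take q zs)) * prod_list (map norm (drop q zs)) = prod_list (map norm zs)"
        by (metis append_take_drop_id map_append prod_list.append)
      finally show ?thesis .
    qed
    have "frechet_derivative f (at \<phi>) (v \<phi>) = M (replicate n \<phi>)" for \<phi>
    proof -
      have "frechet_derivative f (at \<phi>) = (\<lambda>h. real k *\<^sub>R ?f (h # replicate q \<phi>))"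
        using frechet_derivative_at[OF homog_poly_has_derivative[of f q \<phi>]] f Suc by simp
      then show ?thesis
        using homog_poly_eval[OF v, of \<phi>] by (simp add: M_def n' min_def)
    qed
    then show ?thesis
      using homog_poly_symmetrize[OF lin bound] tnorm_nonneg[OF f] tnorm_nonneg[OF v] by simp
  qed
  then show "(\<lambda>\<phi>. frechet_derivative f (at \<phi>) (v \<phi>)) \<in> homog_poly n"
    and "tnorm n (\<lambda>\<phi>. frechet_derivative f (at \<phi>) (v \<phi>)) \<le> real k * tnorm k f * tnorm l v"
    by auto
qed

lemma homog_poly_sum:
  assumes "finite A" "\<And>i. i \<in> A \<Longrightarrow> f i \<in> homog_poly p"
  shows "(\<lambda>\<phi>. \<Sum>i\<in>A. f i \<phi>) \<in> homog_poly p"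
    and "tnorm p (\<lambda>\<phi>. \<Sum>i\<in>A. f i \<phi>) \<le> (\<Sum>i\<in>A. tnorm p (f i))"
proof -
  have "(\<lambda>\<phi>. \<Sum>i\<in>A. f i \<phi>) \<in> homog_poly p \<and>
    tnorm p (\<lambda>\<phi>. \<Sum>i\<in>A. f i \<phi>) \<le> (\<Sum>i\<in>A. tnorm p (f i))"
    using assms
  proof (induction A rule: finite_induct)
    case (insert a A)
    then show ?case
      using homog_poly_lincomb[of "f a" p "\<lambda>\<phi>. \<Sum>i\<in>A. f i \<phi>" 1 1] by simp
  qed (simp add: homog_poly_zero tnorm_zero)
  then show "(\<lambda>\<phi>. \<Sum>i\<in>A. f i \<phi>) \<in> homog_poly p"
    and "tnorm p (\<lambda>\<phi>. \<Sum>i\<in>A. f i \<phi>) \<le> (\<Sum>i\<in>A. tnorm p (f i))" by auto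
qed

text \<open>The coefficients of the power series \<open>X(z) F'(z)\<close>, for \<open>X\<close> with coefficients \<open>x\<close> and \<open>F\<close> with
coefficients \<open>F\<close>.\<close>

definition transport :: "(nat \<Rightarrow> real) \<Rightarrow> (nat \<Rightarrow> real) \<Rightarrow> nat \<Rightarrow> real" where
  "transport x F p = (\<Sum>j\<le>p. diffs F j * x (p - j))"

lemma transport_mono:
  assumes "\<And>p. 0 \<le> F p" "\<And>p. F p \<le> G p" "\<And>p. 0 \<le> x p" "\<And>p. x p \<le> y p"
  shows "transport x F p \<le> transport y G p"
proof -
  have "0 \<le> G p" for p using assms(1,2) order_trans by blast
  then show ?thesis
    unfolding transport_def diffs_def using assms
    by (intro sum_mono mult_mono mult_left_mono) auto
qed

lemma transport_nonneg:
  assumes "\<And>p. 0 \<le> F p" "\<And>p. 0 \<le> x p"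
  shows "0 \<le> transport x F p"
  unfolding transport_def diffs_def using assms by (intro sum_nonneg mult_nonneg_nonneg) auto

lemma transport_sums:
  assumes F: "\<And>p. 0 \<le> F p" and x: "\<And>p. 0 \<le> x p" and r: "0 \<le> r"
    and sF: "summable (\<lambda>p. diffs F p * r ^ p)" and sx: "summable (\<lambda>p. x p * r ^ p)"
  shows "(\<lambda>p. transport x F p * r ^ p) sums ((\<Sum>p. diffs F p * r ^ p) * (\<Sum>p. x p * r ^ p))"
proof -
  have "(\<lambda>p. \<Sum>j\<le>p. (diffs F j * r ^ j) * (x (p - j) * r ^ (p - j))) sums
    ((\<Sum>p. diffs F p * r ^ p) * (\<Sum>p. x p * r ^ p))"
    using sF sx F x r by (intro Cauchy_product_sums) (simp_all add: diffs_def abs_mult)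
  moreover have "(\<Sum>j\<le>p. (diffs F j * r ^ j) * (x (p - j) * r ^ (p - j))) = transport x F p * r ^ p" for p
    unfolding transport_def sum_distrib_right
  proof (intro sum.cong refl)
    fix j assume "j \<in> {..p}"
    then have "r ^ p = r ^ j * r ^ (p - j)" by (simp flip: power_add)
    then show "(diffs F j * r ^ j) * (x (p - j) * r ^ (p - j)) = diffs F j * x (p - j) * r ^ p" by simp
  qed
  ultimately show ?thesis by simp
qed

lemma formal_seriesD: "f \<in> formal_series \<Longrightarrow> f p \<in> homog_poly p"
  unfolding formal_series_def by blast

lemma vf_act_formal_series:
  assumes V: "V \<in> formal_series" and f: "f \<in> formal_series"
  shows "vf_act V f \<in> formal_series"
    and "tnorm p (vf_act V f p) \<le> transport (\<lambda>p. tnorm p (V p)) (\<lambda>p. tnorm p (f p)) p"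
proof -
  have h: "(\<lambda>\<phi>. frechet_derivative (f k) (at \<phi>) (V (p + 1 - k) \<phi>)) \<in> homog_poly p"
     "tnorm p (\<lambda>\<phi>. frechet_derivative (f k) (at \<phi>) (V (p + 1 - k) \<phi>))
       \<le> real k * tnorm k (f k) * tnorm (p + 1 - k) (V (p + 1 - k))" if "k \<le> p + 1" for k p
    using frechet_derivative_homog_poly[OF formal_seriesD[OF f] formal_seriesD[OF V], of p k "p + 1 - k"] that
    by auto
  show "vf_act V f \<in> formal_series"
    unfolding formal_series_def vf_act_def using h(1)
    by (intro CollectI allI homog_poly_sum(1)) auto
  have "tnorm p (vf_act V f p) \<le> (\<Sum>k\<le>p + 1. real k * tnorm k (f k) * tnorm (p + 1 - k) (V (p + 1 - k)))"
    unfolding vf_act_def using h[of _ p]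
    by (intro order_trans[OF homog_poly_sum(2)] sum_mono) auto
  also have "\<dots> = transport (\<lambda>p. tnorm p (V p)) (\<lambda>p. tnorm p (f p)) p"
    unfolding transport_def diffs_def Suc_eq_plus1[symmetric] sum.atMost_Suc_shift by simp
  finally show "tnorm p (vf_act V f p) \<le> transport (\<lambda>p. tnorm p (V p)) (\<lambda>p. tnorm p (f p)) p" .
qed

lemma fs_lincomb_formal_series:
  "f \<in> formal_series \<Longrightarrow> g \<in> formal_series \<Longrightarrow> fs_lincomb a f b g \<in> formal_series"
  unfolding formal_series_def fs_lincomb_def using homog_poly_lincomb by blast

lemma fs_diff_lincomb: "fs_diff f g = fs_lincomb 1 f (- 1) g"
  by (simp add: fs_diff_def fs_lincomb_def)

lemma fs_diff_formal_series:
  "f \<in> formal_series \<Longrightarrow> g \<in> formal_series \<Longrightarrow> fs_diff f g \<in> formal_series"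
  unfolding fs_diff_lincomb by (rule fs_lincomb_formal_series)

lemma vf_act_lincomb:
  assumes f: "f \<in> formal_series" and g: "g \<in> formal_series"
  shows "vf_act V (fs_lincomb a f b g) = fs_lincomb a (vf_act V f) b (vf_act V g)"
proof (intro ext)
  fix p \<phi>
  have "frechet_derivative (fs_lincomb a f b g k) (at \<phi>) h
    = a *\<^sub>R frechet_derivative (f k) (at \<phi>) h + b *\<^sub>R frechet_derivative (g k) (at \<phi>) h" for k h
  proof -
    have "(f k has_derivative frechet_derivative (f k) (at \<phi>)) (at \<phi>)"
      "(g k has_derivative frechet_derivative (g k) (at \<phi>)) (at \<phi>)"
      using homog_poly_differentiable[OF formal_seriesD[OF f]] homog_poly_differentiable[OF formal_seriesD[OF g]]
      by (simp_all add: frechet_derivative_works[symmetric])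
    then have "(fs_lincomb a f b g k has_derivative (\<lambda>h. a *\<^sub>R frechet_derivative (f k) (at \<phi>) h + b *\<^sub>R frechet_derivative (g k) (at \<phi>) h)) (at \<phi>)"
      unfolding fs_lincomb_def by (intro derivative_intros)
    then show ?thesis using frechet_derivative_at by metis
  qed
  then show "vf_act V (fs_lincomb a f b g) p \<phi> = fs_lincomb a (vf_act V f) b (vf_act V g) p \<phi>"
    unfolding vf_act_def fs_lincomb_def by (simp only: sum.distrib scaleR_sum_right)
qed

section \<open>Formal series with a given radius\<close>

lemma fs_norm_eq: "fs_norm r f = (\<Sum>p. ennreal (tnorm p (f p) * r ^ p))"
  by (simp add: majorant_def)

lemma fs_norm_tnorm_le: "ennreal (tnorm p (f p) * r ^ p) \<le> fs_norm r f"
proof -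
  have "(\<Sum>p\<in>{p}. ennreal (tnorm p (f p) * r ^ p)) \<le> fs_norm r f"
    unfolding fs_norm_eq by (intro sum_le_suminf) auto
  then show ?thesis by simp
qed

lemma FS_iff_summable:
  assumes "0 \<le> r"
  shows "f \<in> FS r \<longleftrightarrow> f \<in> formal_series \<and> summable (\<lambda>p. tnorm p (f p) * r ^ p)"
proof -
  have "fs_norm r f < \<infinity> \<longleftrightarrow> summable (\<lambda>p. tnorm p (f p) * r ^ p)" if "f \<in> formal_series"
  proof -
    have nn: "0 \<le> tnorm p (f p) * r ^ p" for p
      using tnorm_nonneg[OF formal_seriesD[OF that]] assms by simp
    show ?thesis
    proof
      assume "fs_norm r f < \<infinity>"
      then show "summable (\<lambda>p. tnorm p (f p) * r ^ p)"
        unfolding fs_norm_eq using nn by (intro summable_suminf_not_top) auto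
    next
      assume "summable (\<lambda>p. tnorm p (f p) * r ^ p)"
      then show "fs_norm r f < \<infinity>"
        unfolding fs_norm_eq using nn by (subst suminf_ennreal2) auto
    qed
  qed
  then show ?thesis unfolding FS_def by blast
qed

lemma fs_norm_FS:
  assumes "0 \<le> r" "f \<in> FS r"
  shows "fs_norm r f = ennreal (\<Sum>p. tnorm p (f p) * r ^ p)"
proof -
  have "f \<in> formal_series" "summable (\<lambda>p. tnorm p (f p) * r ^ p)"
    using assms FS_iff_summable by auto
  then show ?thesis unfolding fs_norm_eq
    using assms(1) by (intro suminf_ennreal2) (auto intro!: mult_nonneg_nonneg tnorm_nonneg formal_seriesD)
qed

lemma FS_formal_series: "f \<in> FS r \<Longrightarrow> f \<in> formal_series"
  unfolding FS_def by blast

lemma FS_fs_norm: "f \<in> FS r \<Longrightarrow> fs_norm r f < \<infinity>"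
  unfolding FS_def by blast

lemma fs_norm_lincomb_le:
  assumes f: "f \<in> formal_series" and g: "g \<in> formal_series" and r: "0 \<le> r"
  shows "fs_norm r (fs_lincomb a f b g) \<le> ennreal \<bar>a\<bar> * fs_norm r f + ennreal \<bar>b\<bar> * fs_norm r g"
proof -
  have "fs_norm r (fs_lincomb a f b g)
     \<le> (\<Sum>p. ennreal \<bar>a\<bar> * ennreal (tnorm p (f p) * r ^ p) + ennreal \<bar>b\<bar> * ennreal (tnorm p (g p) * r ^ p))"
    unfolding fs_norm_eq
  proof (intro suminf_le summableI)
    fix p
    have nn: "0 \<le> tnorm p (f p)" "0 \<le> tnorm p (g p)"
      using tnorm_nonneg formal_seriesD f g by blast+
    have "tnorm p (fs_lincomb a f b g p) * r ^ p \<le> (\<bar>a\<bar> * tnorm p (f p) + \<bar>b\<bar> * tnorm p (g p)) * r ^ p"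
      using homog_poly_lincomb(2)[OF formal_seriesD[OF f] formal_seriesD[OF g], of p a b] r
      by (intro mult_right_mono) (simp_all add: fs_lincomb_def)
    then have "ennreal (tnorm p (fs_lincomb a f b g p) * r ^ p) \<le> ennreal (\<bar>a\<bar> * (tnorm p (f p) * r ^ p) + \<bar>b\<bar> * (tnorm p (g p) * r ^ p))"
      by (intro ennreal_leI) (simp add: algebra_simps)
    also have "\<dots> = ennreal \<bar>a\<bar> * ennreal (tnorm p (f p) * r ^ p) + ennreal \<bar>b\<bar> * ennreal (tnorm p (g p) * r ^ p)"
      using nn r by (simp add: ennreal_plus ennreal_mult)
    finally show "ennreal (tnorm p (fs_lincomb a f b g p) * r ^ p)
      \<le> ennreal \<bar>a\<bar> * ennreal (tnorm p (f p) * r ^ p) + ennreal \<bar>b\<bar> * ennreal (tnorm p (g p) * r ^ p)" .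
  qed
  also have "\<dots> = ennreal \<bar>a\<bar> * fs_norm r f + ennreal \<bar>b\<bar> * fs_norm r g"
    unfolding fs_norm_eq by (simp add: suminf_add summableI ennreal_suminf_cmult flip: suminf_add)
  finally show ?thesis .
qed

lemma fs_lincomb_FS:
  assumes "f \<in> FS r" "g \<in> FS r" "0 \<le> r"
  shows "fs_lincomb a f b g \<in> FS r"
proof -
  have "ennreal \<bar>a\<bar> * fs_norm r f + ennreal \<bar>b\<bar> * fs_norm r g < \<infinity>"
    using assms unfolding FS_def by (auto simp: ennreal_mult_less_top)
  then show ?thesis
    using fs_norm_lincomb_le[of f g r a b] assms fs_lincomb_formal_series unfolding FS_def
    by (auto intro: le_less_trans)
qed

lemma fs_diff_FS: "f \<in> FS r \<Longrightarrow> g \<in> FS r \<Longrightarrow> 0 \<le> r \<Longrightarrow> fs_diff f g \<in> FS r"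
  unfolding fs_diff_lincomb by (rule fs_lincomb_FS)

lemma fs_norm_triangle:
  assumes "f \<in> formal_series" "g \<in> formal_series" "h \<in> formal_series" "0 \<le> r"
  shows "fs_norm r (fs_diff f h) \<le> fs_norm r (fs_diff f g) + fs_norm r (fs_diff g h)"
proof -
  have "fs_diff f h = fs_lincomb 1 (fs_diff f g) 1 (fs_diff g h)"
    by (simp add: fs_diff_def fs_lincomb_def)
  then show ?thesis
    using fs_norm_lincomb_le[OF fs_diff_formal_series[OF assms(1,2)] fs_diff_formal_series[OF assms(2,3)] assms(4), of 1 1]
    by simp
qed

lemma fs_norm_diff_commute:
  assumes "f \<in> formal_series" "g \<in> formal_series" "0 \<le> r"
  shows "fs_norm r (fs_diff f g) = fs_norm r (fs_diff g f)"
proof -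
  have "fs_norm r (fs_diff f g) \<le> fs_norm r (fs_diff g f)"
    if "f \<in> formal_series" "g \<in> formal_series" for f g :: "('a, 'b) fseries"
  proof -
    have "fs_diff f g = fs_lincomb (- 1) (fs_diff g f) 0 (fs_diff g f)"
      by (simp add: fs_diff_def fs_lincomb_def)
    then show ?thesis
      using fs_norm_lincomb_le[OF fs_diff_formal_series[OF that(2,1)] fs_diff_formal_series[OF that(2,1)] assms(3), of "- 1" 0]
      by simp
  qed
  then show ?thesis using assms by (intro order_antisym) auto
qed

lemma zero_FS: "(\<lambda>p \<phi>. 0) \<in> FS r" and fs_norm_zero: "fs_norm r (\<lambda>p \<phi>. 0) = 0"
  by (simp_all add: FS_def formal_series_def homog_poly_zero fs_norm_eq tnorm_zero)

lemma fs_norm_eq_0_iff: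
  assumes "f \<in> formal_series" "0 < r"
  shows "fs_norm r f = 0 \<longleftrightarrow> f = (\<lambda>p \<phi>. 0)"
proof
  assume 0: "fs_norm r f = 0"
  show "f = (\<lambda>p \<phi>. 0)"
  proof (intro ext)
    fix p \<phi>
    have "tnorm p (f p) * r ^ p \<le> 0"
      using fs_norm_tnorm_le[of p f r] 0 by (simp add: ennreal_eq_0_iff)
    then have "tnorm p (f p) \<le> 0" using assms(2) by (simp add: mult_le_0_iff power_le_zero_eq)
    then show "f p \<phi> = 0"
      using homog_poly_eq_zero[OF formal_seriesD[OF assms(1)]] tnorm_nonneg[OF formal_seriesD[OF assms(1)]]
      by (simp add: order_antisym)
  qed
qed (simp add: fs_norm_zero)

lemma
  assumes "0 \<le> r" "r \<le> r'"
  shows fs_norm_mono: "f \<in> formal_series \<Longrightarrow> fs_norm r f \<le> fs_norm r' f"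
    and FS_mono: "f \<in> FS r' \<Longrightarrow> f \<in> FS r"
proof -
  show *: "fs_norm r f \<le> fs_norm r' f" if "f \<in> formal_series"
    unfolding fs_norm_eq using assms tnorm_nonneg[OF formal_seriesD[OF that]]
    by (intro suminf_le ennreal_leI mult_left_mono power_mono) auto
  show "f \<in> FS r" if "f \<in> FS r'"
    using * that unfolding FS_def by (auto intro: le_less_trans)
qed

lemma FS_summable_diffs:
  assumes "f \<in> FS r'" "0 < r" "r < r'"
  shows "summable (\<lambda>p. diffs (\<lambda>p. tnorm p (f p)) p * r ^ p)"
proof (rule termdiff_converges[where K = r'])
  fix z :: real assume z: "norm z < r'"
  have s: "summable (\<lambda>p. tnorm p (f p) * r' ^ p)" and f: "f \<in> formal_series"
    using assms FS_iff_summable[of r'] by auto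
  show "summable (\<lambda>p. tnorm p (f p) * z ^ p)"
  proof (rule summable_comparison_test'[OF s])
    fix p :: nat
    have "\<bar>z\<bar> ^ p \<le> r' ^ p" using z by (intro power_mono) auto
    then show "norm (tnorm p (f p) * z ^ p) \<le> tnorm p (f p) * r' ^ p"
      using tnorm_nonneg[OF formal_seriesD[OF f]] by (simp add: abs_mult power_abs mult_left_mono)
  qed
qed (use assms in auto)

lemma FS_imp_FSd:
  assumes "f \<in> FS r'" "0 < r" "r < r'"
  shows "f \<in> FSd 1 r"
proof -
  have f: "f \<in> formal_series" using assms(1) by (rule FS_formal_series)
  have "majorant 1 f r = ennreal (\<Sum>p. diffs (\<lambda>p. tnorm p (f p)) p * r ^ p)"
    unfolding majorant_def using FS_summable_diffs[OF assms] assms tnorm_nonneg[OF formal_seriesD[OF f]]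
    by (simp, intro suminf_ennreal2) (auto simp: diffs_def)
  then show ?thesis
    using FS_mono[of r r' f] assms unfolding FSd_def by auto
qed

text \<open>The derivative is paid for by shrinking the radius: the ratios \<open>(p + 1) r\<^sup>p / r'\<^sup>(\<^sup>p\<^sup>+\<^sup>1\<^sup>)\<close> are bounded.
The constant depends on the majorant \<open>x\<close> only, hence is uniform over a normal family.\<close>

lemma vf_act_bounded:
  assumes r: "0 < r" "r < r'" and x: "\<And>p. 0 \<le> x p" and sx: "summable (\<lambda>p. x p * r ^ p)"
  obtains K where "0 \<le> K"
    "\<And>V (f :: ('a::real_normed_vector, 'b::real_normed_vector) fseries).
       V \<in> formal_series \<Longrightarrow> (\<And>p. tnorm p (V p) \<le> x p) \<Longrightarrow> f \<in> FS r' \<Longrightarrow>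
       vf_act V f \<in> FS r \<and> fs_norm r (vf_act V f) \<le> ennreal K * fs_norm r' f"
proof -
  have "(\<lambda>p. real (Suc p) * (r / r') ^ p) \<longlonglongrightarrow> 0"
  proof -
    have "summable (\<lambda>p. diffs (\<lambda>p. 1) p * (r / r') ^ p)"
      using r by (intro termdiff_converges[where K = 1]) (auto intro: summable_geometric)
    then show ?thesis by (simp add: diffs_def summable_LIMSEQ_zero)
  qed
  then have "Bseq (\<lambda>p. real (Suc p) * (r / r') ^ p)" by (intro convergent_imp_Bseq convergentI)
  then obtain B where B: "B > 0" "\<And>p. norm (real (Suc p) * (r / r') ^ p) \<le> B" unfolding Bseq_def by blast
  define D where "D = B / r'"
  have D: "D \<ge> 0" "real (Suc p) * r ^ p \<le> D * r' ^ Suc p" for p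
  proof -
    show "D \<ge> 0" using B r by (simp add: D_def)
    have "real (Suc p) * (r / r') ^ p \<le> B" using B(2)[of p] r by simp
    then show "real (Suc p) * r ^ p \<le> D * r' ^ Suc p" using r by (simp add: D_def field_simps)
  qed
  define S where "S = (\<Sum>p. x p * r ^ p)"
  have S: "S \<ge> 0" unfolding S_def using sx x r by (intro suminf_nonneg) auto
  show thesis
  proof (rule that[of "D * S"])
    fix V :: "('a, 'a) fseries" and f :: "('a, 'b) fseries"
    assume V: "V \<in> formal_series" "\<And>p. tnorm p (V p) \<le> x p" and f: "f \<in> FS r'"
    define F where "F = (\<lambda>p. tnorm p (f p))"
    have ff: "f \<in> formal_series" using f by (rule FS_formal_series)
    have F: "0 \<le> F p" for p unfolding F_def using tnorm_nonneg[OF formal_seriesD[OF ff]] .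
    have sF: "summable (\<lambda>p. F p * r' ^ p)" using f r FS_iff_summable[of r' f] by (simp add: F_def)
    have sd: "summable (\<lambda>p. diffs F p * r ^ p)"
      using FS_summable_diffs[OF f r] by (simp add: F_def)
    have le: "tnorm p (vf_act V f p) * r ^ p \<le> transport x F p * r ^ p" for p
    proof (intro mult_right_mono order_trans[OF vf_act_formal_series(2)[OF V(1) ff]])
      show "transport (\<lambda>p. tnorm p (V p)) (\<lambda>p. tnorm p (f p)) p \<le> transport x F p"
        using F V tnorm_nonneg[OF formal_seriesD[OF V(1)]] unfolding F_def by (intro transport_mono) auto
    qed (use r in simp)
    have sums: "(\<lambda>p. transport x F p * r ^ p) sums ((\<Sum>p. diffs F p * r ^ p) * S)"
      unfolding S_def using F x r sd sx by (intro transport_sums) auto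
    have "(\<Sum>p. diffs F p * r ^ p) \<le> (\<Sum>p. D * (F (Suc p) * r' ^ Suc p))"
    proof (intro suminf_le sd summable_mult)
      show "summable (\<lambda>p. F (Suc p) * r' ^ Suc p)" using sF by (subst summable_Suc_iff)
      show "diffs F p * r ^ p \<le> D * (F (Suc p) * r' ^ Suc p)" for p
        using mult_left_mono[OF D(2)[of p] F[of "Suc p"]] by (simp add: diffs_def mult_ac)
    qed
    also have "\<dots> = D * (\<Sum>p. F (Suc p) * r' ^ Suc p)"
      using sF by (intro suminf_mult) (subst summable_Suc_iff)
    also have "\<dots> \<le> D * (\<Sum>p. F p * r' ^ p)"
      using suminf_split_head[OF sF] F[of 0] D by (intro mult_left_mono) auto
    finally have dle: "(\<Sum>p. diffs F p * r ^ p) \<le> D * (\<Sum>p. F p * r' ^ p)" .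
    have s: "summable (\<lambda>p. tnorm p (vf_act V f p) * r ^ p)"
      using le r tnorm_nonneg[OF formal_seriesD[OF vf_act_formal_series(1)[OF V(1) ff]]]
      by (intro summable_comparison_test'[OF sums_summable[OF sums]]) auto
    then have mem: "vf_act V f \<in> FS r"
      using FS_iff_summable[of r "vf_act V f"] r vf_act_formal_series(1)[OF V(1) ff] by auto
    have "(\<Sum>p. tnorm p (vf_act V f p) * r ^ p) \<le> (\<Sum>p. transport x F p * r ^ p)"
      using s sums_summable[OF sums] le by (intro suminf_le) auto
    also have "\<dots> \<le> D * S * (\<Sum>p. F p * r' ^ p)"
      using mult_right_mono[OF dle S] sums_unique[OF sums] by (simp add: mult_ac)
    finally have "fs_norm r (vf_act V f) \<le> ennreal (D * S * (\<Sum>p. F p * r' ^ p))"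
      using mem r by (simp add: fs_norm_FS ennreal_leI)
    also have "\<dots> = ennreal (D * S) * fs_norm r' f"
      using f r D S F sF by (simp add: fs_norm_FS F_def ennreal_mult suminf_nonneg)
    finally show "vf_act V f \<in> FS r \<and> fs_norm r (vf_act V f) \<le> ennreal (D * S) * fs_norm r' f"
      using mem by simp
  qed (use D S in simp)
qed

section \<open>Strong measurability\<close>

lemma (in complete_measure) borel_measurable_AE_LIMSEQ:
  fixes u :: "nat \<Rightarrow> 'a \<Rightarrow> real"
  assumes u: "\<And>i. u i \<in> borel_measurable M" and lim: "AE x in M. (\<lambda>i. u i x) \<longlonglongrightarrow> f x"
  shows "f \<in> borel_measurable M"
proof (rule measurableI)
  fix A :: "real set" assume A: "A \<in> sets borel"
  define l where "l x = lim (\<lambda>i. u i x)" for x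
  have l: "l \<in> borel_measurable M" unfolding l_def using u by measurable
  have "AE x in M. l x = f x" using lim by eventually_elim (simp add: l_def limI)
  then show "f -` A \<inter> space M \<in> sets M"
    by (intro in_sets_AE[OF _ measurable_sets[OF l A]]) auto
qed simp

text \<open>Scalar functionals through which strong measurability in \<open>FS r\<close> is tested. A Lipschitz bound is all that
is used of point evaluations, coefficient norms and distances.\<close>

definition fs_lipschitz :: "real \<Rightarrow> (('a::real_normed_vector, 'b::real_normed_vector) fseries \<Rightarrow> real) \<Rightarrow> bool" where
  "fs_lipschitz r \<Phi> \<longleftrightarrow>
    (\<exists>K\<ge>0. \<forall>f\<in>FS r. \<forall>h\<in>FS r. ennreal \<bar>\<Phi> f - \<Phi> h\<bar> \<le> ennreal K * fs_norm r (fs_diff f h))"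

lemma ennreal_tendsto_0_bound:
  fixes u :: "'c \<Rightarrow> real"
  assumes "(e \<longlongrightarrow> 0) F" "\<forall>\<^sub>F i in F. ennreal \<bar>l - u i\<bar> \<le> ennreal K * e i"
  shows "(u \<longlongrightarrow> l) F"
proof -
  have "((\<lambda>i. ennreal K * e i) \<longlongrightarrow> ennreal K * 0) F"
    by (intro ennreal_tendsto_cmult assms(1)) simp
  then have "((\<lambda>i. ennreal \<bar>l - u i\<bar>) \<longlongrightarrow> ennreal 0) F"
    using assms(2) by (intro tendsto_sandwich[OF _ assms(2) tendsto_const]) (simp_all add: always_eventually)
  then have "((\<lambda>i. \<bar>l - u i\<bar>) \<longlongrightarrow> 0) F"
    by (subst (asm) tendsto_ennreal_iff) auto
  then have "((\<lambda>i. l - u i) \<longlongrightarrow> 0) F" by (simp add: tendsto_rabs_zero_iff)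
  then have "((\<lambda>i. l - (l - u i)) \<longlongrightarrow> l - 0) F" by (intro tendsto_intros)
  then show ?thesis by simp
qed

lemma fs_measurable_FS: "fs_measurable M r g \<Longrightarrow> x \<in> space M \<Longrightarrow> g x \<in> FS r"
  unfolding fs_measurable_def by blast

lemma fs_measurable_lipschitz:
  assumes "complete_measure M" "fs_measurable M r g" "fs_lipschitz r \<Phi>"
  shows "(\<lambda>x. \<Phi> (g x)) \<in> borel_measurable M"
proof -
  interpret complete_measure M by fact
  obtain s where s: "\<And>i. simple_function M (s i)" "\<And>i. s i \<in> space M \<rightarrow> FS r"
    and lim: "AE x in M. (\<lambda>i. fs_norm r (fs_diff (g x) (s i x))) \<longlonglongrightarrow> 0"
    and g: "g \<in> space M \<rightarrow> FS r"
    using assms(2) unfolding fs_measurable_def by blast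
  obtain K where K: "\<And>f h. f \<in> FS r \<Longrightarrow> h \<in> FS r \<Longrightarrow> ennreal \<bar>\<Phi> f - \<Phi> h\<bar> \<le> ennreal K * fs_norm r (fs_diff f h)"
    using assms(3) unfolding fs_lipschitz_def by blast
  show ?thesis
  proof (rule borel_measurable_AE_LIMSEQ)
    show "(\<lambda>x. \<Phi> (s i x)) \<in> borel_measurable M" for i
      using simple_function_compose1[OF s(1), of \<Phi> i] by (rule borel_measurable_simple_function)
    show "AE x in M. (\<lambda>i. \<Phi> (s i x)) \<longlonglongrightarrow> \<Phi> (g x)"
      using lim AE_space
    proof eventually_elim
      case (elim x)
      have "ennreal \<bar>\<Phi> (g x) - \<Phi> (s i x)\<bar> \<le> ennreal K * fs_norm r (fs_diff (g x) (s i x))" for i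
        using g s(2)[of i] elim(2) by (intro K) auto
      then show ?case by (intro ennreal_tendsto_0_bound[OF elim(1)] always_eventually allI)
    qed
  qed
qed

lemma tnorm_le_fs_norm:
  assumes "0 < r" "f \<in> formal_series"
  shows "ennreal (tnorm p (f p)) \<le> ennreal (1 / r ^ p) * fs_norm r f"
proof -
  have nn: "0 \<le> tnorm p (f p)" by (rule tnorm_nonneg[OF formal_seriesD[OF assms(2)]])
  have "ennreal (tnorm p (f p)) = ennreal (1 / r ^ p) * ennreal (tnorm p (f p) * r ^ p)"
    using assms nn by (simp flip: ennreal_mult)
  also have "\<dots> \<le> ennreal (1 / r ^ p) * fs_norm r f"
    by (intro mult_left_mono fs_norm_tnorm_le) simp
  finally show ?thesis .
qed

lemma fs_lipschitz_eval:
  fixes \<phi> :: "'a::real_normed_vector"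
  assumes "0 < r"
  shows "fs_lipschitz r (\<lambda>f. f p \<phi> :: real)"
  unfolding fs_lipschitz_def
proof (intro exI[of _ "norm \<phi> ^ p * (1 / r ^ p)"] conjI ballI)
  fix f h :: "('a, real) fseries" assume fh: "f \<in> FS r" "h \<in> FS r"
  have d: "fs_diff f h \<in> formal_series" using fh FS_formal_series fs_diff_formal_series by blast
  have "ennreal \<bar>f p \<phi> - h p \<phi>\<bar> \<le> ennreal (tnorm p (fs_diff f h p) * norm \<phi> ^ p)"
    using norm_homog_poly_le[OF formal_seriesD[OF d], of p \<phi>] by (intro ennreal_leI) (simp add: fs_diff_def)
  also have "\<dots> = ennreal (norm \<phi> ^ p) * ennreal (tnorm p (fs_diff f h p))"
    by (simp add: mult.commute ennreal_mult tnorm_nonneg[OF formal_seriesD[OF d]])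
  also have "\<dots> \<le> ennreal (norm \<phi> ^ p) * (ennreal (1 / r ^ p) * fs_norm r (fs_diff f h))"
    by (intro mult_left_mono tnorm_le_fs_norm assms d) simp
  also have "\<dots> = ennreal (norm \<phi> ^ p * (1 / r ^ p)) * fs_norm r (fs_diff f h)"
    using assms by (subst ennreal_mult) (auto simp: mult.assoc)
  finally show "ennreal \<bar>f p \<phi> - h p \<phi>\<bar> \<le> ennreal (norm \<phi> ^ p * (1 / r ^ p)) * fs_norm r (fs_diff f h)" .
qed (use assms in simp)

lemma tnorm_diff_le:
  assumes "f \<in> homog_poly p" "h \<in> homog_poly p"
  shows "\<bar>tnorm p f - tnorm p h\<bar> \<le> tnorm p (\<lambda>\<phi>. f \<phi> - h \<phi>)"
proof -
  have d: "(\<lambda>\<phi>. f \<phi> - h \<phi>) \<in> homog_poly p" using homog_poly_lincomb(1)[OF assms, of 1 "-1"] by simp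
  have "tnorm p f \<le> tnorm p (\<lambda>\<phi>. f \<phi> - h \<phi>) + tnorm p h"
    using homog_poly_lincomb(2)[OF d assms(2), of 1 1] by simp
  moreover have "tnorm p h \<le> tnorm p f + tnorm p (\<lambda>\<phi>. f \<phi> - h \<phi>)"
    using homog_poly_lincomb(2)[OF assms(1) d, of 1 "-1"] by simp
  ultimately show ?thesis by linarith
qed

lemma fs_lipschitz_tnorm:
  assumes "0 < r"
  shows "fs_lipschitz r (\<lambda>f. tnorm p (f p))"
  unfolding fs_lipschitz_def
proof (intro exI[of _ "1 / r ^ p"] conjI ballI)
  fix f h :: "('a, 'b) fseries" assume fh: "f \<in> FS r" "h \<in> FS r"
  have d: "fs_diff f h \<in> formal_series" using fh FS_formal_series fs_diff_formal_series by blast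
  have "ennreal \<bar>tnorm p (f p) - tnorm p (h p)\<bar> \<le> ennreal (tnorm p (fs_diff f h p))"
    using tnorm_diff_le[of "f p" p "h p"] fh FS_formal_series formal_seriesD unfolding fs_diff_def
    by (intro ennreal_leI) blast
  also have "\<dots> \<le> ennreal (1 / r ^ p) * fs_norm r (fs_diff f h)"
    by (intro tnorm_le_fs_norm assms d)
  finally show "ennreal \<bar>tnorm p (f p) - tnorm p (h p)\<bar> \<le> ennreal (1 / r ^ p) * fs_norm r (fs_diff f h)" .
qed (use assms in simp)

lemma fs_norm_diff_lipschitz:
  assumes "f \<in> FS r" "h \<in> FS r" "c \<in> FS r" "0 \<le> r"
  shows "ennreal \<bar>enn2real (fs_norm r (fs_diff f c)) - enn2real (fs_norm r (fs_diff h c))\<bar>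
    \<le> fs_norm r (fs_diff f h)"
proof -
  have le: "enn2real (fs_norm r (fs_diff f c)) \<le> enn2real (fs_norm r (fs_diff f h)) + enn2real (fs_norm r (fs_diff h c))"
    if "f \<in> FS r" "h \<in> FS r" for f h
  proof -
    have fin: "fs_norm r (fs_diff f h) < \<infinity>" "fs_norm r (fs_diff h c) < \<infinity>"
      using that assms fs_diff_FS FS_fs_norm by blast+
    have "fs_norm r (fs_diff f c) \<le> fs_norm r (fs_diff f h) + fs_norm r (fs_diff h c)"
      using that assms FS_formal_series by (intro fs_norm_triangle) blast+
    then have "enn2real (fs_norm r (fs_diff f c)) \<le> enn2real (fs_norm r (fs_diff f h) + fs_norm r (fs_diff h c))"
      using fin by (intro enn2real_mono) auto
    then show ?thesis using fin by (simp add: enn2real_plus)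
  qed
  have "enn2real (fs_norm r (fs_diff h f)) = enn2real (fs_norm r (fs_diff f h))"
    using fs_norm_diff_commute[of h f r] assms FS_formal_series by metis
  then have "\<bar>enn2real (fs_norm r (fs_diff f c)) - enn2real (fs_norm r (fs_diff h c))\<bar> \<le> enn2real (fs_norm r (fs_diff f h))"
    using le[OF assms(1,2)] le[OF assms(2,1)] by linarith
  then have "ennreal \<bar>enn2real (fs_norm r (fs_diff f c)) - enn2real (fs_norm r (fs_diff h c))\<bar> \<le> ennreal (enn2real (fs_norm r (fs_diff f h)))"
    by (rule ennreal_leI)
  also have "\<dots> = fs_norm r (fs_diff f h)"
    using FS_fs_norm[OF fs_diff_FS[OF assms(1,2,4)]] by simp
  finally show ?thesis .
qed

lemma fs_lipschitz_norm_diff: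
  assumes "c \<in> FS r" "0 \<le> r"
  shows "fs_lipschitz r (\<lambda>f. enn2real (fs_norm r (fs_diff f c)))"
  unfolding fs_lipschitz_def using fs_norm_diff_lipschitz[OF _ _ assms] by (intro exI[of _ 1]) auto

lemma fs_norm_diff_measurable:
  assumes "complete_measure M" "fs_measurable M r g" "c \<in> FS r" "0 \<le> r"
  shows "(\<lambda>x. fs_norm r (fs_diff (g x) c)) \<in> borel_measurable M"
proof -
  have "(\<lambda>x. ennreal (enn2real (fs_norm r (fs_diff (g x) c)))) \<in> borel_measurable M"
    using fs_measurable_lipschitz[OF assms(1,2) fs_lipschitz_norm_diff[OF assms(3,4)]] by measurable
  moreover have "ennreal (enn2real (fs_norm r (fs_diff (g x) c))) = fs_norm r (fs_diff (g x) c)" if "x \<in> space M" for x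
    using FS_fs_norm[OF fs_diff_FS[OF fs_measurable_FS[OF assms(2) that] assms(3,4)]] by simp
  ultimately show ?thesis by (simp cong: measurable_cong)
qed

lemma fs_norm_measurable:
  assumes "complete_measure M" "fs_measurable M r g" "0 \<le> r"
  shows "(\<lambda>x. fs_norm r (g x)) \<in> borel_measurable M"
  using fs_norm_diff_measurable[OF assms(1,2) zero_FS assms(3)] by (simp add: fs_diff_def)

text \<open>The converse to \<open>fs_measurable_lipschitz\<close>: a map whose values are almost surely approximated by a
fixed sequence \<open>c\<close>, with measurable distances to its members, is strongly measurable. The \<open>i\<close>-th simple
function picks the member nearest to the value among \<open>c 0, \<dots>, c i\<close>.\<close>

lemma fs_measurable_dense:
  assumes g: "g \<in> space M \<rightarrow> FS r" and c: "\<And>n::nat. c n \<in> FS r"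
    and dense: "AE x in M. \<forall>e>0. \<exists>n. fs_norm r (fs_diff (g x) (c n)) < e"
    and meas: "\<And>n. (\<lambda>x. fs_norm r (fs_diff (g x) (c n))) \<in> borel_measurable M"
  shows "fs_measurable M r g"
proof -
  define d where "d n x = fs_norm r (fs_diff (g x) (c n))" for n x
  have [measurable]: "d n \<in> borel_measurable M" for n unfolding d_def by (rule meas)
  define N where "N i x = (LEAST n. n \<le> i \<and> (\<forall>m\<in>{..i}. d n x \<le> d m x))" for i x
  have N: "N i x \<le> i \<and> (\<forall>m\<in>{..i}. d (N i x) x \<le> d m x)" for i x
    unfolding N_def
  proof (rule LeastI_ex)
    have "Min ((\<lambda>n. d n x) ` {..i}) \<in> (\<lambda>n. d n x) ` {..i}" by (intro Min_in) auto
    then obtain n where n: "Min ((\<lambda>n. d n x) ` {..i}) = d n x" "n \<in> {..i}" by (rule imageE)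
    have "d n x \<le> d m x" if "m \<in> {..i}" for m
      unfolding n(1)[symmetric] using that by (intro Min_le) auto
    then show "\<exists>n. n \<le> i \<and> (\<forall>m\<in>{..i}. d n x \<le> d m x)" using n(2) by auto
  qed
  have meas_N: "N i \<in> measurable M (count_space UNIV)" for i
    unfolding N_def by measurable
  have sN: "simple_function M (N i)" for i
    unfolding simple_function_eq_measurable
    using meas_N[of i] N[of i] by (auto intro: finite_subset[of _ "{..i}"])
  show ?thesis unfolding fs_measurable_def
  proof (intro conjI exI[of _ "\<lambda>i x. c (N i x)"] allI g)
    show "simple_function M (\<lambda>x. c (N i x))" for i
      using sN by (rule simple_function_compose1)
    show "(\<lambda>x. c (N i x)) \<in> space M \<rightarrow> FS r" for i using c by auto
    show "AE x in M. (\<lambda>i. fs_norm r (fs_diff (g x) (c (N i x)))) \<longlonglongrightarrow> 0"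
      using dense
    proof eventually_elim
      case (elim x)
      show ?case
      proof (rule order_tendstoI)
        fix e :: ennreal assume "0 < e"
        then obtain n where n: "d n x < e" using elim unfolding d_def by blast
        have "d (N i x) x < e" if "i \<ge> n" for i
          using N[of i x] n that by (auto intro: le_less_trans)
        then show "\<forall>\<^sub>F i in sequentially. fs_norm r (fs_diff (g x) (c (N i x))) < e"
          unfolding d_def eventually_sequentially by blast
      qed simp
    qed
  qed
qed

lemma measurable_compose_simple:
  assumes "simple_function M s" "T \<in> measurable M N"
    and "\<And>v. v \<in> s ` space M \<Longrightarrow> (\<lambda>t. u t v) \<in> borel_measurable N"
  shows "(\<lambda>x. u (T x) (s x)) \<in> borel_measurable M"
proof (rule measurable_compose_countable'[where I = "s ` space M"])
  show "(\<lambda>x. u (T x) v) \<in> borel_measurable M" if "v \<in> s ` space M" for v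
    using measurable_compose[OF assms(2) assms(3)[OF that]] .
  show "s \<in> measurable M (count_space (s ` space M))"
    using measurable_simple_function[OF assms(1)] by (auto simp: measurable_def)
  show "countable (s ` space M)" using assms(1) by (simp add: simple_functionD countable_finite)
qed

text \<open>Joint measurability of \<open>x \<mapsto> A (T x) (g x)\<close> for an operator-valued map that is strongly measurable
only vector by vector. The values of simple functions approximating \<open>g\<close> form a countable set \<open>C\<close>;
the values of simple functions approximating \<open>t \<mapsto> A t v\<close> for \<open>v \<in> C\<close> form a countable
set \<open>D\<close>. By uniform boundedness of \<open>A t\<close>, almost all values \<open>A (T x) (g x)\<close> lie in the closure of \<open>D\<close>, and
\<open>fs_measurable_dense\<close> applies. Exceptional sets in the variable \<open>t\<close> must pull back to null sets under \<open>T\<close>.\<close>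

lemma fs_measurable_operator:
  fixes A :: "'t \<Rightarrow> ('a::real_normed_vector, 'b::real_normed_vector) fseries \<Rightarrow> ('a, 'b) fseries"
  assumes M: "complete_measure M" and N: "complete_measure N" and r: "0 \<le> r"
    and T: "T \<in> measurable M N" and null: "\<And>P. (AE t in N. P t) \<Longrightarrow> AE x in M. P (T x)"
    and bounded: "\<And>t f h. t \<in> space N \<Longrightarrow> f \<in> FS r' \<Longrightarrow> h \<in> FS r' \<Longrightarrow>
        fs_norm r (fs_diff (A t f) (A t h)) \<le> ennreal K * fs_norm r' (fs_diff f h)"
    and A: "\<And>f. f \<in> FS r' \<Longrightarrow> fs_measurable N r (\<lambda>t. A t f)"
    and g: "fs_measurable M r' g"
  shows "fs_measurable M r (\<lambda>x. A (T x) (g x))"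
proof -
  interpret complete_measure M by fact
  obtain s where s: "\<And>i. simple_function M (s i)" "\<And>i. s i \<in> space M \<rightarrow> FS r'"
    and lim: "AE x in M. (\<lambda>i. fs_norm r' (fs_diff (g x) (s i x))) \<longlonglongrightarrow> 0"
    and gF: "g \<in> space M \<rightarrow> FS r'"
    using g unfolding fs_measurable_def by blast
  have AF: "A t f \<in> FS r" if "t \<in> space N" "f \<in> FS r'" for t f
    using fs_measurable_FS[OF A[OF that(2)] that(1)] .
  have TN: "T x \<in> space N" if "x \<in> space M" for x using measurable_space[OF T that] .
  define C where "C = (\<Union>i. s i ` space M)"
  have C: "countable C" "C \<subseteq> FS r'"
  proof -
    show "countable C" unfolding C_def
      using s(1) by (intro countable_UN) (auto intro: countable_finite simple_functionD(1))
    show "C \<subseteq> FS r'" unfolding C_def using s(2) by auto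
  qed
  have "\<forall>v\<in>C. \<exists>\<sigma>. (\<forall>j::nat. simple_function N (\<sigma> j) \<and> \<sigma> j \<in> space N \<rightarrow> FS r) \<and>
        (AE t in N. (\<lambda>j. fs_norm r (fs_diff (A t v) (\<sigma> j t))) \<longlonglongrightarrow> 0)"
    using A C unfolding fs_measurable_def by auto
  from bchoice[OF this] obtain \<sigma> where \<sigma>': "\<forall>v\<in>C. (\<forall>j::nat. simple_function N (\<sigma> v j) \<and> \<sigma> v j \<in> space N \<rightarrow> FS r) \<and>
        (AE t in N. (\<lambda>j. fs_norm r (fs_diff (A t v) (\<sigma> v j t))) \<longlonglongrightarrow> 0)" by blast
  then have \<sigma>: "\<And>v j. v \<in> C \<Longrightarrow> simple_function N (\<sigma> v j)" "\<And>v j. v \<in> C \<Longrightarrow> \<sigma> v j \<in> space N \<rightarrow> FS r"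
    and \<sigma>lim: "\<And>v. v \<in> C \<Longrightarrow> AE t in N. (\<lambda>j. fs_norm r (fs_diff (A t v) (\<sigma> v j t))) \<longlonglongrightarrow> 0"
    by blast+
  \<comment> \<open>the zero series is added only to make \<open>D\<close> nonempty, so that it can be enumerated\<close>
  define D where "D = insert (\<lambda>p \<phi>. 0) (\<Union>v\<in>C. \<Union>j. \<sigma> v j ` space N)"
  have D: "countable D" "D \<subseteq> FS r" "D \<noteq> {}"
  proof -
    show "countable D" unfolding D_def
      by (intro countable_insert countable_UN C(1) countableI_type countable_finite simple_functionD(1) \<sigma>(1))
    show "D \<subseteq> FS r" unfolding D_def using \<sigma>(2) zero_FS by fastforce
  qed (simp add: D_def)
  show ?thesis
  proof (rule fs_measurable_dense[where c = "from_nat_into D"])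
    show "(\<lambda>x. A (T x) (g x)) \<in> space M \<rightarrow> FS r" using AF TN gF by auto
    show c: "from_nat_into D n \<in> FS r" for n using from_nat_into[OF D(3)] D(2) by auto
    have "AE x in M. \<forall>v\<in>C. (\<lambda>j. fs_norm r (fs_diff (A (T x) v) (\<sigma> v j (T x)))) \<longlonglongrightarrow> 0"
      using null[OF \<sigma>lim] C(1) by (intro AE_ball_countable') auto
    then show "AE x in M. \<forall>e>0. \<exists>n. fs_norm r (fs_diff (A (T x) (g x)) (from_nat_into D n)) < e"
      using lim AE_space
    proof eventually_elim
      case (elim x)
      have Tx: "T x \<in> space N" using TN elim(3) .
      have sx: "s i x \<in> C" for i using elim(3) by (auto simp: C_def)
      have gx: "g x \<in> FS r'" using gF elim(3) by auto
      show ?case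
      proof (intro allI impI)
        fix e :: ennreal assume e: "0 < e"
        obtain e' :: real where e': "0 < ennreal e'" "ennreal e' < e" "0 < e'"
          using ennreal_rat_dense[of 0 e] e by (metis dense ennreal_cases ennreal_less_zero_iff infinity_ennreal_def not_less_iff_gr_or_eq top_greatest less_le_not_le)
        have "(\<lambda>i. ennreal K * fs_norm r' (fs_diff (g x) (s i x))) \<longlonglongrightarrow> ennreal K * 0"
          by (intro ennreal_tendsto_cmult elim(2)) simp
        then have "\<forall>\<^sub>F i in sequentially. ennreal K * fs_norm r' (fs_diff (g x) (s i x)) < ennreal (e' / 2)"
          using e' by (intro order_tendstoD) auto
        then obtain i where i: "ennreal K * fs_norm r' (fs_diff (g x) (s i x)) < ennreal (e' / 2)"
          unfolding eventually_sequentially by blast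
        have "\<forall>\<^sub>F j in sequentially. fs_norm r (fs_diff (A (T x) (s i x)) (\<sigma> (s i x) j (T x))) < ennreal (e' / 2)"
          using elim(1) sx e' by (intro order_tendstoD) auto
        then obtain j where j: "fs_norm r (fs_diff (A (T x) (s i x)) (\<sigma> (s i x) j (T x))) < ennreal (e' / 2)"
          unfolding eventually_sequentially by blast
        have inD: "\<sigma> (s i x) j (T x) \<in> D" unfolding D_def using sx Tx by auto
        have sF: "s i x \<in> FS r'" using sx C by auto
        have "fs_norm r (fs_diff (A (T x) (g x)) (\<sigma> (s i x) j (T x)))
          \<le> fs_norm r (fs_diff (A (T x) (g x)) (A (T x) (s i x))) + fs_norm r (fs_diff (A (T x) (s i x)) (\<sigma> (s i x) j (T x)))"
          using AF[OF Tx gx] AF[OF Tx sF] inD D FS_formal_series r by (intro fs_norm_triangle) blast+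
        also have "\<dots> < ennreal (e' / 2) + ennreal (e' / 2)"
          using order.strict_trans1[OF bounded[OF Tx gx sF] i] j by (intro add_strict_mono)
        also have "\<dots> = ennreal e'" using e' by (simp flip: ennreal_plus)
        finally have "fs_norm r (fs_diff (A (T x) (g x)) (\<sigma> (s i x) j (T x))) < e" using e' by auto
        moreover obtain n where "from_nat_into D n = \<sigma> (s i x) j (T x)"
          using from_nat_into_surj[OF D(1) inD] by blast
        ultimately show "\<exists>n. fs_norm r (fs_diff (A (T x) (g x)) (from_nat_into D n)) < e" by metis
      qed
    qed
    fix n
    define d where "d = from_nat_into D n"
    have d: "d \<in> FS r" unfolding d_def by (rule c)
    have "(\<lambda>x. enn2real (fs_norm r (fs_diff (A (T x) (g x)) d))) \<in> borel_measurable M"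
    proof (rule borel_measurable_AE_LIMSEQ)
      show "(\<lambda>x. enn2real (fs_norm r (fs_diff (A (T x) (s i x)) d))) \<in> borel_measurable M" for i
      proof (rule measurable_compose_simple[OF s(1) T])
        fix v assume "v \<in> s i ` space M"
        then have "v \<in> FS r'" using s(2) by auto
        then show "(\<lambda>t. enn2real (fs_norm r (fs_diff (A t v) d))) \<in> borel_measurable N"
          by (intro fs_measurable_lipschitz[OF N A fs_lipschitz_norm_diff] d r)
      qed
      show "AE x in M. (\<lambda>i. enn2real (fs_norm r (fs_diff (A (T x) (s i x)) d))) \<longlonglongrightarrow> enn2real (fs_norm r (fs_diff (A (T x) (g x)) d))"
        using lim AE_space
      proof eventually_elim
        case (elim x)
        have Tx: "T x \<in> space N" using TN elim(2) .
        have sF: "s i x \<in> FS r'" for i using s(2) elim(2) by auto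
        have gx: "g x \<in> FS r'" using gF elim(2) by auto
        have "ennreal \<bar>enn2real (fs_norm r (fs_diff (A (T x) (g x)) d)) - enn2real (fs_norm r (fs_diff (A (T x) (s i x)) d))\<bar>
          \<le> ennreal K * fs_norm r' (fs_diff (g x) (s i x))" for i
          using fs_norm_diff_lipschitz[OF AF[OF Tx gx] AF[OF Tx sF] d r] bounded[OF Tx gx sF] by (rule order_trans)
        then show ?case by (intro ennreal_tendsto_0_bound[OF elim(1)] always_eventually allI)
      qed
    qed
    then have "(\<lambda>x. ennreal (enn2real (fs_norm r (fs_diff (A (T x) (g x)) d)))) \<in> borel_measurable M" by measurable
    moreover have "ennreal (enn2real (fs_norm r (fs_diff (A (T x) (g x)) d))) = fs_norm r (fs_diff (A (T x) (g x)) d)" if "x \<in> space M" for x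
    proof -
      have "A (T x) (g x) \<in> FS r" using AF TN gF that by auto
      then show ?thesis using FS_fs_norm[OF fs_diff_FS[OF _ d r]] by simp
    qed
    ultimately show "(\<lambda>x. fs_norm r (fs_diff (A (T x) (g x)) (from_nat_into D n))) \<in> borel_measurable M"
      unfolding d_def by (simp cong: measurable_cong)
  qed
qed

section \<open>Integration of series-valued functions\<close>

lemma iter_diff_integral:
  fixes G :: "'c \<Rightarrow> 'a::real_vector \<Rightarrow> real"
  assumes "\<And>\<phi>. integrable M (\<lambda>x. G x \<phi>)"
  shows "integrable M (\<lambda>x. iter_diff xs (G x))"
    and "iter_diff xs (\<lambda>\<phi>. \<integral>x. G x \<phi> \<partial>M) = (\<integral>x. iter_diff xs (G x) \<partial>M)"
proof -
  have "integrable M (\<lambda>x. iter_diff xs (G x)) \<and>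
    iter_diff xs (\<lambda>\<phi>. \<integral>x. G x \<phi> \<partial>M) = (\<integral>x. iter_diff xs (G x) \<partial>M)"
    using assms
  proof (induction xs arbitrary: G)
    case (Cons y ys)
    then show ?case using Cons.IH[of "\<lambda>x \<phi>. G x (\<phi> + y) - G x \<phi>"] by simp
  qed simp
  then show "integrable M (\<lambda>x. iter_diff xs (G x))"
    and "iter_diff xs (\<lambda>\<phi>. \<integral>x. G x \<phi> \<partial>M) = (\<integral>x. iter_diff xs (G x) \<partial>M)" by auto
qed

text \<open>The polarized form of the integral is the integral of the polarized forms, so it inherits
multilinearity, symmetry and the bound.\<close>

lemma homog_poly_integral:
  fixes G :: "'c \<Rightarrow> 'a::real_normed_vector \<Rightarrow> real"
  assumes G: "\<And>x. x \<in> space M \<Longrightarrow> G x \<in> homog_poly p"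
    and meas: "\<And>\<phi>. (\<lambda>x. G x \<phi>) \<in> borel_measurable M"
    and int: "integrable M (\<lambda>x. tnorm p (G x))"
  shows "integrable M (\<lambda>x. G x \<phi>)"
    and "(\<lambda>\<phi>. \<integral>x. G x \<phi> \<partial>M) \<in> homog_poly p"
    and "tnorm p (\<lambda>\<phi>. \<integral>x. G x \<phi> \<partial>M) \<le> (\<integral>x. tnorm p (G x) \<partial>M)"
proof -
  show I: "integrable M (\<lambda>x. G x \<phi>)" for \<phi>
  proof (rule Bochner_Integration.integrable_bound)
    show "integrable M (\<lambda>x. tnorm p (G x) * norm \<phi> ^ p)" using int by simp
    show "AE x in M. norm (G x \<phi>) \<le> norm (tnorm p (G x) * norm \<phi> ^ p)"
      by (intro AE_I2 order_trans[OF norm_homog_poly_le[OF G]]) (auto simp: abs_ge_self)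
  qed (rule meas)
  define h where "h = (\<lambda>\<phi>. \<integral>x. G x \<phi> \<partial>M)"
  have Ip: "integrable M (\<lambda>x. polar p (G x) xs)" and hp: "polar p h xs = (\<integral>x. polar p (G x) xs \<partial>M)" for xs
    unfolding polar_def h_def using iter_diff_integral[of M G xs, OF I] by simp_all
  have mG: "sym_multilinear p (polar p (G x))" if "x \<in> space M" for x
    using homog_poly_polarizes[OF G[OF that]] unfolding polarizes_def by blast
  have "linear (\<lambda>y. polar p h (xs @ y # ys))" if len: "length xs + length ys + 1 = p" for xs ys
  proof (rule linearI)
    fix y z c
    have lin: "linear (\<lambda>y. polar p (G x) (xs @ y # ys))" if "x \<in> space M" for x
      using sym_multilinear_linear[OF mG[OF that] len] .
    have "polar p h (xs @ (y + z) # ys) = (\<integral>x. polar p (G x) (xs @ y # ys) + polar p (G x) (xs @ z # ys) \<partial>M)"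
      unfolding hp by (intro Bochner_Integration.integral_cong refl) (simp add: linear_add[OF lin])
    then show "polar p h (xs @ (y + z) # ys) = polar p h (xs @ y # ys) + polar p h (xs @ z # ys)"
      by (simp add: hp Ip)
    have "polar p h (xs @ (c *\<^sub>R y) # ys) = (\<integral>x. c *\<^sub>R polar p (G x) (xs @ y # ys) \<partial>M)"
      unfolding hp by (intro Bochner_Integration.integral_cong refl) (simp add: linear_scale[OF lin])
    then show "polar p h (xs @ (c *\<^sub>R y) # ys) = c *\<^sub>R polar p h (xs @ y # ys)"
      by (simp add: hp)
  qed
  moreover have "polar p h xs = polar p h ys" if "length xs = p" "mset xs = mset ys" for xs ys
    unfolding hp using sym_multilinear_perm[OF mG that] by (intro Bochner_Integration.integral_cong refl)
  ultimately have "sym_multilinear p (polar p h)" unfolding sym_multilinear_def by blast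
  moreover have "h \<phi> = polar p h (replicate p \<phi>)" for \<phi>
    unfolding hp using homog_poly_eval[OF G] unfolding h_def by (intro Bochner_Integration.integral_cong refl)
  ultimately have 1: "polarizes p (polar p h) h" unfolding polarizes_def by blast
  have "norm (polar p h xs) \<le> (\<integral>x. tnorm p (G x) \<partial>M) * prod_list (map norm xs)" if "length xs = p" for xs
  proof -
    have "norm (polar p h xs) \<le> (\<integral>x. norm (polar p (G x) xs) \<partial>M)" unfolding hp by (rule integral_norm_bound)
    also have "\<dots> \<le> (\<integral>x. tnorm p (G x) * prod_list (map norm xs) \<partial>M)"
      using int Ip norm_polar_le[OF G that] by (intro integral_mono) auto
    finally show ?thesis by simp
  qed
  moreover have "0 \<le> (\<integral>x. tnorm p (G x) \<partial>M)"
    using tnorm_nonneg[OF G] by (intro Bochner_Integration.integral_nonneg) auto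
  ultimately have 2: "tensor_bound p (polar p h) (\<integral>x. tnorm p (G x) \<partial>M)" unfolding tensor_bound_def by blast
  show "(\<lambda>\<phi>. \<integral>x. G x \<phi> \<partial>M) \<in> homog_poly p"
    and "tnorm p (\<lambda>\<phi>. \<integral>x. G x \<phi> \<partial>M) \<le> (\<integral>x. tnorm p (G x) \<partial>M)"
    using polarizes_bound[OF 1 2] unfolding h_def .
qed

text \<open>The triangle inequality for integrals, with the integral taken pointwise. For the counting measure on the
natural numbers it says that absolutely convergent series converge; it thereby also
takes the place of a completeness theorem for \<open>FS r\<close>.\<close>

lemma fs_integral_bound:
  fixes G :: "'c \<Rightarrow> ('a::real_normed_vector, real) fseries"
  assumes r: "0 < r" and G: "\<And>x. x \<in> space M \<Longrightarrow> G x \<in> formal_series"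
    and meas: "\<And>p \<phi>. (\<lambda>x. G x p \<phi>) \<in> borel_measurable M"
    and tmeas: "\<And>p. (\<lambda>x. tnorm p (G x p)) \<in> borel_measurable M"
    and fin: "(\<integral>\<^sup>+x. fs_norm r (G x) \<partial>M) < \<infinity>"
  shows "integrable M (\<lambda>x. G x p \<phi>)"
    and "(\<lambda>p \<phi>. \<integral>x. G x p \<phi> \<partial>M) \<in> FS r"
    and "fs_norm r (\<lambda>p \<phi>. \<integral>x. G x p \<phi> \<partial>M) \<le> (\<integral>\<^sup>+x. fs_norm r (G x) \<partial>M)"
proof -
  note tmeas[measurable]
  have int: "integrable M (\<lambda>x. tnorm p (G x p))" for p
  proof (rule integrableI_bounded[OF tmeas])
    have "(\<integral>\<^sup>+x. ennreal (norm (tnorm p (G x p))) \<partial>M) \<le> (\<integral>\<^sup>+x. ennreal (1 / r ^ p) * fs_norm r (G x) \<partial>M)"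
    proof (intro nn_integral_mono)
      fix x assume "x \<in> space M"
      then show "ennreal (norm (tnorm p (G x p))) \<le> ennreal (1 / r ^ p) * fs_norm r (G x)"
        using tnorm_le_fs_norm[OF r G, of x p] tnorm_nonneg[OF formal_seriesD[OF G], of x p] by simp
    qed
    also have "\<dots> = ennreal (1 / r ^ p) * (\<integral>\<^sup>+x. fs_norm r (G x) \<partial>M)"
      unfolding fs_norm_eq by (intro nn_integral_cmult) measurable
    also have "\<dots> < \<infinity>" using fin by (simp add: ennreal_mult_less_top)
    finally show "(\<integral>\<^sup>+x. ennreal (norm (tnorm p (G x p))) \<partial>M) < \<infinity>" .
  qed
  define h where "h = (\<lambda>p \<phi>. \<integral>x. G x p \<phi> \<partial>M)"
  note I = homog_poly_integral[OF formal_seriesD[OF G] meas int]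
  show "integrable M (\<lambda>x. G x p \<phi>)" by (rule I(1))
  have hF: "h \<in> formal_series" unfolding formal_series_def h_def using I(2) by blast
  have le: "fs_norm r h \<le> (\<integral>\<^sup>+x. fs_norm r (G x) \<partial>M)"
  proof -
    have "ennreal (tnorm p (h p) * r ^ p) \<le> (\<integral>\<^sup>+x. ennreal (tnorm p (G x p) * r ^ p) \<partial>M)" for p
    proof -
      have "tnorm p (h p) * r ^ p \<le> (\<integral>x. tnorm p (G x p) * r ^ p \<partial>M)"
        using mult_right_mono[OF I(3)[of p], of "r ^ p"] r by (simp add: h_def)
      then have "ennreal (tnorm p (h p) * r ^ p) \<le> ennreal (\<integral>x. tnorm p (G x p) * r ^ p \<partial>M)"
        by (rule ennreal_leI)
      also have "\<dots> = (\<integral>\<^sup>+x. ennreal (tnorm p (G x p) * r ^ p) \<partial>M)"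
        using int r tnorm_nonneg[OF formal_seriesD[OF G]]
        by (intro nn_integral_eq_integral[symmetric]) (auto intro!: AE_I2)
      finally show ?thesis .
    qed
    then have "fs_norm r h \<le> (\<Sum>p. \<integral>\<^sup>+x. ennreal (tnorm p (G x p) * r ^ p) \<partial>M)"
      unfolding fs_norm_eq by (intro suminf_le) auto
    also have "\<dots> = (\<integral>\<^sup>+x. fs_norm r (G x) \<partial>M)"
      unfolding fs_norm_eq by (intro nn_integral_suminf[symmetric]) measurable
    finally show ?thesis .
  qed
  show "(\<lambda>p \<phi>. \<integral>x. G x p \<phi> \<partial>M) \<in> FS r"
    using le hF fin unfolding FS_def h_def by (auto intro: le_less_trans)
  show "fs_norm r (\<lambda>p \<phi>. \<integral>x. G x p \<phi> \<partial>M) \<le> (\<integral>\<^sup>+x. fs_norm r (G x) \<partial>M)"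
    using le unfolding h_def .
qed

lemma fs_measurable_integral_bound:
  fixes G :: "'c \<Rightarrow> ('a::real_normed_vector, real) fseries"
  assumes r: "0 < r" and M: "complete_measure M" and G: "fs_measurable M r G"
    and fin: "(\<integral>\<^sup>+x. fs_norm r (G x) \<partial>M) < \<infinity>"
  shows "integrable M (\<lambda>x. G x p \<phi>)"
    and "(\<lambda>p \<phi>. \<integral>x. G x p \<phi> \<partial>M) \<in> FS r"
    and "fs_norm r (\<lambda>p \<phi>. \<integral>x. G x p \<phi> \<partial>M) \<le> (\<integral>\<^sup>+x. fs_norm r (G x) \<partial>M)"
proof -
  have a: "x \<in> space M \<Longrightarrow> G x \<in> formal_series" for x using fs_measurable_FS[OF G] FS_formal_series by blast
  note m = fs_measurable_lipschitz[OF M G fs_lipschitz_eval[OF r]] fs_measurable_lipschitz[OF M G fs_lipschitz_tnorm[OF r]]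
  show "integrable M (\<lambda>x. G x p \<phi>)"
    and "(\<lambda>p \<phi>. \<integral>x. G x p \<phi> \<partial>M) \<in> FS r"
    and "fs_norm r (\<lambda>p \<phi>. \<integral>x. G x p \<phi> \<partial>M) \<le> (\<integral>\<^sup>+x. fs_norm r (G x) \<partial>M)"
    using fs_integral_bound[OF r a m fin] by simp_all
qed

lemma fs_simple_integrable_eval:
  assumes "fs_simple_integrable M r s"
  shows "Bochner_Integration.simple_bochner_integrable M (\<lambda>x. s x p \<phi> :: real)"
    and "Bochner_Integration.simple_bochner_integral M (\<lambda>x. s x p \<phi>) = fs_simple_integral M s p \<phi>"
proof -
  have s: "simple_function M s" "emeasure M {x \<in> space M. s x \<noteq> (\<lambda>p \<phi>. 0)} \<noteq> \<infinity>"
    using assms unfolding fs_simple_integrable_def by auto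
  have "{x \<in> space M. s x \<noteq> (\<lambda>p \<phi>. 0)} = s -` (- {\<lambda>p \<phi>. 0}) \<inter> space M" by auto
  then have set: "{x \<in> space M. s x \<noteq> (\<lambda>p \<phi>. 0)} \<in> sets M"
    using measurable_sets[OF measurable_simple_function[OF s(1)], of "- {\<lambda>p \<phi>. 0}"] by simp
  show 1: "Bochner_Integration.simple_bochner_integrable M (\<lambda>x. s x p \<phi>)"
  proof (rule simple_bochner_integrable.intros)
    show "simple_function M (\<lambda>x. s x p \<phi>)" using simple_function_compose1[OF s(1), of "\<lambda>f. f p \<phi>"] .
    have "emeasure M {y \<in> space M. s y p \<phi> \<noteq> 0} \<le> emeasure M {x \<in> space M. s x \<noteq> (\<lambda>p \<phi>. 0)}"
      using set by (intro emeasure_mono) auto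
    then show "emeasure M {y \<in> space M. s y p \<phi> \<noteq> 0} \<noteq> \<infinity>" using s(2) by (auto simp: top_unique)
  qed
  show "Bochner_Integration.simple_bochner_integral M (\<lambda>x. s x p \<phi>) = fs_simple_integral M s p \<phi>"
    unfolding fs_simple_integral_def
    by (rule simple_bochner_integral_partition[OF 1 s(1)]) auto
qed

text \<open>Point evaluations are Lipschitz on \<open>FS r\<close>, so an integral in \<open>FS r\<close> is also an ordinary integral at every
point. Uniqueness and linearity are thus inherited from real-valued integrals.\<close>

lemma has_fs_integral_eval:
  fixes g :: "'c \<Rightarrow> ('a::real_normed_vector, real) fseries"
  assumes r: "0 < r" and M: "complete_measure M" and int: "has_fs_integral M r g h"
  shows "has_bochner_integral M (\<lambda>x. g x p \<phi>) (h p \<phi>)"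
proof -
  obtain s where s: "\<And>i. fs_simple_integrable M r (s i)"
    and lim: "(\<lambda>i. \<integral>\<^sup>+x. fs_norm r (fs_diff (g x) (s i x)) \<partial>M) \<longlonglongrightarrow> 0"
    and limh: "(\<lambda>i. fs_norm r (fs_diff h (fs_simple_integral M (s i)))) \<longlonglongrightarrow> 0"
    and g: "fs_measurable M r g" and h: "h \<in> FS r"
    using int unfolding has_fs_integral_def by blast
  have sF: "s i x \<in> FS r" if "x \<in> space M" for i x
    using s[of i] that unfolding fs_simple_integrable_def by auto
  have SF: "fs_simple_integral M (s i) \<in> FS r" for i
  proof -
    have "(\<lambda>p \<phi>. \<Sum>c\<in>D. measure M {x \<in> space M. s i x = c} *\<^sub>R c p \<phi>) \<in> FS r"
      if "finite D" "D \<subseteq> FS r" for D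
      using that
    proof (induction D rule: finite_induct)
      case (insert d D)
      then show ?case
        using fs_lincomb_FS[of d r "\<lambda>p \<phi>. \<Sum>c\<in>D. measure M {x \<in> space M. s i x = c} *\<^sub>R c p \<phi>" "measure M {x \<in> space M. s i x = d}" 1] r
        by (simp add: fs_lincomb_def)
    qed (simp add: zero_FS)
    moreover have "finite (s i ` space M)" "s i ` space M \<subseteq> FS r"
      using s[of i] unfolding fs_simple_integrable_def by (auto simp: simple_functionD)
    ultimately show ?thesis unfolding fs_simple_integral_def by blast
  qed
  obtain K where K: "K \<ge> 0" "\<And>f h. f \<in> FS r \<Longrightarrow> h \<in> FS r \<Longrightarrow> ennreal \<bar>f p \<phi> - h p \<phi>\<bar> \<le> ennreal K * fs_norm r (fs_diff f h)"
    using fs_lipschitz_eval[OF r, of p \<phi>] unfolding fs_lipschitz_def by blast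
  show ?thesis
  proof (rule has_bochner_integral.intros)
    show "(\<lambda>x. g x p \<phi>) \<in> borel_measurable M"
      by (rule fs_measurable_lipschitz[OF M g fs_lipschitz_eval[OF r]])
    show "Bochner_Integration.simple_bochner_integrable M (\<lambda>x. s i x p \<phi>)" for i
      by (rule fs_simple_integrable_eval(1)[OF s])
    show "(\<lambda>i. Bochner_Integration.simple_bochner_integral M (\<lambda>x. s i x p \<phi>)) \<longlonglongrightarrow> h p \<phi>"
      unfolding fs_simple_integrable_eval(2)[OF s]
      using K(2)[OF h SF] by (intro ennreal_tendsto_0_bound[OF limh] always_eventually allI)
    have "(\<lambda>i. ennreal K * (\<integral>\<^sup>+x. fs_norm r (fs_diff (g x) (s i x)) \<partial>M)) \<longlonglongrightarrow> ennreal K * 0"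
      by (intro ennreal_tendsto_cmult lim) simp
    then have up: "(\<lambda>i. ennreal K * (\<integral>\<^sup>+x. fs_norm r (fs_diff (g x) (s i x)) \<partial>M)) \<longlonglongrightarrow> 0"
      by (simp only: mult_zero_right)
    have "(\<integral>\<^sup>+x. norm (g x p \<phi> - s i x p \<phi>) \<partial>M) \<le> ennreal K * (\<integral>\<^sup>+x. fs_norm r (fs_diff (g x) (s i x)) \<partial>M)" for i
    proof -
      have m: "(\<lambda>x. fs_norm r (fs_diff (g x) (s i x))) \<in> borel_measurable M"
      proof -
        have "(\<lambda>x. fs_norm r (fs_diff (g (id x)) (s i x))) \<in> borel_measurable M"
        proof (rule measurable_compose_simple[where T = id and N = M and s = "s i"
            and u = "\<lambda>t v. fs_norm r (fs_diff (g t) v)"])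
          show "simple_function M (s i)" using s[of i] unfolding fs_simple_integrable_def by blast
          show "(\<lambda>x. fs_norm r (fs_diff (g x) v)) \<in> borel_measurable M" if "v \<in> s i ` space M" for v
            using that sF r by (intro fs_norm_diff_measurable[OF M g]) auto
        qed auto
        then show ?thesis by simp
      qed
      have "(\<integral>\<^sup>+x. norm (g x p \<phi> - s i x p \<phi>) \<partial>M) \<le> (\<integral>\<^sup>+x. ennreal K * fs_norm r (fs_diff (g x) (s i x)) \<partial>M)"
      proof (rule nn_integral_mono)
        fix x assume "x \<in> space M"
        then show "ennreal (norm (g x p \<phi> - s i x p \<phi>)) \<le> ennreal K * fs_norm r (fs_diff (g x) (s i x))"
          using K(2)[OF fs_measurable_FS[OF g] sF, of x x i] by (simp only: real_norm_def)
      qed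
      also have "\<dots> = ennreal K * (\<integral>\<^sup>+x. fs_norm r (fs_diff (g x) (s i x)) \<partial>M)"
        using m by (rule nn_integral_cmult)
      finally show ?thesis .
    qed
    then have le: "\<forall>\<^sub>F i in sequentially. (\<integral>\<^sup>+x. norm (g x p \<phi> - s i x p \<phi>) \<partial>M) \<le> ennreal K * (\<integral>\<^sup>+x. fs_norm r (fs_diff (g x) (s i x)) \<partial>M)"
      by (intro always_eventually allI)
    show "(\<lambda>i. \<integral>\<^sup>+x. norm (g x p \<phi> - s i x p \<phi>) \<partial>M) \<longlonglongrightarrow> 0"
      by (rule tendsto_sandwich[OF always_eventually[OF allI[OF zero_le]] le tendsto_const up])
  qed
qed

lemma fs_measurable_diff_simple:
  assumes "fs_measurable M r g" "simple_function M s" "s \<in> space M \<rightarrow> FS r" "0 \<le> r"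
  shows "fs_measurable M r (\<lambda>x. fs_diff (g x) (s x))"
proof -
  obtain \<sigma> where \<sigma>: "\<And>i. simple_function M (\<sigma> i)" "\<And>i. \<sigma> i \<in> space M \<rightarrow> FS r"
    and lim: "AE x in M. (\<lambda>i. fs_norm r (fs_diff (g x) (\<sigma> i x))) \<longlonglongrightarrow> 0"
    and g: "g \<in> space M \<rightarrow> FS r"
    using assms(1) unfolding fs_measurable_def by blast
  have eq: "fs_diff (fs_diff a c) (fs_diff b c) = fs_diff a b" for a b c :: "('b, 'c) fseries"
    by (simp add: fs_diff_def)
  show ?thesis unfolding fs_measurable_def
  proof (intro conjI exI[of _ "\<lambda>i x. fs_diff (\<sigma> i x) (s x)"] allI)
    show "simple_function M (\<lambda>x. fs_diff (\<sigma> i x) (s x))" for i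
      using \<sigma>(1) assms(2) by (rule simple_function_compose2)
    show "(\<lambda>x. fs_diff (\<sigma> i x) (s x)) \<in> space M \<rightarrow> FS r" for i
      using \<sigma>(2) assms(3,4) fs_diff_FS by fastforce
    show "(\<lambda>x. fs_diff (g x) (s x)) \<in> space M \<rightarrow> FS r"
      using g assms(3,4) fs_diff_FS by fastforce
    show "AE x in M. (\<lambda>i. fs_norm r (fs_diff (fs_diff (g x) (s x)) (fs_diff (\<sigma> i x) (s x)))) \<longlonglongrightarrow> 0"
      unfolding eq by (rule lim)
  qed
qed

text \<open>On a finite measure space every bounded strongly measurable map is integrable: truncating the simple approximants
where their norm exceeds a bound \<open>b\<close> on \<open>g\<close> keeps the almost sure convergence and makes dominated
convergence applicable. The truncation needs \<open>b\<close> to be a strict bound.\<close>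

lemma has_fs_integral_bounded:
  fixes g :: "'c \<Rightarrow> ('a::real_normed_vector, real) fseries"
  assumes r: "0 < r" and M: "complete_measure M" and fin: "emeasure M (space M) \<noteq> \<infinity>"
    and g: "fs_measurable M r g" and B: "\<And>x. x \<in> space M \<Longrightarrow> fs_norm r (g x) \<le> ennreal B"
  shows "has_fs_integral M r g (\<lambda>p \<phi>. \<integral>x. g x p \<phi> \<partial>M)"
    and "integrable M (\<lambda>x. g x p \<phi>)"
    and "fs_norm r (\<lambda>p \<phi>. \<integral>x. g x p \<phi> \<partial>M) \<le> ennreal B * emeasure M (space M)"
proof -
  have gfin: "(\<integral>\<^sup>+x. fs_norm r (g x) \<partial>M) \<le> ennreal B * emeasure M (space M)"
    using nn_integral_mono[of M "\<lambda>x. fs_norm r (g x)" "\<lambda>x. ennreal B"] B by simp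
  also have "\<dots> < \<infinity>" using fin by (simp add: ennreal_mult_less_top less_top)
  finally have gfin': "(\<integral>\<^sup>+x. fs_norm r (g x) \<partial>M) < \<infinity>" .
  note I = fs_measurable_integral_bound[OF r M g gfin']
  show "integrable M (\<lambda>x. g x p \<phi>)" for p \<phi> by (rule I(1))
  show "fs_norm r (\<lambda>p \<phi>. \<integral>x. g x p \<phi> \<partial>M) \<le> ennreal B * emeasure M (space M)"
    using I(3) gfin by (rule order_trans)
  define b where "b = max B 0 + 1"
  have b: "b > 0" "\<And>x. x \<in> space M \<Longrightarrow> fs_norm r (g x) \<le> ennreal b" "\<And>x. x \<in> space M \<Longrightarrow> fs_norm r (g x) < ennreal b"
  proof -
    show b0: "b > 0" unfolding b_def by simp
    have "ennreal B < ennreal b" using b0 by (intro ennreal_lessI) (auto simp: b_def)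
    then show "fs_norm r (g x) < ennreal b" if "x \<in> space M" for x using B[OF that] by (rule le_less_trans[rotated])
    then show "fs_norm r (g x) \<le> ennreal b" if "x \<in> space M" for x using that by (simp add: less_imp_le)
  qed
  obtain \<sigma> where \<sigma>: "\<And>i. simple_function M (\<sigma> i)" "\<And>i. \<sigma> i \<in> space M \<rightarrow> FS r"
    and lim: "AE x in M. (\<lambda>i. fs_norm r (fs_diff (g x) (\<sigma> i x))) \<longlonglongrightarrow> 0"
    using g unfolding fs_measurable_def by blast
  define s where "s i x = (if fs_norm r (\<sigma> i x) \<le> ennreal b then \<sigma> i x else (\<lambda>p \<phi>. 0))" for i x
  have ss: "simple_function M (s i)" for i
    unfolding s_def by (rule simple_function_compose1[OF \<sigma>(1), of "\<lambda>f. if fs_norm r f \<le> ennreal b then f else (\<lambda>p \<phi>. 0)"])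
  have sF: "s i \<in> space M \<rightarrow> FS r" for i using \<sigma>(2)[of i] zero_FS[of r] by (auto simp: s_def Pi_iff)
  have sb: "fs_norm r (s i x) \<le> ennreal b" for i x by (auto simp: s_def fs_norm_zero)
  have slim: "AE x in M. (\<lambda>i. fs_norm r (fs_diff (g x) (s i x))) \<longlonglongrightarrow> 0"
    using lim AE_space
  proof eventually_elim
    case (elim x)
    have gx: "g x \<in> FS r" using fs_measurable_FS[OF g elim(2)] .
    have \<sigma>x: "\<sigma> i x \<in> FS r" for i using \<sigma>(2)[of i] elim(2) by auto
    have "0 < ennreal b - fs_norm r (g x)" using b(3)[OF elim(2)] by (simp add: diff_gr0_ennreal)
    then have "\<forall>\<^sub>F i in sequentially. fs_norm r (fs_diff (g x) (\<sigma> i x)) < ennreal b - fs_norm r (g x)"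
      using elim(1) by (intro order_tendstoD)
    then have "\<forall>\<^sub>F i in sequentially. s i x = \<sigma> i x"
    proof eventually_elim
      case (elim i)
      have "fs_norm r (\<sigma> i x) \<le> fs_norm r (g x) + fs_norm r (fs_diff (g x) (\<sigma> i x))"
      proof -
        have "\<sigma> i x = fs_lincomb 1 (g x) (- 1) (fs_diff (g x) (\<sigma> i x))"
          by (simp add: fs_lincomb_def fs_diff_def)
        then show ?thesis
          using fs_norm_lincomb_le[of "g x" "fs_diff (g x) (\<sigma> i x)" r 1 "- 1"] FS_formal_series[OF gx]
            FS_formal_series[OF fs_diff_FS[OF gx \<sigma>x]] r by simp
      qed
      also have "\<dots> \<le> fs_norm r (g x) + (ennreal b - fs_norm r (g x))"
        using elim by (intro add_left_mono) auto
      also have "\<dots> = ennreal b" using b(2)[OF \<open>x \<in> space M\<close>] by (simp add: add_diff_inverse_ennreal)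
      finally show ?case by (simp add: s_def)
    qed
    then have "\<forall>\<^sub>F i in sequentially. fs_norm r (fs_diff (g x) (\<sigma> i x)) = fs_norm r (fs_diff (g x) (s i x))"
      by eventually_elim simp
    then show ?case by (rule Lim_transform_eventually[OF elim(1)])
  qed
  have dm: "fs_measurable M r (\<lambda>x. fs_diff (g x) (s i x))" for i
    using fs_measurable_diff_simple[OF g ss sF] r by simp
  have db: "fs_norm r (fs_diff (g x) (s i x)) \<le> ennreal (2 * b)" if "x \<in> space M" for i x
  proof -
    have "s i x \<in> FS r" using sF[of i] that by blast
    then have "fs_norm r (fs_diff (g x) (s i x)) \<le> fs_norm r (g x) + fs_norm r (s i x)"
      using fs_norm_lincomb_le[OF FS_formal_series[OF fs_measurable_FS[OF g that]] FS_formal_series less_imp_le[OF r], where g = "s i x" and a = 1 and b = "- 1"]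
      by (simp add: fs_diff_lincomb)
    also have "\<dots> \<le> ennreal b + ennreal b" using b(2)[OF that] sb by (intro add_mono)
    also have "\<dots> = ennreal (2 * b)" using b(1) by (simp flip: ennreal_plus)
    finally show ?thesis .
  qed
  have conv: "(\<lambda>i. \<integral>\<^sup>+x. fs_norm r (fs_diff (g x) (s i x)) \<partial>M) \<longlonglongrightarrow> (\<integral>\<^sup>+x. 0 \<partial>M)"
  proof (rule nn_integral_dominated_convergence[where w = "\<lambda>x. ennreal (2 * b)"])
    show "(\<lambda>x. fs_norm r (fs_diff (g x) (s i x))) \<in> borel_measurable M" for i
      using fs_norm_measurable[OF M dm] r by simp
    show "AE x in M. fs_norm r (fs_diff (g x) (s i x)) \<le> ennreal (2 * b)" for i using db by (intro AE_I2)
    show "(\<integral>\<^sup>+x. ennreal (2 * b) \<partial>M) < \<infinity>" using fin by (simp add: ennreal_mult_less_top less_top)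
    show "AE x in M. (\<lambda>i. fs_norm r (fs_diff (g x) (s i x))) \<longlonglongrightarrow> 0" by (rule slim)
  qed auto
  then have conv0: "(\<lambda>i. \<integral>\<^sup>+x. fs_norm r (fs_diff (g x) (s i x)) \<partial>M) \<longlonglongrightarrow> 0" by simp
  have si: "fs_simple_integrable M r (s i)" for i
    unfolding fs_simple_integrable_def
  proof (intro conjI ss sF)
    have "emeasure M {x \<in> space M. s i x \<noteq> (\<lambda>p \<phi>. 0)} \<le> emeasure M (space M)" by (rule emeasure_space)
    then show "emeasure M {x \<in> space M. s i x \<noteq> (\<lambda>p \<phi>. 0)} \<noteq> \<infinity>" using fin by (auto simp: top_unique)
  qed
  have "fs_norm r (fs_diff (\<lambda>p \<phi>. \<integral>x. g x p \<phi> \<partial>M) (fs_simple_integral M (s i))) \<le> (\<integral>\<^sup>+x. fs_norm r (fs_diff (g x) (s i x)) \<partial>M)" for i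
  proof -
    have "fs_diff (\<lambda>p \<phi>. \<integral>x. g x p \<phi> \<partial>M) (fs_simple_integral M (s i)) = (\<lambda>p \<phi>. \<integral>x. fs_diff (g x) (s i x) p \<phi> \<partial>M)"
    proof (intro ext)
      fix p \<phi>
      have "has_bochner_integral M (\<lambda>x. s i x p \<phi>) (fs_simple_integral M (s i) p \<phi>)"
        using has_bochner_integral_simple_bochner_integrable[OF fs_simple_integrable_eval(1)[OF si, of i p \<phi>]]
          fs_simple_integrable_eval(2)[OF si, of i p \<phi>] by simp
      then have "integrable M (\<lambda>x. s i x p \<phi>)" "(\<integral>x. s i x p \<phi> \<partial>M) = fs_simple_integral M (s i) p \<phi>"
        by (auto simp: has_bochner_integral_iff)
      then show "fs_diff (\<lambda>p \<phi>. \<integral>x. g x p \<phi> \<partial>M) (fs_simple_integral M (s i)) p \<phi> = (\<integral>x. fs_diff (g x) (s i x) p \<phi> \<partial>M)"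
        using I(1) by (simp add: fs_diff_def)
    qed
    moreover have "(\<integral>\<^sup>+x. fs_norm r (fs_diff (g x) (s i x)) \<partial>M) < \<infinity>"
    proof -
      have "(\<integral>\<^sup>+x. fs_norm r (fs_diff (g x) (s i x)) \<partial>M) \<le> (\<integral>\<^sup>+x. ennreal (2 * b) \<partial>M)"
        using db by (intro nn_integral_mono) auto
      also have "\<dots> < \<infinity>" using fin by (simp add: ennreal_mult_less_top less_top)
      finally show ?thesis .
    qed
    ultimately show ?thesis using fs_measurable_integral_bound(3)[OF r M dm] by simp
  qed
  then have "(\<lambda>i. fs_norm r (fs_diff (\<lambda>p \<phi>. \<integral>x. g x p \<phi> \<partial>M) (fs_simple_integral M (s i)))) \<longlonglongrightarrow> 0"
    by (intro tendsto_sandwich[OF _ _ tendsto_const conv0]) (auto intro: always_eventually)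
  then show "has_fs_integral M r g (\<lambda>p \<phi>. \<integral>x. g x p \<phi> \<partial>M)"
    unfolding has_fs_integral_def using g I(2) si conv0 by blast
qed

section \<open>Ordered time simplices\<close>

lemma complete_measure_restrict_completion:
  assumes "A \<in> sets (completion N)"
  shows "complete_measure (restrict_space (completion N) A)"
proof
  fix B C assume B: "B \<subseteq> C" and C: "C \<in> null_sets (restrict_space (completion N) A)"
  then have "C \<subseteq> A" "C \<in> null_sets (completion N)"
    using assms null_sets_restrict_space by blast+
  then have "B \<in> sets (completion N)" "B \<subseteq> A"
    using B completion.complete by blast+
  then show "B \<in> sets (restrict_space (completion N) A)"
    using assms by (auto simp: sets_restrict_space)
qed

abbreviation lborel_power :: "nat \<Rightarrow> (nat \<Rightarrow> real) measure" where
  "lborel_power k \<equiv> (\<Pi>\<^sub>M i\<in>{1..k}. lborel)"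

lemma null_sets_coordinate:
  assumes N: "N \<in> null_sets lborel" and i: "i \<in> {1..k}"
  shows "(\<lambda>\<tau>. \<tau> i) -` N \<inter> space (lborel_power k) \<in> null_sets (lborel_power k)"
proof -
  interpret product_sigma_finite "\<lambda>_. lborel :: real measure" ..
  have eq: "(\<lambda>\<tau>. \<tau> i) -` N \<inter> space (lborel_power k) = (\<Pi>\<^sub>E j\<in>{1..k}. if j = i then N else UNIV)"
    using i by (auto simp: space_PiM PiE_iff split: if_splits)
  have s: "(if j = i then N else UNIV) \<in> sets lborel" for j
    using N by auto
  have "emeasure (lborel_power k) (\<Pi>\<^sub>E j\<in>{1..k}. if j = i then N else UNIV)
    = (\<Prod>j\<in>{1..k}. emeasure lborel (if j = i then N else UNIV))"
    using s by (intro emeasure_PiM) auto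
  also have "\<dots> = 0"
    using i N by (intro prod_zero) (auto intro!: bexI[of _ i])
  finally show ?thesis
    unfolding eq using s by (intro null_setsI sets_PiM_I_finite) auto
qed

lemma coordinate_measurable:
  assumes "i \<in> {1..k}"
  shows "(\<lambda>\<tau>. \<tau> i) \<in> measurable (completion (lborel_power k)) lebesgue"
proof (rule complete_measure.measurable_completion2)
  show f: "(\<lambda>\<tau>. \<tau> i) \<in> measurable (completion (lborel_power k)) lborel"
    using assms by (intro measurable_completion measurable_component_singleton)
  show "null_sets lborel \<subseteq> null_sets (distr (completion (lborel_power k)) lborel (\<lambda>\<tau>. \<tau> i))"
  proof
    fix N :: "real set" assume N: "N \<in> null_sets lborel"
    have n: "(\<lambda>\<tau>. \<tau> i) -` N \<inter> space (lborel_power k) \<in> null_sets (lborel_power k)"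
      by (rule null_sets_coordinate[OF N assms])
    have "emeasure (distr (completion (lborel_power k)) lborel (\<lambda>\<tau>. \<tau> i)) N = emeasure (completion (lborel_power k)) ((\<lambda>\<tau>. \<tau> i) -` N \<inter> space (lborel_power k))"
      using N f by (subst emeasure_distr) auto
    also have "\<dots> = 0" using null_sets_completionI[OF n] by (rule null_setsD1)
    finally show "N \<in> null_sets (distr (completion (lborel_power k)) lborel (\<lambda>\<tau>. \<tau> i))"
      using N by (intro null_setsI) auto
  qed
qed (rule completion.complete_measure_axioms)

text \<open>The simple functions that approximate \<open>t \<mapsto> V t \<cdot> f\<close> are only Lebesgue measurable, and converge
only almost everywhere. Since the product measure is completed, coordinates are measurable with
respect to Lebesgue sets, and preimages of null sets of times are null sets.\<close>

lemma coordinate_restrict: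
  assumes i: "i \<in> {1..k}" and A: "A \<in> sets (completion (lborel_power k))" and AI: "\<And>\<tau>. \<tau> \<in> A \<Longrightarrow> \<tau> i \<in> I"
    and I: "I \<in> sets lebesgue"
  shows "(\<lambda>\<tau>. \<tau> i) \<in> measurable (restrict_space (completion (lborel_power k)) A) (lebesgue_on I)"
    and "(AE t in lebesgue_on I. P t) \<Longrightarrow> (AE \<tau> in restrict_space (completion (lborel_power k)) A. P (\<tau> i))"
proof -
  show "(\<lambda>\<tau>. \<tau> i) \<in> measurable (restrict_space (completion (lborel_power k)) A) (lebesgue_on I)"
    using coordinate_measurable[OF i] AI
    by (intro measurable_restrict_space2 measurable_restrict_space1) (auto simp: space_restrict_space)
  assume P: "AE t in lebesgue_on I. P t"
  have "AE t in lebesgue. t \<in> I \<longrightarrow> P t"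
    using P I by (subst (asm) AE_restrict_space_iff) auto
  then have "AE t in lborel. t \<in> I \<longrightarrow> P t" by (simp add: AE_completion_iff)
  then obtain N where N: "N \<in> null_sets lborel" "{t \<in> space lborel. \<not> (t \<in> I \<longrightarrow> P t)} \<subseteq> N"
    by (auto simp: eventually_ae_filter)
  have "AE \<tau> in lborel_power k. \<tau> i \<in> I \<longrightarrow> P (\<tau> i)"
    using N(2) by (intro AE_I'[OF null_sets_coordinate[OF N(1) i]]) auto
  then have "AE \<tau> in completion (lborel_power k). \<tau> i \<in> I \<longrightarrow> P (\<tau> i)" by (rule AE_completion)
  then have "AE \<tau> in completion (lborel_power k). \<tau> \<in> A \<longrightarrow> P (\<tau> i)"
    by eventually_elim (use AI in auto)
  then show "AE \<tau> in restrict_space (completion (lborel_power k)) A. P (\<tau> i)"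
    using A sets.sets_into_space[OF A] by (subst AE_restrict_space_iff) (auto simp: Int_absorb1)
qed

lemma time_simplex_iff:
  "\<tau> \<in> time_simplex k t1 t2 \<longleftrightarrow>
    \<tau> \<in> {1..k} \<rightarrow>\<^sub>E UNIV \<and> (\<forall>i\<in>{1..k}. \<tau> i \<in> open_segment t1 t2) \<and>
    (\<forall>i\<in>{1..k}. \<forall>j\<in>{1..k}. i < j \<longrightarrow> (if t1 \<le> t2 then \<tau> i < \<tau> j else \<tau> j < \<tau> i))"
  unfolding time_simplex_def open_segment_eq_real_ivl monotone_on_def
  by (auto simp: PiE_iff)

lemma time_simplex_sets: "time_simplex k t1 t2 \<in> sets (lborel_power k)"
proof -
  have "time_simplex k t1 t2 = {\<tau> \<in> space (lborel_power k). (\<forall>i\<in>{1..k}. \<tau> i \<in> open_segment t1 t2) \<and>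
    (\<forall>i\<in>{1..k}. \<forall>j\<in>{1..k}. i < j \<longrightarrow> (if t1 \<le> t2 then \<tau> i < \<tau> j else \<tau> j < \<tau> i))}"
    unfolding set_eq_iff time_simplex_iff by (simp add: space_PiM)
  also have "\<dots> \<in> sets (lborel_power k)"
    unfolding open_segment_eq_real_ivl
    by (cases "t1 \<le> t2") (simp_all, measurable)
  finally show ?thesis .
qed

text \<open>Fixing the last time \<open>y\<close> leaves the simplex of the earlier times between \<open>t1\<close> and \<open>y\<close>. This recursion gives the
volume in \<open>emeasure_time_simplex\<close>.\<close>

lemma time_simplex_fun_upd:
  assumes "x \<in> {1..k} \<rightarrow>\<^sub>E (UNIV :: real set)"
  shows "x(Suc k := y) \<in> time_simplex (Suc k) t1 t2 \<longleftrightarrow> y \<in> open_segment t1 t2 \<and> x \<in> time_simplex k t1 y"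
proof
  let ?x = "x(Suc k := y)"
  have E: "?x \<in> {1..Suc k} \<rightarrow>\<^sub>E UNIV" using assms by (auto simp: PiE_iff extensional_def)
  assume *: "?x \<in> time_simplex (Suc k) t1 t2"
  then have in_seg: "?x i \<in> open_segment t1 t2" if "i \<in> {1..Suc k}" for i
    using that unfolding time_simplex_iff by blast
  have ord: "if t1 \<le> t2 then ?x i < ?x j else ?x j < ?x i" if "i \<in> {1..Suc k}" "j \<in> {1..Suc k}" "i < j" for i j
    using * that unfolding time_simplex_iff by blast
  have y: "y \<in> open_segment t1 t2" using in_seg[of "Suc k"] by simp
  have "x i \<in> open_segment t1 y" if "i \<in> {1..k}" for i
    using in_seg[of i] ord[of i "Suc k"] that y by (auto simp: open_segment_eq_real_ivl split: if_splits)
  moreover have "if t1 \<le> y then x i < x j else x j < x i" if "i \<in> {1..k}" "j \<in> {1..k}" "i < j" for i j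
    using ord[of i j] that y by (auto simp: open_segment_eq_real_ivl split: if_splits)
  ultimately show "y \<in> open_segment t1 t2 \<and> x \<in> time_simplex k t1 y"
    using y assms unfolding time_simplex_iff by blast
next
  let ?x = "x(Suc k := y)"
  have E: "?x \<in> {1..Suc k} \<rightarrow>\<^sub>E UNIV" using assms by (auto simp: PiE_iff extensional_def)
  assume *: "y \<in> open_segment t1 t2 \<and> x \<in> time_simplex k t1 y"
  then have y: "y \<in> open_segment t1 t2" and x: "\<And>i. i \<in> {1..k} \<Longrightarrow> x i \<in> open_segment t1 y"
    "\<And>i j. i \<in> {1..k} \<Longrightarrow> j \<in> {1..k} \<Longrightarrow> i < j \<Longrightarrow> (if t1 \<le> y then x i < x j else x j < x i)"
    unfolding time_simplex_iff by blast+
  have "?x i \<in> open_segment t1 t2" if "i \<in> {1..Suc k}" for i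
    using x(1)[of i] that y by (cases "i = Suc k") (auto simp: open_segment_eq_real_ivl split: if_splits)
  moreover have "if t1 \<le> t2 then ?x i < ?x j else ?x j < ?x i" if "i \<in> {1..Suc k}" "j \<in> {1..Suc k}" "i < j" for i j
    using x(1)[of i] x(2)[of i j] that y
    by (cases "j = Suc k") (auto simp: open_segment_eq_real_ivl split: if_splits)
  ultimately show "?x \<in> time_simplex (Suc k) t1 t2"
    using E unfolding time_simplex_iff by blast
qed

lemma nn_integral_power_segment:
  "(\<integral>\<^sup>+y. indicator (open_segment t1 t2) y * ennreal (\<bar>y - t1\<bar> ^ k / fact k) \<partial>lborel)
    = ennreal (\<bar>t2 - t1\<bar> ^ Suc k / fact (Suc k))"
proof -
  define a where "a = min t1 t2"
  define b where "b = max t1 t2"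
  have ab: "a \<le> b" by (simp add: a_def b_def)
  have seg: "open_segment t1 t2 = {a<..<b}" by (auto simp: open_segment_eq_real_ivl a_def b_def)
  have null: "AE y in lborel. y \<noteq> a" "AE y in lborel. y \<noteq> b"
    using AE_lborel_singleton by auto
  have "(\<integral>\<^sup>+y. indicator (open_segment t1 t2) y * ennreal (\<bar>y - t1\<bar> ^ k / fact k) \<partial>lborel)
    = (\<integral>\<^sup>+y. ennreal (\<bar>y - t1\<bar> ^ k / fact k) * indicator {a..b} y \<partial>lborel)"
  proof (rule nn_integral_cong_AE)
    show "AE y in lborel. indicator (open_segment t1 t2) y * ennreal (\<bar>y - t1\<bar> ^ k / fact k)
      = ennreal (\<bar>y - t1\<bar> ^ k / fact k) * indicator {a..b} y"
      using null by eventually_elim (auto simp: seg indicator_def)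
  qed
  also have "\<dots> = ennreal (\<bar>t2 - t1\<bar> ^ Suc k / fact (Suc k))"
  proof (cases "t1 \<le> t2")
    case True
    then have ab': "a = t1" "b = t2" by (auto simp: a_def b_def)
    have "(\<integral>\<^sup>+y. ennreal (\<bar>y - t1\<bar> ^ k / fact k) * indicator {a..b} y \<partial>lborel)
      = (\<integral>\<^sup>+y. ennreal ((y - t1) ^ k / fact k) * indicator {a..b} y \<partial>lborel)"
      by (intro nn_integral_cong) (auto simp: indicator_def ab')
    also have "\<dots> = ennreal ((b - t1) ^ Suc k / fact (Suc k) - (a - t1) ^ Suc k / fact (Suc k))"
    proof (rule nn_integral_FTC_Icc)
      show "DERIV (\<lambda>y. (y - t1) ^ Suc k / fact (Suc k)) y :> (y - t1) ^ k / fact k" for y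
        by (rule DERIV_cong, (rule derivative_intros refl)+) (simp_all add: field_simps del: of_nat_Suc)
    qed (use ab ab' in auto)
    finally show ?thesis using True by (simp add: ab')
  next
    case False
    then have ab': "a = t2" "b = t1" by (auto simp: a_def b_def)
    have "(\<integral>\<^sup>+y. ennreal (\<bar>y - t1\<bar> ^ k / fact k) * indicator {a..b} y \<partial>lborel)
      = (\<integral>\<^sup>+y. ennreal ((t1 - y) ^ k / fact k) * indicator {a..b} y \<partial>lborel)"
      by (intro nn_integral_cong) (auto simp: indicator_def ab')
    also have "\<dots> = ennreal (- ((t1 - b) ^ Suc k / fact (Suc k)) - (- ((t1 - a) ^ Suc k / fact (Suc k))))"
    proof (rule nn_integral_FTC_Icc)
      show "DERIV (\<lambda>y. - ((t1 - y) ^ Suc k / fact (Suc k))) y :> (t1 - y) ^ k / fact k" for y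
        by (rule DERIV_cong, (rule derivative_intros refl)+) (simp_all add: field_simps del: of_nat_Suc)
    qed (use ab ab' in auto)
    finally show ?thesis using False by (simp add: ab')
  qed
  finally show ?thesis .
qed

lemma emeasure_time_simplex:
  "emeasure (lborel_power k) (time_simplex k t1 t2) = ennreal (\<bar>t2 - t1\<bar> ^ k / fact k)"
proof (induction k arbitrary: t2)
  case 0
  have "time_simplex 0 t1 t2 = {\<lambda>_. undefined}"
    by (auto simp: time_simplex_def monotone_on_def)
  then show ?case by (simp add: PiM_empty)
next
  case (Suc k)
  interpret product_sigma_finite "\<lambda>_. lborel :: real measure" ..
  have ins: "{1..Suc k} = insert (Suc k) {1..k}" by auto
  have m: "time_simplex (Suc k) t1 t2 \<in> sets (Pi\<^sub>M (insert (Suc k) {1..k}) (\<lambda>_. lborel))"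
    using time_simplex_sets[of "Suc k" t1 t2] unfolding ins .
  have "emeasure (lborel_power (Suc k)) (time_simplex (Suc k) t1 t2)
    = (\<integral>\<^sup>+\<tau>. indicator (time_simplex (Suc k) t1 t2) \<tau> \<partial>lborel_power (Suc k))"
    by (intro nn_integral_indicator[symmetric] time_simplex_sets)
  also have "\<dots> = (\<integral>\<^sup>+y. (\<integral>\<^sup>+x. indicator (time_simplex (Suc k) t1 t2) (x(Suc k := y)) \<partial>lborel_power k) \<partial>lborel)"
    unfolding ins using m by (intro product_nn_integral_insert_rev) auto
  also have "\<dots> = (\<integral>\<^sup>+y. (\<integral>\<^sup>+x. indicator (open_segment t1 t2) y * indicator (time_simplex k t1 y) x \<partial>lborel_power k) \<partial>lborel)"
    by (intro nn_integral_cong) (auto simp: space_PiM time_simplex_fun_upd indicator_def)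
  also have "\<dots> = (\<integral>\<^sup>+y. indicator (open_segment t1 t2) y * emeasure (lborel_power k) (time_simplex k t1 y) \<partial>lborel)"
    using time_simplex_sets by (intro nn_integral_cong) (simp add: nn_integral_cmult)
  also have "\<dots> = ennreal (\<bar>t2 - t1\<bar> ^ Suc k / fact (Suc k))"
    unfolding Suc.IH by (rule nn_integral_power_segment)
  finally show ?case .
qed

lemma time_simplex_mono:
  assumes "s \<in> closed_segment t1 t"
  shows "time_simplex k t1 s \<subseteq> time_simplex k t1 t"
proof
  fix \<tau> assume \<tau>: "\<tau> \<in> time_simplex k t1 s"
  have "\<tau> i \<in> open_segment t1 t" if "i \<in> {1..k}" for i
  proof -
    have "\<tau> i \<in> open_segment t1 s" using \<tau> that unfolding time_simplex_iff by blast
    then show ?thesis using assms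
      by (auto simp: open_segment_eq_real_ivl closed_segment_eq_real_ivl split: if_splits)
  qed
  moreover have "if t1 \<le> t then \<tau> i < \<tau> j else \<tau> j < \<tau> i" if "i \<in> {1..k}" "j \<in> {1..k}" "i < j" for i j
  proof -
    have "\<tau> i \<in> open_segment t1 s" "if t1 \<le> s then \<tau> i < \<tau> j else \<tau> j < \<tau> i"
      using \<tau> that unfolding time_simplex_iff by blast+
    then show ?thesis using assms
      by (auto simp: open_segment_eq_real_ivl closed_segment_eq_real_ivl split: if_splits)
  qed
  ultimately show "\<tau> \<in> time_simplex k t1 t"
    using \<tau> unfolding time_simplex_iff by blast
qed

section \<open>The majorant flow\<close>

lemma suminf_power_nonneg:
  fixes x :: "nat \<Rightarrow> real"
  assumes "\<And>p. 0 \<le> x p" "0 \<le> z" "summable (\<lambda>p. x p * z ^ p)"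
  shows "0 \<le> (\<Sum>p. x p * z ^ p)"
  using assms by (intro suminf_nonneg) auto

lemma suminf_power_pos:
  fixes x :: "nat \<Rightarrow> real"
  assumes "\<And>p. 0 \<le> x p" "0 < z" "summable (\<lambda>p. x p * z ^ p)" "x l \<noteq> 0"
  shows "0 < (\<Sum>p. x p * z ^ p)"
proof (rule suminf_pos2[where i = l])
  have "0 < x l" using assms(1)[of l] assms(4) by simp
  then show "0 < x l * z ^ l" using assms(2) by simp
qed (use assms in auto)

lemma suminf_power_mono:
  fixes F :: "nat \<Rightarrow> real"
  assumes "\<And>p. 0 \<le> F p" "0 \<le> y" "y \<le> z" "summable (\<lambda>p. F p * z ^ p)"
  shows "summable (\<lambda>p. F p * y ^ p)" "(\<Sum>p. F p * y ^ p) \<le> (\<Sum>p. F p * z ^ p)"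
proof -
  have le: "F p * y ^ p \<le> F p * z ^ p" for p using assms by (intro mult_left_mono power_mono) auto
  show s: "summable (\<lambda>p. F p * y ^ p)"
    using assms le by (intro summable_comparison_test'[OF assms(4)]) auto
  show "(\<Sum>p. F p * y ^ p) \<le> (\<Sum>p. F p * z ^ p)" using le s assms(4) by (intro suminf_le) auto
qed

text \<open>The trajectory decreases as long as it is positive, since \<open>X \<ge> 0\<close> on the positive axis. It stays positive:
after the last time at which it is not, it would decrease, and could not end at a positive value.\<close>

lemma majorant_flow:
  fixes x :: "nat \<Rightarrow> real" and \<gamma> :: "real \<Rightarrow> real"
  assumes x: "\<And>p. 0 \<le> x p" and T: "0 \<le> T"
    and sx: "\<And>s. s \<in> {0..T} \<Longrightarrow> summable (\<lambda>p. x p * \<bar>\<gamma> s\<bar> ^ p)"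
    and d: "\<And>s. s \<in> {0..T} \<Longrightarrow> (\<gamma> has_real_derivative - (\<Sum>p. x p * \<gamma> s ^ p)) (at s within {0..T})"
    and pos: "0 < \<gamma> T"
  shows "\<And>s. s \<in> {0..T} \<Longrightarrow> 0 < \<gamma> s"
    and "\<And>s t. 0 \<le> s \<Longrightarrow> s \<le> t \<Longrightarrow> t \<le> T \<Longrightarrow> \<gamma> t \<le> \<gamma> s"
    and "\<And>s t l. 0 \<le> s \<Longrightarrow> s < t \<Longrightarrow> t \<le> T \<Longrightarrow> x l \<noteq> 0 \<Longrightarrow> \<gamma> t < \<gamma> s"
proof -
  have cont: "continuous_on {0..T} \<gamma>"
    using d by (intro DERIV_continuous_on)
  have d_at: "DERIV \<gamma> s :> - (\<Sum>p. x p * \<gamma> s ^ p)" if "0 < s" "s < T" for s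
    using d[of s] that by (simp add: at_within_Icc_at)
  have dec: "\<gamma> b \<le> \<gamma> a" if ab: "0 \<le> a" "a \<le> b" "b \<le> T" "\<And>s. a < s \<Longrightarrow> s < b \<Longrightarrow> 0 < \<gamma> s" for a b
  proof -
    have "- \<gamma> a \<le> - \<gamma> b"
    proof (rule DERIV_nonneg_imp_increasing_open[OF ab(2)])
      fix s assume s: "a < s" "s < b"
      have "DERIV (\<lambda>s. - \<gamma> s) s :> (\<Sum>p. x p * \<gamma> s ^ p)"
        using DERIV_minus[OF d_at[of s]] s ab by simp
      moreover have "0 \<le> (\<Sum>p. x p * \<gamma> s ^ p)"
      proof (rule suminf_power_nonneg[OF x])
        have "0 < \<gamma> s" using ab(4) s by blast
        then show "0 \<le> \<gamma> s" "summable (\<lambda>p. x p * \<gamma> s ^ p)"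
          using sx[of s] s(1,2) ab(1-3) by simp_all
      qed
      ultimately show "\<exists>y. DERIV (\<lambda>s. - \<gamma> s) s :> y \<and> 0 \<le> y" by blast
    next
      show "continuous_on {a..b} (\<lambda>s. - \<gamma> s)"
        using ab by (intro continuous_intros continuous_on_subset[OF cont]) auto
    qed
    then show ?thesis by simp
  qed
  show pos': "0 < \<gamma> s" if s: "s \<in> {0..T}" for s
  proof (rule ccontr)
    assume neg: "\<not> 0 < \<gamma> s"
    define Z where "Z = {0..T} \<inter> \<gamma> -` {..0}"
    have "compact Z"
      unfolding Z_def compact_eq_bounded_closed
      by (intro conjI bounded_Int disjI1 bounded_closed_interval continuous_closed_preimage[OF cont]) auto
    moreover have "Z \<noteq> {}" using s neg by (auto simp: Z_def)
    ultimately obtain m where m: "m \<in> Z" "\<And>z. z \<in> Z \<Longrightarrow> z \<le> m"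
      using compact_attains_sup[of Z] by blast
    have "\<gamma> T \<le> \<gamma> m"
    proof (rule dec)
      show "0 < \<gamma> s" if "m < s" "s < T" for s
        using m(2)[of s] m(1) that by (auto simp: Z_def not_le[symmetric])
    qed (use m in \<open>auto simp: Z_def\<close>)
    then show False using pos m(1) by (auto simp: Z_def)
  qed
  show "\<gamma> t \<le> \<gamma> s" if "0 \<le> s" "s \<le> t" "t \<le> T" for s t
    using that by (intro dec pos') auto
  show "\<gamma> t < \<gamma> s" if st: "0 \<le> s" "s < t" "t \<le> T" and l: "x l \<noteq> 0" for s t l
  proof (rule DERIV_neg_imp_decreasing_open[OF st(2)])
    fix r assume r: "s < r" "r < t"
    have "0 < (\<Sum>p. x p * \<gamma> r ^ p)"
      using x pos'[of r] sx[of r] r st l by (intro suminf_power_pos[where l = l]) auto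
    then show "\<exists>y. DERIV \<gamma> r :> y \<and> y < 0" using d_at[of r] r st by force
  next
    show "continuous_on {s..t} \<gamma>" using st by (intro continuous_on_subset[OF cont]) auto
  qed
qed

lemma transport_summable:
  assumes F: "\<And>p. 0 \<le> F p" and x: "\<And>p. 0 \<le> x p"
    and sF: "\<And>r. 0 \<le> r \<Longrightarrow> r < R \<Longrightarrow> summable (\<lambda>p. F p * r ^ p)"
    and sx: "\<And>r. 0 \<le> r \<Longrightarrow> r < R \<Longrightarrow> summable (\<lambda>p. x p * r ^ p)"
    and r: "0 \<le> r" "r < R"
  shows "summable (\<lambda>p. diffs F p * r ^ p)"
    and "summable (\<lambda>p. transport x F p * r ^ p)"
    and "(\<Sum>p. transport x F p * r ^ p) = (\<Sum>p. diffs F p * r ^ p) * (\<Sum>p. x p * r ^ p)"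
proof -
  show sd: "summable (\<lambda>p. diffs F p * r ^ p)"
  proof (rule termdiff_converges[where K = R])
    fix z :: real assume z: "norm z < R"
    show "summable (\<lambda>p. F p * z ^ p)"
    proof (rule summable_comparison_test')
      show "summable (\<lambda>p. F p * \<bar>z\<bar> ^ p)" using sF[of "\<bar>z\<bar>"] z by simp
      show "norm (F p * z ^ p) \<le> F p * \<bar>z\<bar> ^ p" for p using F by (simp add: abs_mult power_abs)
    qed
  qed (use r in simp)
  have "(\<lambda>p. transport x F p * r ^ p) sums ((\<Sum>p. diffs F p * r ^ p) * (\<Sum>p. x p * r ^ p))"
    by (rule transport_sums[OF F x r(1) sd sx[OF r]])
  then show "summable (\<lambda>p. transport x F p * r ^ p)"
    and "(\<Sum>p. transport x F p * r ^ p) = (\<Sum>p. diffs F p * r ^ p) * (\<Sum>p. x p * r ^ p)"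
    by (auto simp: sums_iff)
qed

text \<open>The partial sums of \<open>exp (s X d/dz) F\<close> at \<open>u 0\<close> stay below \<open>F (u s)\<close>. Both sides agree at \<open>s = 0\<close>,
and the difference of their derivatives is the difference of the two sides for \<open>transport x F\<close> and one term less.\<close>

lemma transport_exponential_bound_interior:
  fixes u :: "real \<Rightarrow> real"
  assumes x: "\<And>p. 0 \<le> x p" and sx: "\<And>r. 0 \<le> r \<Longrightarrow> r < R \<Longrightarrow> summable (\<lambda>p. x p * r ^ p)"
    and u: "\<And>s. 0 \<le> s \<Longrightarrow> s < T \<Longrightarrow> 0 \<le> u s \<and> u s < R"
    and du: "\<And>s. 0 \<le> s \<Longrightarrow> s < T \<Longrightarrow> (u has_real_derivative (\<Sum>p. x p * u s ^ p)) (at s within {0..T})"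
    and F: "\<And>p. 0 \<le> F p" and sF: "\<And>r. 0 \<le> r \<Longrightarrow> r < R \<Longrightarrow> summable (\<lambda>p. F p * r ^ p)"
    and s: "0 \<le> s" "s < T"
  shows "(\<Sum>k<n. s ^ k / fact k * (\<Sum>p. (transport x ^^ k) F p * u 0 ^ p)) \<le> (\<Sum>p. F p * u s ^ p)"
  using F sF s
proof (induction n arbitrary: F s)
  case 0
  then show ?case using u[of s] by (simp add: suminf_power_nonneg)
next
  case (Suc n)
  define N where "N k = (\<Sum>p. (transport x ^^ k) F p * u 0 ^ p)" for k
  define S where "S s = (\<Sum>k<Suc n. s ^ k / fact k * N k)" for s :: real
  define D where "D s = (\<Sum>p. F p * u s ^ p) - S s" for s
  define D' where "D' s = (\<Sum>p. transport x F p * u s ^ p) - (\<Sum>k<n. s ^ k / fact k * N (Suc k))" for s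
  have S': "(S has_real_derivative (\<Sum>k<n. s ^ k / fact k * N (Suc k))) (at s within X)" for s X
  proof -
    have eq: "S = (\<lambda>s. N 0 + (\<Sum>k<n. s ^ Suc k / fact (Suc k) * N (Suc k)))"
      unfolding S_def fun_eq_iff by (subst sum.lessThan_Suc_shift) simp
    show ?thesis unfolding eq
      by (rule DERIV_cong, (rule derivative_intros refl)+)
        (auto intro!: sum.cong simp: field_simps simp del: of_nat_Suc)
  qed
  have deriv: "(D has_real_derivative D' s) (at s within {0..T})" if "0 \<le> s" "s < T" for s
  proof -
    have us: "0 \<le> u s" "u s < R" using u that by auto
    obtain K where K: "u s < K" "K < R" using dense us(2) by blast
    have "DERIV (\<lambda>z. \<Sum>p. F p * z ^ p) (u s) :> (\<Sum>p. diffs F p * u s ^ p)"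
      using Suc.prems(2)[of K] us K by (intro termdiffs_strong[where K = K]) auto
    then have "((\<lambda>s. \<Sum>p. F p * u s ^ p) has_real_derivative (\<Sum>p. diffs F p * u s ^ p) * (\<Sum>p. x p * u s ^ p)) (at s within {0..T})"
      using du[OF that] by (rule DERIV_chain2)
    also have "(\<Sum>p. diffs F p * u s ^ p) * (\<Sum>p. x p * u s ^ p) = (\<Sum>p. transport x F p * u s ^ p)"
      using transport_summable(3)[OF Suc.prems(1) x Suc.prems(2) sx us] by simp
    finally show ?thesis unfolding D_def D'_def by (intro derivative_intros S')
  qed
  \<comment> \<open>the derivative of \<open>D\<close> is nonnegative by the induction hypothesis for \<open>transport x F\<close>\<close>
  have "D 0 \<le> D s"
  proof (rule DERIV_nonneg_imp_increasing_open[of 0 s D])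
    fix r assume r: "0 < r" "r < s"
    have "DERIV D r :> D' r" using deriv[of r] r Suc.prems by (simp add: at_within_Icc_at)
    moreover have "0 \<le> D' r"
    proof -
      have "(\<Sum>k<n. r ^ k / fact k * (\<Sum>p. (transport x ^^ k) (transport x F) p * u 0 ^ p)) \<le> (\<Sum>p. transport x F p * u r ^ p)"
        using Suc.prems r x
        by (intro Suc.IH transport_nonneg transport_summable(2)[OF _ x _ sx]) auto
      then show ?thesis by (simp add: D'_def N_def funpow_swap1)
    qed
    ultimately show "\<exists>y. DERIV D r :> y \<and> 0 \<le> y" by blast
  next
    show "continuous_on {0..s} D"
    proof (rule DERIV_continuous_on)
      show "(D has_real_derivative D' r) (at r within {0..s})" if "r \<in> {0..s}" for r
        using deriv[of r] that Suc.prems by (auto intro: DERIV_subset)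
    qed
  qed (use Suc.prems in simp)
  moreover have "D 0 = 0"
    unfolding D_def S_def by (subst sum.lessThan_Suc_shift) (simp add: N_def)
  ultimately show ?case by (simp add: D_def S_def N_def)
qed

text \<open>At the final time \<open>u\<close> reaches \<open>R\<close>, where \<open>F\<close> converges but need not be differentiable. The left-hand
side is a polynomial in the time, so the estimate extends by continuity.\<close>

lemma transport_exponential_bound:
  fixes u :: "real \<Rightarrow> real"
  assumes x: "\<And>p. 0 \<le> x p" and sx: "\<And>r. 0 \<le> r \<Longrightarrow> r < R \<Longrightarrow> summable (\<lambda>p. x p * r ^ p)"
    and u: "\<And>s. 0 \<le> s \<Longrightarrow> s < T \<Longrightarrow> 0 \<le> u s \<and> u s < R"
    and du: "\<And>s. 0 \<le> s \<Longrightarrow> s < T \<Longrightarrow> (u has_real_derivative (\<Sum>p. x p * u s ^ p)) (at s within {0..T})"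
    and F: "\<And>p. 0 \<le> F p" and sF: "summable (\<lambda>p. F p * R ^ p)"
    and T: "0 < T"
  shows "(\<Sum>k<n. T ^ k / fact k * (\<Sum>p. (transport x ^^ k) F p * u 0 ^ p)) \<le> (\<Sum>p. F p * R ^ p)"
proof -
  have sF': "summable (\<lambda>p. F p * r ^ p)" if "0 \<le> r" "r < R" for r
    using suminf_power_mono(1)[OF F that(1) less_imp_le[OF that(2)] sF] .
  have le: "(\<Sum>k<n. s ^ k / fact k * (\<Sum>p. (transport x ^^ k) F p * u 0 ^ p)) \<le> (\<Sum>p. F p * R ^ p)"
    if "0 \<le> s" "s < T" for s
    using transport_exponential_bound_interior[OF x sx u du F sF' that, of n]
      suminf_power_mono(2)[OF F _ _ sF, of "u s"] u[OF that] by simp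
  have "((\<lambda>s. \<Sum>k<n. s ^ k / fact k * (\<Sum>p. (transport x ^^ k) F p * u 0 ^ p)) \<longlongrightarrow>
    (\<Sum>k<n. T ^ k / fact k * (\<Sum>p. (transport x ^^ k) F p * u 0 ^ p))) (at_left T)"
    by (intro tendsto_intros) auto
  then show ?thesis
  proof (rule tendsto_upperbound)
    show "\<forall>\<^sub>F s in at_left T. (\<Sum>k<n. s ^ k / fact k * (\<Sum>p. (transport x ^^ k) F p * u 0 ^ p)) \<le> (\<Sum>p. F p * R ^ p)"
      unfolding eventually_at_left[OF T] using T le by (intro exI[of _ 0]) auto
  qed simp
qed

section \<open>Series of formal series\<close>

lemma fs_scale_formal_series: "f \<in> formal_series \<Longrightarrow> (\<lambda>p \<phi>. c *\<^sub>R f p \<phi>) \<in> formal_series"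
  using fs_lincomb_formal_series[of f f c 0] by (simp add: fs_lincomb_def)

lemma fs_norm_scale_le:
  assumes "f \<in> formal_series" "0 \<le> r"
  shows "fs_norm r (\<lambda>p \<phi>. c *\<^sub>R f p \<phi>) \<le> ennreal \<bar>c\<bar> * fs_norm r f"
  using fs_norm_lincomb_le[OF assms(1,1,2), of c 0] by (simp add: fs_lincomb_def)

lemma FS_sum:
  assumes "finite A" "\<And>i. i \<in> A \<Longrightarrow> f i \<in> FS r" "0 \<le> r"
  shows "(\<lambda>p \<phi>. \<Sum>i\<in>A. c i *\<^sub>R f i p \<phi>) \<in> FS r"
  using assms
proof (induction A rule: finite_induct)
  case (insert i A)
  then show ?case
    using fs_lincomb_FS[of "f i" r "\<lambda>p \<phi>. \<Sum>i\<in>A. c i *\<^sub>R f i p \<phi>" "c i" 1] by (simp add: fs_lincomb_def)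
qed (simp add: zero_FS)

lemma fs_series:
  fixes h :: "nat \<Rightarrow> ('a::real_normed_vector, real) fseries"
  assumes r: "0 < r" and h: "\<And>k. h k \<in> formal_series" and hc: "\<And>k. fs_norm r (h k) \<le> ennreal (c k)"
    and c: "\<And>k. 0 \<le> c k" "summable c"
  shows "(\<lambda>p \<phi>. \<Sum>k. h k p \<phi>) \<in> FS r"
    and "fs_norm r (\<lambda>p \<phi>. \<Sum>k. h k p \<phi>) \<le> ennreal (suminf c)"
    and "\<And>p \<phi>. summable (\<lambda>k. h k p \<phi>)"
    and "(\<lambda>n. fs_norm r (fs_diff (\<lambda>p \<phi>. \<Sum>k. h k p \<phi>) (\<lambda>p \<phi>. \<Sum>k<n. h k p \<phi>))) \<longlonglongrightarrow> 0"
proof -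
  have tail: "summable (\<lambda>k. h (k + n) p \<phi>)" "(\<lambda>p \<phi>. \<Sum>k. h (k + n) p \<phi>) \<in> FS r"
    "fs_norm r (\<lambda>p \<phi>. \<Sum>k. h (k + n) p \<phi>) \<le> ennreal (\<Sum>k. c (k + n))" for n p \<phi>
  proof -
    have "(\<Sum>k. fs_norm r (h (k + n))) \<le> (\<Sum>k. ennreal (c (k + n)))"
      using hc by (intro suminf_le) auto
    also have "\<dots> = ennreal (\<Sum>k. c (k + n))"
      using c by (intro suminf_ennreal2) auto
    finally have le: "(\<integral>\<^sup>+k. fs_norm r (h (k + n)) \<partial>count_space UNIV) \<le> ennreal (\<Sum>k. c (k + n))"
      by (simp add: nn_integral_count_space_nat)
    then have fin: "(\<integral>\<^sup>+k. fs_norm r (h (k + n)) \<partial>count_space UNIV) < \<infinity>"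
      by (auto intro: le_less_trans)
    note I = fs_integral_bound[of r "count_space UNIV" "\<lambda>k. h (k + n)", OF r h _ _ fin]
    have int: "integrable (count_space UNIV) (\<lambda>k. h (k + n) p \<phi>)" for p \<phi> using I(1) by simp
    then show "summable (\<lambda>k. h (k + n) p \<phi>)"
      by (simp add: integrable_count_space_nat_iff summable_norm_cancel)
    have "(\<integral>k. h (k + n) p \<phi> \<partial>count_space UNIV) = (\<Sum>k. h (k + n) p \<phi>)" for p \<phi>
      by (rule integral_count_space_nat[OF int])
    then show "(\<lambda>p \<phi>. \<Sum>k. h (k + n) p \<phi>) \<in> FS r"
      "fs_norm r (\<lambda>p \<phi>. \<Sum>k. h (k + n) p \<phi>) \<le> ennreal (\<Sum>k. c (k + n))"
      using I(2) order_trans[OF I(3) le] by simp_all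
  qed
  show "(\<lambda>p \<phi>. \<Sum>k. h k p \<phi>) \<in> FS r"
    and "fs_norm r (\<lambda>p \<phi>. \<Sum>k. h k p \<phi>) \<le> ennreal (suminf c)"
    and "\<And>p \<phi>. summable (\<lambda>k. h k p \<phi>)"
    using tail[of 0] by simp_all
  have eq: "fs_diff (\<lambda>p \<phi>. \<Sum>k. h k p \<phi>) (\<lambda>p \<phi>. \<Sum>k<n. h k p \<phi>) = (\<lambda>p \<phi>. \<Sum>k. h (k + n) p \<phi>)" for n
  proof (intro ext)
    fix p \<phi>
    have "summable (\<lambda>k. h k p \<phi>)" using tail(1)[of 0 p \<phi>] by simp
    from suminf_minus_initial_segment[OF this, of n]
    show "fs_diff (\<lambda>p \<phi>. \<Sum>k. h k p \<phi>) (\<lambda>p \<phi>. \<Sum>k<n. h k p \<phi>) p \<phi> = (\<Sum>k. h (k + n) p \<phi>)"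
      by (simp add: fs_diff_def)
  qed
  have "(\<lambda>n. suminf c - (\<Sum>k<n. c k)) \<longlonglongrightarrow> suminf c - suminf c"
    by (intro tendsto_intros summable_LIMSEQ c)
  then have lim: "(\<lambda>n. ennreal (\<Sum>k. c (k + n))) \<longlonglongrightarrow> 0"
    using tendsto_ennrealI[of "\<lambda>n. \<Sum>k. c (k + n)" 0 sequentially]
    by (simp add: suminf_minus_initial_segment[OF c(2)])
  then show "(\<lambda>n. fs_norm r (fs_diff (\<lambda>p \<phi>. \<Sum>k. h k p \<phi>) (\<lambda>p \<phi>. \<Sum>k<n. h k p \<phi>))) \<longlonglongrightarrow> 0"
    unfolding eq
    by (rule tendsto_sandwich[OF always_eventually[OF allI[OF zero_le]] always_eventually[OF allI[OF tail(3)]] tendsto_const])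
qed

section \<open>The chronological exponential, pointwise\<close>

definition chron_sign :: "real \<Rightarrow> real \<Rightarrow> nat \<Rightarrow> real" where
  "chron_sign t1 t2 k = (if t1 \<le> t2 then 1 else (- 1) ^ k)"

lemma abs_chron_sign [simp]: "\<bar>chron_sign t1 t2 k\<bar> = 1"
  by (simp add: chron_sign_def power_abs)

lemma complete_simplex_measure: "complete_measure (simplex_measure k t1 t2)"
  unfolding simplex_measure_def
  by (intro complete_measure_restrict_completion sets_completionI_sets time_simplex_sets)

lemma space_simplex_measure: "space (simplex_measure k t1 t2) = time_simplex k t1 t2"
  unfolding simplex_measure_def
  using sets.sets_into_space[OF time_simplex_sets[of k t1 t2]] by (auto simp: space_restrict_space)

text \<open>A chronological exponential is a convergent sum of ordinary integrals at every point. This determines it.\<close>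

lemma has_Texp_eval:
  fixes f g :: "('a::real_normed_vector, real) fseries"
  assumes r: "0 < r" and "has_Texp r V t1 t2 f g"
  obtains h where
    "\<And>k p \<phi>. has_bochner_integral (simplex_measure k t1 t2) (\<lambda>\<tau>. vf_iter V \<tau> k f p \<phi>) (h k p \<phi>)"
    "\<And>p \<phi>. (\<lambda>k. chron_sign t1 t2 k * h k p \<phi>) sums g p \<phi>"
proof -
  obtain h where g: "g \<in> FS r"
    and h: "\<And>k. has_fs_integral (simplex_measure k t1 t2) r (\<lambda>\<tau>. vf_iter V \<tau> k f) (h k)"
    and lim: "(\<lambda>n. fs_norm r (fs_diff g (\<lambda>p \<phi>. \<Sum>k<n. chron_sign t1 t2 k *\<^sub>R h k p \<phi>))) \<longlonglongrightarrow> 0"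
    using assms(2) unfolding has_Texp_def chron_sign_def by blast
  have hF: "h k \<in> FS r" for k using h unfolding has_fs_integral_def by blast
  show thesis
  proof (rule that)
    show "has_bochner_integral (simplex_measure k t1 t2) (\<lambda>\<tau>. vf_iter V \<tau> k f p \<phi>) (h k p \<phi>)" for k p \<phi>
      by (rule has_fs_integral_eval[OF r complete_simplex_measure h])
    show "(\<lambda>k. chron_sign t1 t2 k * h k p \<phi>) sums g p \<phi>" for p \<phi>
    proof -
      obtain K where K: "\<And>f h. f \<in> FS r \<Longrightarrow> h \<in> FS r \<Longrightarrow> ennreal \<bar>f p \<phi> - h p \<phi>\<bar> \<le> ennreal K * fs_norm r (fs_diff f h)"
        using fs_lipschitz_eval[OF r, of p \<phi>] unfolding fs_lipschitz_def by blast
      have S: "(\<lambda>p \<phi>. \<Sum>k<n. chron_sign t1 t2 k *\<^sub>R h k p \<phi>) \<in> FS r" for n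
        using hF r by (intro FS_sum) auto
      have "(\<lambda>n. \<Sum>k<n. chron_sign t1 t2 k *\<^sub>R h k p \<phi>) \<longlonglongrightarrow> g p \<phi>"
        using K[OF g S] by (intro ennreal_tendsto_0_bound[OF lim] always_eventually allI)
      then show ?thesis unfolding sums_def by simp
    qed
  qed
qed

lemma has_Texp_unique:
  fixes f g g' :: "('a::real_normed_vector, real) fseries"
  assumes "0 < r" "has_Texp r V t1 t2 f g" "has_Texp r V t1 t2 f g'"
  shows "g = g'"
proof (intro ext)
  fix p \<phi>
  obtain h where h: "\<And>k p \<phi>. has_bochner_integral (simplex_measure k t1 t2) (\<lambda>\<tau>. vf_iter V \<tau> k f p \<phi>) (h k p \<phi>)"
    "\<And>p \<phi>. (\<lambda>k. chron_sign t1 t2 k * h k p \<phi>) sums g p \<phi>"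
    using has_Texp_eval[OF assms(1,2)] by blast
  obtain h' where h': "\<And>k p \<phi>. has_bochner_integral (simplex_measure k t1 t2) (\<lambda>\<tau>. vf_iter V \<tau> k f p \<phi>) (h' k p \<phi>)"
    "\<And>p \<phi>. (\<lambda>k. chron_sign t1 t2 k * h' k p \<phi>) sums g' p \<phi>"
    using has_Texp_eval[OF assms(1,3)] by blast
  have "h k p \<phi> = h' k p \<phi>" for k
    by (rule has_bochner_integral_eq[OF h(1) h'(1)])
  then show "g p \<phi> = g' p \<phi>" using sums_unique2[OF h(2)] h'(2) by simp
qed

lemma Texp_eq:
  fixes f g :: "('a::real_normed_vector, real) fseries"
  assumes "0 < r" "has_Texp r V t1 t2 f g"
  shows "Texp r V t1 t2 f = g" "\<exists>!g. has_Texp r V t1 t2 f g"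
proof -
  show "\<exists>!g. has_Texp r V t1 t2 f g" using assms has_Texp_unique by blast
  show "Texp r V t1 t2 f = g"
    unfolding Texp_def by (rule the_equality, rule assms(2)) (rule has_Texp_unique[OF assms(1) _ assms(2)])
qed

section \<open>Iterated action of a majorized family\<close>

lemma vf_iter_formal_series:
  assumes V: "\<And>i. i \<in> {1..k} \<Longrightarrow> V (\<tau> i) \<in> formal_series" and f: "f \<in> formal_series"
  shows "vf_iter V \<tau> k f \<in> formal_series"
  using assms by (induction k) (auto intro!: vf_act_formal_series(1))

lemma vf_iter_lincomb:
  assumes V: "\<And>i. i \<in> {1..k} \<Longrightarrow> V (\<tau> i) \<in> formal_series" and f: "f \<in> formal_series" and g: "g \<in> formal_series"
  shows "vf_iter V \<tau> k (fs_lincomb a f b g) = fs_lincomb a (vf_iter V \<tau> k f) b (vf_iter V \<tau> k g)"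
  using assms(1)
proof (induction k)
  case (Suc k)
  have "vf_iter V \<tau> k f \<in> formal_series" "vf_iter V \<tau> k g \<in> formal_series"
    using Suc.prems f g by (auto intro!: vf_iter_formal_series)
  then show ?case using Suc by (simp add: vf_act_lincomb)
qed simp

lemma funpow_transport_nonneg:
  assumes "\<And>p. 0 \<le> x p" "\<And>p. 0 \<le> F p"
  shows "0 \<le> (transport x ^^ k) F p"
  using assms by (induction k arbitrary: p) (auto intro!: transport_nonneg)

lemma tnorm_vf_iter_le:
  assumes V: "\<And>i. i \<in> {1..k} \<Longrightarrow> V (\<tau> i) \<in> formal_series"
    and le: "\<And>i p. i \<in> {1..k} \<Longrightarrow> tnorm p (V (\<tau> i) p) \<le> x p" and f: "f \<in> formal_series"
  shows "tnorm p (vf_iter V \<tau> k f p) \<le> (transport x ^^ k) (\<lambda>p. tnorm p (f p)) p"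
  using V le
proof (induction k arbitrary: p)
  case (Suc k)
  have i: "vf_iter V \<tau> k f \<in> formal_series" and V': "V (\<tau> (Suc k)) \<in> formal_series"
    using Suc.prems f by (auto intro!: vf_iter_formal_series)
  have "tnorm p (vf_iter V \<tau> (Suc k) f p) \<le> transport (\<lambda>p. tnorm p (V (\<tau> (Suc k)) p)) (\<lambda>p. tnorm p (vf_iter V \<tau> k f p)) p"
    using vf_act_formal_series(2)[OF V' i] by simp
  also have "\<dots> \<le> transport x ((transport x ^^ k) (\<lambda>p. tnorm p (f p))) p"
    using Suc.prems Suc.IH tnorm_nonneg[OF formal_seriesD[OF i]] tnorm_nonneg[OF formal_seriesD[OF V']]
    by (intro transport_mono) auto
  finally show ?case by simp
qed simp

lemma fs_measurable_const: "c \<in> FS r \<Longrightarrow> fs_measurable M r (\<lambda>x. c)"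
  unfolding fs_measurable_def
  by (auto intro!: exI[of _ "\<lambda>i x. c"] simp: fs_diff_def fs_norm_zero)

text \<open>A normal family with majorant \<open>x\<close>, acting on series of radius \<open>R\<close>, without reference to a flow.\<close>

locale majorized_family =
  fixes V :: "real \<Rightarrow> ('a::banach, 'a) fseries" and x :: "nat \<Rightarrow> real" and I :: "real set" and R :: real
  assumes V: "\<And>t. t \<in> I \<Longrightarrow> V t \<in> formal_series"
    and V_le: "\<And>t p. t \<in> I \<Longrightarrow> tnorm p (V t p) \<le> x p"
    and x: "\<And>p. 0 \<le> x p"
    and sx: "\<And>r. 0 \<le> r \<Longrightarrow> r < R \<Longrightarrow> summable (\<lambda>p. x p * r ^ p)"
    and I: "I \<in> sets lebesgue"
    and meas: "\<And>r f. 0 < r \<Longrightarrow> r < R \<Longrightarrow> (f :: ('a, real) fseries) \<in> FSd 1 r \<Longrightarrow>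
      fs_measurable (lebesgue_on I) r (\<lambda>t. vf_act (V t) f)"
begin

text \<open>Every application of a vector field needs a slightly larger radius for its argument, and there is always room
below \<open>R\<close>. All \<open>n\<close> time coordinates are kept throughout the induction on the
number \<open>k\<close> of vector fields applied, so that no change of the product space occurs.\<close>

lemma vf_iter_measurable:
  fixes f :: "('a, real) fseries"
  assumes A: "A \<in> sets (completion (lborel_power n))" and AI: "\<forall>\<tau>\<in>A. \<forall>i\<in>{1..n}. \<tau> i \<in> I"
    and f: "f \<in> FS R" and r: "0 < r" "r < R" and k: "k \<le> n"
  shows "fs_measurable (restrict_space (completion (lborel_power n)) A) r (\<lambda>\<tau>. vf_iter V \<tau> k f)"
  using r k
proof (induction k arbitrary: r)
  case 0
  then show ?case using FS_mono[of r R f] f by (simp add: fs_measurable_const)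
next
  case (Suc k)
  let ?M = "restrict_space (completion (lborel_power n)) A"
  obtain r' where r': "r < r'" "r' < R" using dense Suc.prems(2) by blast
  obtain K where K: "\<And>V (f :: ('a, real) fseries). V \<in> formal_series \<Longrightarrow> (\<And>p. tnorm p (V p) \<le> x p) \<Longrightarrow> f \<in> FS r' \<Longrightarrow>
       vf_act V f \<in> FS r \<and> fs_norm r (vf_act V f) \<le> ennreal K * fs_norm r' f"
    using vf_act_bounded[OF Suc.prems(1) r'(1) x sx[OF less_imp_le[OF Suc.prems(1)] Suc.prems(2)]] by blast
  have i: "Suc k \<in> {1..n}" using Suc.prems by auto
  have "fs_measurable ?M r (\<lambda>\<tau>. vf_act (V ((\<lambda>\<tau>. \<tau> (Suc k)) \<tau>)) (vf_iter V \<tau> k f))"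
  proof (rule fs_measurable_operator[where N = "lebesgue_on I" and r' = r' and K = K and A = "\<lambda>t. vf_act (V t)"
        and g = "\<lambda>\<tau>. vf_iter V \<tau> k f"])
    show "complete_measure ?M" by (rule complete_measure_restrict_completion[OF A])
    show "complete_measure (lebesgue_on I)" using I by (rule complete_measure_restrict_completion)
    show "(\<lambda>\<tau>. \<tau> (Suc k)) \<in> measurable ?M (lebesgue_on I)"
      by (rule coordinate_restrict(1)[OF i A _ I]) (use AI i in blast)
    show "AE \<tau> in ?M. P (\<tau> (Suc k))" if "AE t in lebesgue_on I. P t" for P
      by (rule coordinate_restrict(2)[OF i A _ I that]) (use AI i in blast)
    show "fs_measurable (lebesgue_on I) r (\<lambda>t. vf_act (V t) f)" if "f \<in> FS r'" for f :: "('a, real) fseries"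
      using FS_imp_FSd[OF that Suc.prems(1) r'(1)] Suc.prems by (intro meas)
    show "fs_measurable ?M r' (\<lambda>\<tau>. vf_iter V \<tau> k f)"
      using Suc.prems r' by (intro Suc.IH) auto
    fix t and f h :: "('a, real) fseries" assume t: "t \<in> space (lebesgue_on I)" and fh: "f \<in> FS r'" "h \<in> FS r'"
    have "fs_diff (vf_act (V t) f) (vf_act (V t) h) = vf_act (V t) (fs_diff f h)"
      unfolding fs_diff_lincomb using fh FS_formal_series by (intro vf_act_lincomb[symmetric]) blast+
    moreover have "fs_diff f h \<in> FS r'" using fh r' Suc.prems(1) by (intro fs_diff_FS) auto
    ultimately show "fs_norm r (fs_diff (vf_act (V t) f) (vf_act (V t) h)) \<le> ennreal K * fs_norm r' (fs_diff f h)"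
      using K[of "V t" "fs_diff f h"] V V_le t by simp
  qed (use Suc.prems in simp)
  then show ?case by simp
qed

definition iter_majorant :: "('a, real) fseries \<Rightarrow> nat \<Rightarrow> real \<Rightarrow> real" where
  "iter_majorant f k r = (\<Sum>p. (transport x ^^ k) (\<lambda>p. tnorm p (f p)) p * r ^ p)"

lemma iter_majorant_summable:
  assumes f: "f \<in> FS R" and r: "0 \<le> r" "r < R"
  shows "summable (\<lambda>p. (transport x ^^ k) (\<lambda>p. tnorm p (f p)) p * r ^ p)"
  using r
proof (induction k arbitrary: r)
  case 0
  then show ?case using FS_mono[of r R f] f FS_iff_summable[of r f] by simp
next
  case (Suc k)
  have F: "0 \<le> tnorm p (f p)" for p using tnorm_nonneg[OF formal_seriesD[OF FS_formal_series[OF f]]] .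
  show ?case
    using transport_summable(2)[OF funpow_transport_nonneg[OF x F] x Suc.IH sx Suc.prems] by simp
qed

lemma iter_majorant_nonneg:
  assumes f: "f \<in> FS R" and r: "0 \<le> r" "r < R"
  shows "0 \<le> iter_majorant f k r"
  unfolding iter_majorant_def
  using iter_majorant_summable[OF assms, of k] funpow_transport_nonneg[OF x tnorm_nonneg[OF formal_seriesD[OF FS_formal_series[OF f]]]] r
  by (intro suminf_nonneg) auto

lemma fs_norm_vf_iter_le:
  fixes f :: "('a, real) fseries"
  assumes f: "f \<in> FS R" and r: "0 \<le> r" "r < R" and \<tau>: "\<And>i. i \<in> {1..k} \<Longrightarrow> \<tau> i \<in> I"
  shows "fs_norm r (vf_iter V \<tau> k f) \<le> ennreal (iter_majorant f k r)"
proof -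
  have ff: "f \<in> formal_series" using FS_formal_series[OF f] .
  have F: "0 \<le> (transport x ^^ k) (\<lambda>p. tnorm p (f p)) p" for p
    by (rule funpow_transport_nonneg[OF x tnorm_nonneg[OF formal_seriesD[OF ff]]])
  have "fs_norm r (vf_iter V \<tau> k f) \<le> (\<Sum>p. ennreal ((transport x ^^ k) (\<lambda>p. tnorm p (f p)) p * r ^ p))"
    unfolding fs_norm_eq using tnorm_vf_iter_le[of k V \<tau> x f] V V_le \<tau> ff r
    by (intro suminf_le ennreal_leI mult_right_mono) auto
  also have "\<dots> = ennreal (iter_majorant f k r)"
    unfolding iter_majorant_def using F r iter_majorant_summable[OF f r]
    by (intro suminf_ennreal2) auto
  finally show ?thesis .
qed

text \<open>Stated for arbitrary regions of times, because differences of simplices occur in the Lipschitz estimate.\<close>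

lemma region_integral:
  fixes f :: "('a, real) fseries"
  assumes A: "A \<in> sets (lborel_power k)" and AI: "\<forall>\<tau>\<in>A. \<forall>i\<in>{1..k}. \<tau> i \<in> I"
    and v: "emeasure (lborel_power k) A = ennreal v" and f: "f \<in> FS R" and r: "0 < r" "r < R"
  defines "M \<equiv> restrict_space (completion (lborel_power k)) A"
  shows "has_fs_integral M r (\<lambda>\<tau>. vf_iter V \<tau> k f) (\<lambda>p \<phi>. \<integral>\<tau>. vf_iter V \<tau> k f p \<phi> \<partial>M)"
    and "integrable M (\<lambda>\<tau>. vf_iter V \<tau> k f p \<phi>)"
    and "fs_norm r (\<lambda>p \<phi>. \<integral>\<tau>. vf_iter V \<tau> k f p \<phi> \<partial>M) \<le> ennreal (v * iter_majorant f k r)"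
proof -
  have A': "A \<in> sets (completion (lborel_power k))" using A by (rule sets_completionI_sets)
  have sp: "space M = A" unfolding M_def using sets.sets_into_space[OF A] by (auto simp: space_restrict_space)
  have e: "emeasure M (space M) = ennreal v"
    unfolding sp unfolding M_def using A' v A
    by (subst emeasure_restrict_space) (auto simp: emeasure_completion)
  have m: "fs_measurable M r (\<lambda>\<tau>. vf_iter V \<tau> k f)"
    unfolding M_def by (rule vf_iter_measurable[OF A' AI f r order_refl])
  have B: "fs_norm r (vf_iter V \<tau> k f) \<le> ennreal (iter_majorant f k r)" if "\<tau> \<in> space M" for \<tau>
    using that AI r unfolding sp by (intro fs_norm_vf_iter_le[OF f]) auto
  have "complete_measure M" unfolding M_def by (rule complete_measure_restrict_completion[OF A'])
  note J = has_fs_integral_bounded[OF r(1) this _ m B]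
  show "has_fs_integral M r (\<lambda>\<tau>. vf_iter V \<tau> k f) (\<lambda>p \<phi>. \<integral>\<tau>. vf_iter V \<tau> k f p \<phi> \<partial>M)"
    and "integrable M (\<lambda>\<tau>. vf_iter V \<tau> k f p \<phi>)"
    using J(1,2) e by simp_all
  have "fs_norm r (\<lambda>p \<phi>. \<integral>\<tau>. vf_iter V \<tau> k f p \<phi> \<partial>M) \<le> ennreal (iter_majorant f k r) * ennreal v"
    using J(3) e by simp
  also have "\<dots> \<le> ennreal (v * iter_majorant f k r)"
  proof (cases "0 \<le> v")
    case True
    then show ?thesis using iter_majorant_nonneg[OF f] r by (simp add: ennreal_mult mult.commute)
  qed (simp add: ennreal_neg)
  finally show "fs_norm r (\<lambda>p \<phi>. \<integral>\<tau>. vf_iter V \<tau> k f p \<phi> \<partial>M) \<le> ennreal (v * iter_majorant f k r)" .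
qed

definition chron_term :: "('a, real) fseries \<Rightarrow> real \<Rightarrow> nat \<Rightarrow> real \<Rightarrow> ('a, real) fseries" where
  "chron_term f t1 k t = (\<lambda>p \<phi>. \<integral>\<tau>. vf_iter V \<tau> k f p \<phi> \<partial>simplex_measure k t1 t)"

lemma time_simplex_subset_I:
  assumes "closed_segment t1 t \<subseteq> I"
  shows "\<forall>\<tau>\<in>time_simplex k t1 t. \<forall>i\<in>{1..k}. \<tau> i \<in> I"
proof (intro ballI)
  fix \<tau> i assume "\<tau> \<in> time_simplex k t1 t" "i \<in> {1..k}"
  then have "\<tau> i \<in> open_segment t1 t" unfolding time_simplex_iff by blast
  then show "\<tau> i \<in> I" using assms segment_open_subset_closed by blast
qed

lemma chron_term:
  assumes t: "closed_segment t1 t \<subseteq> I" and f: "f \<in> FS R" and r: "0 < r" "r < R"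
  shows "has_fs_integral (simplex_measure k t1 t) r (\<lambda>\<tau>. vf_iter V \<tau> k f) (chron_term f t1 k t)"
    and "integrable (simplex_measure k t1 t) (\<lambda>\<tau>. vf_iter V \<tau> k f p \<phi>)"
    and "fs_norm r (chron_term f t1 k t) \<le> ennreal (\<bar>t - t1\<bar> ^ k / fact k * iter_majorant f k r)"
    and "chron_term f t1 k t \<in> FS r"
proof -
  note J = region_integral[OF time_simplex_sets time_simplex_subset_I[OF t] emeasure_time_simplex f r,
      folded simplex_measure_def]
  show "has_fs_integral (simplex_measure k t1 t) r (\<lambda>\<tau>. vf_iter V \<tau> k f) (chron_term f t1 k t)"
    and "integrable (simplex_measure k t1 t) (\<lambda>\<tau>. vf_iter V \<tau> k f p \<phi>)"
    and "fs_norm r (chron_term f t1 k t) \<le> ennreal (\<bar>t - t1\<bar> ^ k / fact k * iter_majorant f k r)"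
    unfolding chron_term_def using J by simp_all
  then show "chron_term f t1 k t \<in> FS r" unfolding has_fs_integral_def by blast
qed

text \<open>The simplices grow with the end time, so the difference is the integral over the set difference, whose volume is
the difference of the volumes.\<close>

lemma chron_term_diff:
  assumes t: "closed_segment t1 t \<subseteq> I" and s: "s \<in> closed_segment t1 t" and f: "f \<in> FS R" and r: "0 < r" "r < R"
  shows "fs_norm r (fs_diff (chron_term f t1 k t) (chron_term f t1 k s))
    \<le> ennreal ((\<bar>t - t1\<bar> ^ k - \<bar>s - t1\<bar> ^ k) / fact k * iter_majorant f k r)"
proof -
  let ?C = "completion (lborel_power k)" and ?St = "time_simplex k t1 t" and ?Ss = "time_simplex k t1 s"
  let ?A = "?St - ?Ss"
  have sub: "?Ss \<subseteq> ?St" by (rule time_simplex_mono[OF s])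
  have s': "closed_segment t1 s \<subseteq> I" using s t subset_closed_segment[of t1 s t1 t] by auto
  have A: "?A \<in> sets (lborel_power k)" by (intro sets.Diff time_simplex_sets)
  have S: "?St \<in> sets ?C" "?Ss \<in> sets ?C" "?A \<in> sets ?C"
    using A time_simplex_sets by (auto intro!: sets_completionI_sets)
  have v: "emeasure (lborel_power k) ?A = ennreal ((\<bar>t - t1\<bar> ^ k - \<bar>s - t1\<bar> ^ k) / fact k)"
  proof -
    have "emeasure (lborel_power k) ?A = emeasure (lborel_power k) ?St - emeasure (lborel_power k) ?Ss"
      by (rule emeasure_Diff[OF _ time_simplex_sets time_simplex_sets sub])
        (simp only: emeasure_time_simplex ennreal_neq_top infinity_ennreal_def not_False_eq_True)
    then show ?thesis unfolding emeasure_time_simplex by (simp add: ennreal_minus diff_divide_distrib)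
  qed
  have AI: "\<forall>\<tau>\<in>?A. \<forall>i\<in>{1..k}. \<tau> i \<in> I"
    using time_simplex_subset_I[OF t] by blast
  note J = region_integral[OF A AI v f r]
  have "fs_diff (chron_term f t1 k t) (chron_term f t1 k s) = (\<lambda>p \<phi>. \<integral>\<tau>. vf_iter V \<tau> k f p \<phi> \<partial>restrict_space ?C ?A)"
  proof (intro ext)
    fix p \<phi>
    define u where "u \<tau> = vf_iter V \<tau> k f p \<phi>" for \<tau>
    have it: "integrable ?C (\<lambda>\<tau>. indicator ?St \<tau> *\<^sub>R u \<tau>)"
      using chron_term(2)[OF t f r, of k p \<phi>] S(1) unfolding simplex_measure_def u_def
      by (subst (asm) integrable_restrict_space) auto
    have int_s: "integrable ?C (\<lambda>\<tau>. indicator ?Ss \<tau> *\<^sub>R u \<tau>)"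
      using chron_term(2)[OF s' f r, of k p \<phi>] S(2) unfolding simplex_measure_def u_def
      by (subst (asm) integrable_restrict_space) auto
    have restr: "(\<integral>\<tau>. u \<tau> \<partial>restrict_space ?C B) = (\<integral>\<tau>. indicator B \<tau> *\<^sub>R u \<tau> \<partial>?C)" if "B \<in> sets ?C" for B
      by (rule integral_restrict_space[OF sets.Int[OF that sets.top]])
    have "fs_diff (chron_term f t1 k t) (chron_term f t1 k s) p \<phi>
      = (\<integral>\<tau>. indicator ?St \<tau> *\<^sub>R u \<tau> \<partial>?C) - (\<integral>\<tau>. indicator ?Ss \<tau> *\<^sub>R u \<tau> \<partial>?C)"
      unfolding fs_diff_def chron_term_def simplex_measure_def u_def[symmetric] restr[OF S(1)] restr[OF S(2)] ..
    also have "\<dots> = (\<integral>\<tau>. indicator ?St \<tau> *\<^sub>R u \<tau> - indicator ?Ss \<tau> *\<^sub>R u \<tau> \<partial>?C)"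
      using it int_s by (rule Bochner_Integration.integral_diff[symmetric])
    also have "\<dots> = (\<integral>\<tau>. indicator ?A \<tau> *\<^sub>R u \<tau> \<partial>?C)"
      using sub by (intro Bochner_Integration.integral_cong) (auto simp: indicator_def)
    also have "\<dots> = (\<integral>\<tau>. vf_iter V \<tau> k f p \<phi> \<partial>restrict_space ?C ?A)"
      unfolding restr[OF S(3), symmetric] by (simp only: u_def[abs_def])
    finally show "fs_diff (chron_term f t1 k t) (chron_term f t1 k s) p \<phi>
      = (\<integral>\<tau>. vf_iter V \<tau> k f p \<phi> \<partial>restrict_space ?C ?A)" .
  qed
  then show ?thesis using J(3) by simp
qed

end

section \<open>Existence, norm bound and Lipschitz continuity\<close>

lemma power_diff_le:
  fixes a b :: real
  assumes "0 \<le> b" "b \<le> a"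
  shows "a ^ Suc j - b ^ Suc j \<le> real (Suc j) * (a - b) * a ^ j"
proof (induction j)
  case (Suc j)
  have "a ^ Suc (Suc j) - b ^ Suc (Suc j) = a * (a ^ Suc j - b ^ Suc j) + (a - b) * b ^ Suc j"
    by (simp add: algebra_simps)
  also have "\<dots> \<le> a * (real (Suc j) * (a - b) * a ^ j) + (a - b) * a ^ Suc j"
    using assms Suc.IH by (intro add_mono mult_left_mono power_mono) auto
  also have "\<dots> = real (Suc (Suc j)) * (a - b) * a ^ Suc j" by (simp add: algebra_simps)
  finally show ?case .
qed simp

text \<open>The situation \<open>\<rho> < R\<close>. The flow enters only through the exponential bound that it implies.\<close>

locale chronological_exponential = majorized_family V x I R
  for V :: "real \<Rightarrow> ('a::banach, 'a) fseries" and x I R +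
  fixes t1 t2 \<rho> :: real
  assumes segment: "closed_segment t1 t2 \<subseteq> I" and \<rho>: "0 < \<rho>" "\<rho> < R"
    and exp_bound: "\<And>F n. (\<And>p. 0 \<le> F p) \<Longrightarrow> summable (\<lambda>p. F p * R ^ p) \<Longrightarrow>
      (\<Sum>k<n. \<bar>t2 - t1\<bar> ^ k / fact k * (\<Sum>p. (transport x ^^ k) F p * \<rho> ^ p)) \<le> (\<Sum>p. F p * R ^ p)"
begin

lemma subsegment:
  assumes "t \<in> closed_segment t1 t2"
  shows "closed_segment t1 t \<subseteq> I" "\<bar>t - t1\<bar> \<le> \<bar>t2 - t1\<bar>"
proof -
  have "closed_segment t1 t \<subseteq> closed_segment t1 t2"
    using assms by (simp add: subset_closed_segment)
  then show "closed_segment t1 t \<subseteq> I" using segment by blast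
  show "\<bar>t - t1\<bar> \<le> \<bar>t2 - t1\<bar>"
    using assms by (auto simp: closed_segment_eq_real_ivl split: if_splits)
qed

text \<open>Partial sums of nonnegative terms suffice in \<open>exp_bound\<close>: they yield summability together with the bound.\<close>

lemma summable_majorants:
  assumes c: "\<And>k. 0 \<le> c k" and le: "\<And>k. c k \<le> \<bar>t2 - t1\<bar> ^ k / fact k * (\<Sum>p. (transport x ^^ k) F p * \<rho> ^ p)"
    and F: "\<And>p. 0 \<le> F p" "summable (\<lambda>p. F p * R ^ p)"
  shows "summable c" "suminf c \<le> (\<Sum>p. F p * R ^ p)"
proof -
  have b: "(\<Sum>k<n. c k) \<le> (\<Sum>p. F p * R ^ p)" for n
    using sum_mono[of "{..<n}" c, OF le] exp_bound[OF F, of n] by (rule order_trans)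
  show "summable c" using c b by (rule summableI_nonneg_bounded)
  then show "suminf c \<le> (\<Sum>p. F p * R ^ p)" using b by (intro suminf_le_const)
qed

definition chron_exp :: "('a, real) fseries \<Rightarrow> real \<Rightarrow> ('a, real) fseries" where
  "chron_exp f t = (\<lambda>p \<phi>. \<Sum>k. chron_sign t1 t k *\<^sub>R chron_term f t1 k t p \<phi>)"

lemma chron_exp:
  assumes t: "t \<in> closed_segment t1 t2" and f: "f \<in> FS R"
  shows "has_Texp \<rho> V t1 t f (chron_exp f t)"
    and "fs_norm \<rho> (chron_exp f t) \<le> fs_norm R f"
    and "summable (\<lambda>k. chron_sign t1 t k *\<^sub>R chron_term f t1 k t p \<phi>)"
proof -
  define c where "c k = \<bar>t - t1\<bar> ^ k / fact k * iter_majorant f k \<rho>" for k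
  have R: "0 \<le> R" using \<rho> by simp
  have F: "0 \<le> tnorm p (f p)" "summable (\<lambda>p. tnorm p (f p) * R ^ p)" for p
    using f FS_iff_summable[OF R] tnorm_nonneg[OF formal_seriesD[OF FS_formal_series[OF f]]] by auto
  note T = chron_term[OF subsegment(1)[OF t] f \<rho>]
  have c0: "0 \<le> c k" for k
    unfolding c_def using iter_majorant_nonneg[OF f] \<rho> by (intro mult_nonneg_nonneg) auto
  have cle: "c k \<le> \<bar>t2 - t1\<bar> ^ k / fact k * (\<Sum>p. (transport x ^^ k) (\<lambda>p. tnorm p (f p)) p * \<rho> ^ p)" for k
    unfolding c_def iter_majorant_def[symmetric] using iter_majorant_nonneg[OF f] \<rho> subsegment(2)[OF t]
    by (intro mult_right_mono divide_right_mono power_mono) auto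
  note c = summable_majorants[OF c0 cle F]
  have h: "(\<lambda>p \<phi>. chron_sign t1 t k *\<^sub>R chron_term f t1 k t p \<phi>) \<in> formal_series" for k
    by (intro fs_scale_formal_series FS_formal_series[OF T(4)])
  have hc: "fs_norm \<rho> (\<lambda>p \<phi>. chron_sign t1 t k *\<^sub>R chron_term f t1 k t p \<phi>) \<le> ennreal (c k)" for k
    using order_trans[OF fs_norm_scale_le[OF FS_formal_series[OF T(4)[of k]], of \<rho> "chron_sign t1 t k"]] T(3)[of k] \<rho>
    unfolding c_def by simp
  note S = fs_series[OF \<rho>(1) h hc c0 c(1)]
  show "has_Texp \<rho> V t1 t f (chron_exp f t)"
    unfolding has_Texp_def
  proof (intro conjI exI[of _ "\<lambda>k. chron_term f t1 k t"] allI)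
    show "chron_exp f t \<in> FS \<rho>" unfolding chron_exp_def by (rule S(1))
    show "has_fs_integral (simplex_measure k t1 t) \<rho> (\<lambda>\<tau>. vf_iter V \<tau> k f) (chron_term f t1 k t)" for k
      by (rule T(1))
    show "(\<lambda>n. fs_norm \<rho> (fs_diff (chron_exp f t) (\<lambda>p \<phi>. \<Sum>k<n. (if t1 \<le> t then 1 else (- 1) ^ k) *\<^sub>R chron_term f t1 k t p \<phi>))) \<longlonglongrightarrow> 0"
      using S(4) unfolding chron_exp_def chron_sign_def .
  qed
  have "fs_norm \<rho> (chron_exp f t) \<le> ennreal (suminf c)" unfolding chron_exp_def by (rule S(2))
  also have "\<dots> \<le> ennreal (\<Sum>p. tnorm p (f p) * R ^ p)" by (intro ennreal_leI c(2))
  also have "\<dots> = fs_norm R f" using fs_norm_FS[OF R f] by simp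
  finally show "fs_norm \<rho> (chron_exp f t) \<le> fs_norm R f" .
  show "summable (\<lambda>k. chron_sign t1 t k *\<^sub>R chron_term f t1 k t p \<phi>)" by (rule S(3))
qed

text \<open>For \<open>t2 < t1\<close> the alternating sign is lost at the end time \<open>t = t1\<close>, but there all terms with
\<open>k > 0\<close> vanish. The sign may therefore be taken to be constant along the segment.\<close>

lemma chron_sign_chron_term:
  assumes t: "t \<in> closed_segment t1 t2" and f: "f \<in> FS R"
  shows "chron_sign t1 t k *\<^sub>R chron_term f t1 k t p \<phi> = chron_sign t1 t2 k *\<^sub>R chron_term f t1 k t p \<phi>"
proof (cases "t = t1 \<and> k \<noteq> 0")
  case True
  note T = chron_term[OF subsegment(1)[OF t] f \<rho>, of k]
  have "fs_norm \<rho> (chron_term f t1 k t) = 0" using T(3) True by (simp add: power_0_left)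
  then have "chron_term f t1 k t = (\<lambda>p \<phi>. 0)"
    using fs_norm_eq_0_iff[OF FS_formal_series[OF T(4)] \<rho>(1)] by simp
  then show ?thesis by simp
next
  case False
  have "chron_sign t1 t k = chron_sign t1 t2 k"
  proof (cases "k = 0")
    case nz: False
    then have "t \<noteq> t1" using False by blast
    then show ?thesis using t unfolding chron_sign_def
      by (auto simp: closed_segment_eq_real_ivl split: if_splits)
  qed (simp add: chron_sign_def)
  then show ?thesis by simp
qed

text \<open>The \<open>k\<close>-th terms at \<open>t\<close> and \<open>s\<close> differ by at most \<open>(a\<^sup>k - b\<^sup>k) / k! * (A\<^sup>k F)(\<rho>)\<close>
with \<open>a = \<bar>t - t1\<bar>\<close>, \<open>b = \<bar>s - t1\<bar>\<close> and \<open>A\<close> for \<open>transport x\<close>. This is at most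
\<open>(a - b) * a\<^sup>j / j! * (A\<^sup>j (A F))(\<rho>)\<close> for \<open>k = j + 1\<close>, and the exponential bound for \<open>A F\<close> sums these terms. The
larger radius \<open>Rb\<close> ensures that \<open>A F\<close> converges at \<open>R\<close>.\<close>

lemma chron_exp_lipschitz:
  assumes Rb: "R < Rb" and sxb: "\<And>r. 0 \<le> r \<Longrightarrow> r < Rb \<Longrightarrow> summable (\<lambda>p. x p * r ^ p)"
    and f: "f \<in> FS Rb" and t: "t \<in> closed_segment t1 t2" and s: "s \<in> closed_segment t1 t"
  defines "L \<equiv> (\<Sum>p. transport x (\<lambda>p. tnorm p (f p)) p * R ^ p)"
  shows "fs_norm \<rho> (fs_diff (chron_exp f t) (chron_exp f s)) \<le> ennreal (L * \<bar>t - s\<bar>)" and "0 \<le> L"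
proof -
  have R: "0 \<le> R" using \<rho> by simp
  have fR: "f \<in> FS R" using FS_mono[of R Rb f] R Rb f by simp
  have s2: "s \<in> closed_segment t1 t2"
    using s t subset_closed_segment[of t1 t t1 t2] by auto
  define F where "F = (\<lambda>p. tnorm p (f p))"
  define G where "G = transport x F"
  have F: "0 \<le> F p" for p
    unfolding F_def using tnorm_nonneg[OF formal_seriesD[OF FS_formal_series[OF fR]]] .
  have sF: "summable (\<lambda>p. F p * r ^ p)" if "0 \<le> r" "r < Rb" for r
    using FS_mono[of r Rb f] FS_iff_summable[of r f] f that unfolding F_def by auto
  have G: "0 \<le> G p" "summable (\<lambda>p. G p * R ^ p)" for p
    unfolding G_def using transport_nonneg[OF F x] transport_summable(2)[OF F x sF sxb R Rb] by auto
  have L: "L = (\<Sum>p. G p * R ^ p)" unfolding L_def G_def F_def ..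
  show "0 \<le> L" unfolding L using G R by (intro suminf_nonneg) auto
  define a where "a = \<bar>t - t1\<bar>"
  define b where "b = \<bar>s - t1\<bar>"
  have ab: "0 \<le> b" "b \<le> a" "a - b = \<bar>t - s\<bar>" "a \<le> \<bar>t2 - t1\<bar>"
    using s subsegment(2)[OF t] unfolding a_def b_def
    by (auto simp: closed_segment_eq_real_ivl split: if_splits)
  define e where "e j = \<bar>t2 - t1\<bar> ^ j / fact j * (\<Sum>p. (transport x ^^ j) G p * \<rho> ^ p)" for j
  have N: "(\<Sum>p. (transport x ^^ j) G p * \<rho> ^ p) = iter_majorant f (Suc j) \<rho>" for j
    unfolding iter_majorant_def G_def F_def by (simp only: funpow_Suc_right o_apply)
  have Nn: "0 \<le> iter_majorant f k \<rho>" for k using iter_majorant_nonneg[OF fR] \<rho> by simp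
  have e0: "0 \<le> e j" for j unfolding e_def N using Nn by (intro mult_nonneg_nonneg) auto
  have e: "summable e" "suminf e \<le> L"
    using summable_majorants[OF e0 _ G] unfolding e_def L by auto
  \<comment> \<open>\<open>c (Suc j)\<close> majorizes the difference of the terms of order \<open>Suc j\<close>; those of order \<open>0\<close> agree\<close>
  define c where "c k = (case k of 0 \<Rightarrow> 0 | Suc j \<Rightarrow> \<bar>t - s\<bar> * e j)" for k
  have c0: "0 \<le> c k" for k unfolding c_def using e0 by (auto split: nat.split)
  have sc: "summable c"
    using summable_mult[OF e(1), of "\<bar>t - s\<bar>"] by (subst summable_Suc_iff[symmetric]) (simp add: c_def)
  have cL: "suminf c \<le> L * \<bar>t - s\<bar>"
  proof -
    have "suminf c = (\<Sum>j. \<bar>t - s\<bar> * e j)"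
      using suminf_split_head[OF sc] by (simp add: c_def)
    also have "\<dots> = \<bar>t - s\<bar> * suminf e" using e(1) by (rule suminf_mult)
    also have "\<dots> \<le> \<bar>t - s\<bar> * L" using e(2) by (intro mult_left_mono) auto
    finally show ?thesis by (simp add: mult.commute)
  qed
  define d where "d k = fs_diff (chron_term f t1 k t) (chron_term f t1 k s)" for k
  note Tt = chron_term[OF subsegment(1)[OF t] fR \<rho>] and Ts = chron_term[OF subsegment(1)[OF s2] fR \<rho>]
  have dF: "d k \<in> formal_series" for k
    unfolding d_def by (intro fs_diff_formal_series FS_formal_series[OF Tt(4)] FS_formal_series[OF Ts(4)])
  have dc: "fs_norm \<rho> (d k) \<le> ennreal (c k)" for k
  proof -
    have "fs_norm \<rho> (d k) \<le> ennreal ((a ^ k - b ^ k) / fact k * iter_majorant f k \<rho>)"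
      unfolding d_def a_def b_def by (rule chron_term_diff[OF subsegment(1)[OF t] s fR \<rho>])
    also have "(a ^ k - b ^ k) / fact k * iter_majorant f k \<rho> \<le> c k"
    proof (cases k)
      case (Suc j)
      have "(a ^ k - b ^ k) / fact k \<le> real (Suc j) * (a - b) * a ^ j / fact k"
        unfolding Suc using ab by (intro divide_right_mono power_diff_le) auto
      also have "\<dots> = (a - b) * (a ^ j / fact j)" by (simp add: Suc field_simps del: of_nat_Suc)
      also have "\<dots> \<le> \<bar>t - s\<bar> * (\<bar>t2 - t1\<bar> ^ j / fact j)"
        unfolding ab(3) using ab by (intro mult_left_mono divide_right_mono power_mono) auto
      finally have "(a ^ k - b ^ k) / fact k * iter_majorant f k \<rho> \<le> \<bar>t - s\<bar> * (\<bar>t2 - t1\<bar> ^ j / fact j) * iter_majorant f k \<rho>"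
        using Nn by (intro mult_right_mono)
      then show ?thesis by (simp add: c_def e_def N Suc mult.assoc)
    qed (simp add: c_def)
    finally show ?thesis by (simp add: ennreal_leI)
  qed
  define h where "h k = (\<lambda>p \<phi>. chron_sign t1 t2 k *\<^sub>R d k p \<phi>)" for k
  have hF: "h k \<in> formal_series" for k unfolding h_def by (intro fs_scale_formal_series dF)
  have hc: "fs_norm \<rho> (h k) \<le> ennreal (c k)" for k
    using order_trans[OF fs_norm_scale_le[OF dF[of k], of \<rho> "chron_sign t1 t2 k"]] dc[of k] \<rho> unfolding h_def by simp
  have "fs_diff (chron_exp f t) (chron_exp f s) = (\<lambda>p \<phi>. \<Sum>k. h k p \<phi>)"
  proof (intro ext)
    fix p \<phi>
    note st = chron_exp(3)[OF t fR, of p \<phi>, unfolded chron_sign_chron_term[OF t fR]]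
      and ss = chron_exp(3)[OF s2 fR, of p \<phi>, unfolded chron_sign_chron_term[OF s2 fR]]
    show "fs_diff (chron_exp f t) (chron_exp f s) p \<phi> = (\<Sum>k. h k p \<phi>)"
      unfolding fs_diff_def chron_exp_def chron_sign_chron_term[OF t fR] chron_sign_chron_term[OF s2 fR]
        suminf_diff[OF st ss] h_def d_def by (simp only: scaleR_diff_right)
  qed
  then have "fs_norm \<rho> (fs_diff (chron_exp f t) (chron_exp f s)) \<le> ennreal (suminf c)"
    using fs_series(2)[OF \<rho>(1) hF hc c0 sc] by simp
  also have "\<dots> \<le> ennreal (L * \<bar>t - s\<bar>)" using cL by (rule ennreal_leI)
  finally show "fs_norm \<rho> (fs_diff (chron_exp f t) (chron_exp f s)) \<le> ennreal (L * \<bar>t - s\<bar>)" .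
qed

lemma chron_exp_lipschitz_on_segment:
  assumes Rb: "R < Rb" and sxb: "\<And>r. 0 \<le> r \<Longrightarrow> r < Rb \<Longrightarrow> summable (\<lambda>p. x p * r ^ p)"
    and f: "f \<in> FS Rb"
  shows "\<exists>L\<ge>0. \<forall>t\<in>closed_segment t1 t2. \<forall>s\<in>closed_segment t1 t2.
    fs_norm \<rho> (fs_diff (chron_exp f t) (chron_exp f s)) \<le> ennreal (L * \<bar>t - s\<bar>)"
proof -
  define L where "L = (\<Sum>p. transport x (\<lambda>p. tnorm p (f p)) p * R ^ p)"
  have lip: "fs_norm \<rho> (fs_diff (chron_exp f t) (chron_exp f s)) \<le> ennreal (L * \<bar>t - s\<bar>)" "0 \<le> L"
    if "t \<in> closed_segment t1 t2" "s \<in> closed_segment t1 t" for t s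
    unfolding L_def by (rule chron_exp_lipschitz[OF Rb _ f that], erule (1) sxb)+
  have fR: "f \<in> FS R" using FS_mono[of R Rb f] \<rho> Rb f by simp
  have fs: "chron_exp f t \<in> formal_series" if "t \<in> closed_segment t1 t2" for t
    using chron_exp(1)[OF that fR] FS_formal_series unfolding has_Texp_def by blast
  show ?thesis
  proof (intro exI[of _ L] conjI ballI)
    show "0 \<le> L" using lip(2)[of t1 t1] by simp
    fix t s assume ts: "t \<in> closed_segment t1 t2" "s \<in> closed_segment t1 t2"
    then consider "s \<in> closed_segment t1 t" | "t \<in> closed_segment t1 s"
      by (fastforce simp: closed_segment_eq_real_ivl split: if_splits)
    then show "fs_norm \<rho> (fs_diff (chron_exp f t) (chron_exp f s)) \<le> ennreal (L * \<bar>t - s\<bar>)"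
    proof cases
      case 1
      then show ?thesis using lip(1) ts by blast
    next
      case 2
      then show ?thesis
        using lip(1)[OF ts(2) 2] fs_norm_diff_commute[OF fs[OF ts(1)] fs[OF ts(2)], of \<rho>] \<rho>
        by (simp add: abs_minus_commute)
    qed
  qed
qed

end

text \<open>This covers a trivial time interval, where the higher simplices are empty, and a vanishing majorant, where the
vector fields are zero.\<close>

lemma has_Texp_if_iterates_vanish:
  fixes f :: "('a::real_normed_vector, real) fseries"
  assumes r: "0 < r" and f: "f \<in> FS r"
    and zero: "\<And>k \<tau>. k \<noteq> 0 \<Longrightarrow> \<tau> \<in> time_simplex k t1 t2 \<Longrightarrow> vf_iter V \<tau> k f = (\<lambda>p \<phi>. 0)"
  shows "has_Texp r V t1 t2 f f"
  unfolding has_Texp_def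
proof (intro conjI f exI[of _ "\<lambda>k. if k = 0 then f else (\<lambda>p \<phi>. 0)"] allI)
  have em: "emeasure (simplex_measure k t1 t2) (space (simplex_measure k t1 t2)) = ennreal (\<bar>t2 - t1\<bar> ^ k / fact k)" for k
    unfolding space_simplex_measure unfolding simplex_measure_def
    using time_simplex_sets[of k t1 t2] emeasure_time_simplex[of k t1 t2]
    by (subst emeasure_restrict_space) (auto simp: emeasure_completion)
  show "has_fs_integral (simplex_measure k t1 t2) r (\<lambda>\<tau>. vf_iter V \<tau> k f) (if k = 0 then f else (\<lambda>p \<phi>. 0))" for k
  proof (cases "k = 0")
    case True
    obtain B where B: "fs_norm r f = ennreal B" using FS_fs_norm[OF f] by (cases "fs_norm r f") auto
    have "has_fs_integral (simplex_measure 0 t1 t2) r (\<lambda>\<tau>. f) (\<lambda>p \<phi>. \<integral>\<tau>. f p \<phi> \<partial>simplex_measure 0 t1 t2)"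
      using has_fs_integral_bounded(1)[OF r complete_simplex_measure _ fs_measurable_const[OF f], of 0 t1 t2 B] B em[of 0] by simp
    moreover have "measure (simplex_measure 0 t1 t2) (space (simplex_measure 0 t1 t2)) = 1"
      using em[of 0] by (simp add: measure_def)
    ultimately show ?thesis using True by simp
  next
    case False
    let ?M = "simplex_measure k t1 t2"
    have z: "vf_iter V \<tau> k f = (\<lambda>p \<phi>. 0)" if "\<tau> \<in> space ?M" for \<tau>
      using zero[OF False] that unfolding space_simplex_measure .
    have "fs_measurable ?M r (\<lambda>\<tau>. vf_iter V \<tau> k f)"
      unfolding fs_measurable_def
    proof (intro conjI exI[of _ "\<lambda>i \<tau>. (\<lambda>p \<phi>. 0)"] allI)
      show "(\<lambda>\<tau>. vf_iter V \<tau> k f) \<in> space ?M \<rightarrow> FS r" using z zero_FS by auto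
      show "(\<lambda>\<tau>. (\<lambda>p \<phi>. 0)) \<in> space ?M \<rightarrow> FS r" using zero_FS by auto
      show "AE \<tau> in ?M. (\<lambda>i. fs_norm r (fs_diff (vf_iter V \<tau> k f) (\<lambda>p \<phi>. 0))) \<longlonglongrightarrow> 0"
        using z by (intro AE_I2) (simp add: fs_diff_def fs_norm_zero)
    qed simp
    from has_fs_integral_bounded(1)[OF r complete_simplex_measure _ this, of 0]
    have "has_fs_integral ?M r (\<lambda>\<tau>. vf_iter V \<tau> k f) (\<lambda>p \<phi>. \<integral>\<tau>. vf_iter V \<tau> k f p \<phi> \<partial>?M)"
      using z em[of k] by (simp add: fs_norm_zero)
    moreover have "(\<integral>\<tau>. vf_iter V \<tau> k f p \<phi> \<partial>?M) = (\<integral>\<tau>. 0 \<partial>?M)" for p \<phi>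
      using z by (intro Bochner_Integration.integral_cong) auto
    ultimately show ?thesis using False by simp
  qed
  have "(\<Sum>k<n. (if t1 \<le> t2 then 1 else (- 1) ^ k) *\<^sub>R (if k = 0 then f else (\<lambda>p \<phi>. 0)) p \<phi>) = f p \<phi>"
    if "n \<ge> 1" for n p \<phi>
  proof -
    obtain m where "n = Suc m" using \<open>n \<ge> 1\<close> by (cases n) auto
    then show ?thesis by (simp add: sum.lessThan_Suc_shift del: sum.lessThan_Suc)
  qed
  then have "\<forall>\<^sub>F n in sequentially. 0 = fs_norm r (fs_diff f (\<lambda>p \<phi>. \<Sum>k<n. (if t1 \<le> t2 then 1 else (- 1) ^ k) *\<^sub>R (if k = 0 then f else (\<lambda>p \<phi>. 0)) p \<phi>))"
    unfolding eventually_sequentially by (intro exI[of _ 1]) (simp add: fs_diff_def fs_norm_zero)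
  then show "(\<lambda>n. fs_norm r (fs_diff f (\<lambda>p \<phi>. \<Sum>k<n. (if t1 \<le> t2 then 1 else (- 1) ^ k) *\<^sub>R (if k = 0 then f else (\<lambda>p \<phi>. 0)) p \<phi>))) \<longlonglongrightarrow> 0"
    by (rule Lim_transform_eventually[OF tendsto_const])
qed

lemma has_Texp_lincomb:
  fixes f g :: "('a::real_normed_vector, real) fseries"
  assumes r: "0 < r" and V: "\<And>t. t \<in> closed_segment t1 t2 \<Longrightarrow> V t \<in> formal_series"
    and f: "f \<in> formal_series" "has_Texp r V t1 t2 f f'" and g: "g \<in> formal_series" "has_Texp r V t1 t2 g g'"
    and u: "has_Texp r V t1 t2 (fs_lincomb a f b g) u"
  shows "u = fs_lincomb a f' b g'"
proof (intro ext)
  fix p \<phi>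
  obtain hf where hf: "\<And>k p \<phi>. has_bochner_integral (simplex_measure k t1 t2) (\<lambda>\<tau>. vf_iter V \<tau> k f p \<phi>) (hf k p \<phi>)"
    "\<And>p \<phi>. (\<lambda>k. chron_sign t1 t2 k * hf k p \<phi>) sums f' p \<phi>"
    using has_Texp_eval[OF r f(2)] by blast
  obtain hg where hg: "\<And>k p \<phi>. has_bochner_integral (simplex_measure k t1 t2) (\<lambda>\<tau>. vf_iter V \<tau> k g p \<phi>) (hg k p \<phi>)"
    "\<And>p \<phi>. (\<lambda>k. chron_sign t1 t2 k * hg k p \<phi>) sums g' p \<phi>"
    using has_Texp_eval[OF r g(2)] by blast
  obtain hu where hu: "\<And>k p \<phi>. has_bochner_integral (simplex_measure k t1 t2) (\<lambda>\<tau>. vf_iter V \<tau> k (fs_lincomb a f b g) p \<phi>) (hu k p \<phi>)"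
    "\<And>p \<phi>. (\<lambda>k. chron_sign t1 t2 k * hu k p \<phi>) sums u p \<phi>"
    using has_Texp_eval[OF r u] by blast
  have "hu k p \<phi> = a * hf k p \<phi> + b * hg k p \<phi>" for k
  proof (rule has_bochner_integral_eq[OF hu(1)])
    have "vf_iter V \<tau> k (fs_lincomb a f b g) p \<phi> = a * vf_iter V \<tau> k f p \<phi> + b * vf_iter V \<tau> k g p \<phi>"
      if "\<tau> \<in> space (simplex_measure k t1 t2)" for \<tau>
    proof -
      have "V (\<tau> i) \<in> formal_series" if "i \<in> {1..k}" for i
        using \<open>\<tau> \<in> space _\<close> that V segment_open_subset_closed unfolding space_simplex_measure time_simplex_iff by blast
      then have "vf_iter V \<tau> k (fs_lincomb a f b g) = fs_lincomb a (vf_iter V \<tau> k f) b (vf_iter V \<tau> k g)"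
        by (intro vf_iter_lincomb f(1) g(1))
      then show ?thesis by (simp add: fs_lincomb_def)
    qed
    then show "has_bochner_integral (simplex_measure k t1 t2) (\<lambda>\<tau>. vf_iter V \<tau> k (fs_lincomb a f b g) p \<phi>) (a * hf k p \<phi> + b * hg k p \<phi>)"
      using has_bochner_integral_add[OF has_bochner_integral_mult_right[OF hf(1)[of k p \<phi>], of a] has_bochner_integral_mult_right[OF hg(1)[of k p \<phi>], of b]]
      by (simp cong: has_bochner_integral_cong)
  qed
  moreover have "(\<lambda>k. a * (chron_sign t1 t2 k * hf k p \<phi>) + b * (chron_sign t1 t2 k * hg k p \<phi>)) sums (a * f' p \<phi> + b * g' p \<phi>)"
    by (intro sums_add sums_mult hf(2) hg(2))
  ultimately have "(\<lambda>k. chron_sign t1 t2 k * hu k p \<phi>) sums (a * f' p \<phi> + b * g' p \<phi>)"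
    by (simp add: algebra_simps)
  then show "u p \<phi> = fs_lincomb a f' b g' p \<phi>"
    using sums_unique2[OF hu(2)] by (simp add: fs_lincomb_def)
qed

section \<open>From the majorant flow to the chronological exponential\<close>

lemma FS_ext_formal_series: "f \<in> FS_ext r \<Longrightarrow> f \<in> formal_series"
  unfolding FS_ext_def FS_def by (auto split: if_splits dest: bspec[of _ _ "1::real"])

lemma FS_ext_FS:
  assumes "f \<in> FS_ext r0" "0 \<le> r" "ereal r < r0"
  shows "f \<in> FS r"
proof (cases "r0 = \<infinity>")
  case True
  then have "f \<in> FS (r + 1)" using assms unfolding FS_ext_def by auto
  then show ?thesis using assms(2) by (intro FS_mono[of r "r + 1"]) auto
next
  case False
  then obtain s where s: "r0 = ereal s" using assms(3) by (cases r0) auto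
  then have "f \<in> FS s" using assms(1) False unfolding FS_ext_def by simp
  then show ?thesis using assms(2,3) s by (intro FS_mono[of r s]) auto
qed

text \<open>Evaluating \<open>z \<mapsto> x p * z ^ p\<close> at \<open>1\<close> shows that its norm is at least \<open>\<bar>x p\<bar>\<close>.\<close>

lemma summable_majorant_coefficients:
  fixes x :: "nat \<Rightarrow> real"
  assumes X: "(\<lambda>p z. x p * z ^ p) \<in> FS_ext r0" and r: "0 \<le> r" "ereal r < r0"
  shows "summable (\<lambda>p. \<bar>x p\<bar> * r ^ p)"
proof -
  let ?X = "\<lambda>p z. x p * z ^ p :: real"
  have X': "?X \<in> formal_series" "summable (\<lambda>p. tnorm p (?X p) * r ^ p)"
    using FS_ext_FS[OF X r] FS_iff_summable[OF r(1), of ?X] by auto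
  have "\<bar>x p\<bar> \<le> tnorm p (?X p)" for p
    using norm_homog_poly_le[OF formal_seriesD[OF X'(1)], of p 1] by simp
  then show ?thesis
    using r(1) by (intro summable_comparison_test'[OF X'(2)]) (simp add: mult_right_mono)
qed

text \<open>The flow starts at \<open>R\<close> and decreases to \<open>\<rho>\<close>; the exponential bound uses the reversed trajectory \<open>u\<close>.\<close>

lemma flows_to_majorant:
  fixes x :: "nat \<Rightarrow> real"
  assumes x: "\<And>p. 0 \<le> x p" and sx: "\<forall>r\<ge>0. ereal r < r0 \<longrightarrow> summable (\<lambda>p. x p * r ^ p)"
    and flow: "flows_to (\<lambda>z. - fs_eval (\<lambda>p z. x p * z ^ p) z) {z. ereal \<bar>z\<bar> < r0} T R \<rho>"
    and T: "0 \<le> T" and \<rho>: "0 < \<rho>"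
  shows "\<rho> \<le> R"
    and "0 < T \<Longrightarrow> x l \<noteq> 0 \<Longrightarrow> \<rho> < R"
    and "0 < T \<Longrightarrow> x l \<noteq> 0 \<Longrightarrow> (\<And>p. 0 \<le> F p) \<Longrightarrow> summable (\<lambda>p. F p * R ^ p) \<Longrightarrow>
      (\<Sum>k<n. T ^ k / fact k * (\<Sum>p. (transport x ^^ k) F p * \<rho> ^ p)) \<le> (\<Sum>p. F p * R ^ p)"
proof -
  have seg: "closed_segment 0 T = {0..T}" using T by (simp add: closed_segment_eq_real_ivl)
  obtain \<gamma> where \<gamma>0: "\<gamma> 0 = R" and \<gamma>T: "\<gamma> T = \<rho>"
    and \<gamma>D: "\<And>s. s \<in> {0..T} \<Longrightarrow> ereal \<bar>\<gamma> s\<bar> < r0"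
    and \<gamma>': "\<And>s. s \<in> {0..T} \<Longrightarrow> (\<gamma> has_real_derivative - (\<Sum>p. x p * \<gamma> s ^ p)) (at s within {0..T})"
    using flow unfolding flows_to_def fs_eval_def seg by auto
  have s\<gamma>: "summable (\<lambda>p. x p * \<bar>\<gamma> s\<bar> ^ p)" if "s \<in> {0..T}" for s
    using sx \<gamma>D[OF that] by simp
  have "0 < \<gamma> T" using \<gamma>T \<rho> by simp
  note mf = majorant_flow[OF x T s\<gamma> \<gamma>' this]
  show "\<rho> \<le> R" using mf(2)[of 0 T] \<gamma>0 \<gamma>T T by simp
  show "\<rho> < R" if "0 < T" "x l \<noteq> 0" using mf(3)[of 0 T l] \<gamma>0 \<gamma>T that by simp
  assume T0: "0 < T" and l: "x l \<noteq> 0" and F: "\<And>p. 0 \<le> F p" "summable (\<lambda>p. F p * R ^ p)"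
  define u where "u s = \<gamma> (T - s)" for s
  have u0: "u 0 = \<rho>" by (simp add: u_def \<gamma>T)
  have R: "ereal R < r0" using \<gamma>D[of 0] T \<gamma>0 mf(1)[of 0] by simp
  have "(\<Sum>k<n. T ^ k / fact k * (\<Sum>p. (transport x ^^ k) F p * u 0 ^ p)) \<le> (\<Sum>p. F p * R ^ p)"
  proof (rule transport_exponential_bound[OF x _ _ _ F T0])
    show "summable (\<lambda>p. x p * r ^ p)" if "0 \<le> r" "r < R" for r
      using sx that R by (meson ereal_less_eq(3) less_imp_le order_le_less_trans)
    show "0 \<le> u s \<and> u s < R" if "0 \<le> s" "s < T" for s
      using mf(1)[of "T - s"] mf(3)[of 0 "T - s" l] l that \<gamma>0 by (simp add: u_def)
    show "(u has_real_derivative (\<Sum>p. x p * u s ^ p)) (at s within {0..T})" if "0 \<le> s" "s < T" for s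
    proof -
      have img: "(\<lambda>s. T - s) ` {0..T} = {0..T}" by (auto simp: image_iff intro!: bexI[of _ "T - _"])
      have "((\<lambda>s. T - s) has_real_derivative - 1) (at s within {0..T})"
        by (auto intro!: derivative_eq_intros)
      moreover have "(\<gamma> has_real_derivative - (\<Sum>p. x p * \<gamma> (T - s) ^ p)) (at (T - s) within (\<lambda>s. T - s) ` {0..T})"
        unfolding img using that by (intro \<gamma>') auto
      ultimately have "(\<gamma> \<circ> (\<lambda>s. T - s) has_real_derivative - (\<Sum>p. x p * \<gamma> (T - s) ^ p) * - 1) (at s within {0..T})"
        by (rule DERIV_image_chain[rotated])
      then show ?thesis by (simp add: u_def[abs_def] o_def)
    qed
  qed
  then show "(\<Sum>k<n. T ^ k / fact k * (\<Sum>p. (transport x ^^ k) F p * \<rho> ^ p)) \<le> (\<Sum>p. F p * R ^ p)"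
    unfolding u0 .
qed

text \<open>All claims about \<^const>\<open>Texp\<close> follow from any construction \<open>U\<close> of the chronological exponential
with the norm and Lipschitz bounds, since the exponential is unique.\<close>

lemma Texp_properties:
  fixes U :: "real \<Rightarrow> ('a::banach, real) fseries \<Rightarrow> ('a, real) fseries"
  assumes \<rho>: "0 < \<rho>" "\<rho> \<le> R" and V: "\<And>t. t \<in> closed_segment t1 t2 \<Longrightarrow> V t \<in> formal_series"
    and U: "\<And>t f. t \<in> closed_segment t1 t2 \<Longrightarrow> f \<in> FS R \<Longrightarrow>
      has_Texp \<rho> V t1 t f (U t f) \<and> fs_norm \<rho> (U t f) \<le> fs_norm R f"
    and lip: "\<And>Rb f. R < Rb \<Longrightarrow> ereal Rb < r0 \<Longrightarrow> f \<in> FS Rb \<Longrightarrow>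
      \<exists>L\<ge>0. \<forall>t\<in>closed_segment t1 t2. \<forall>s\<in>closed_segment t1 t2.
        fs_norm \<rho> (fs_diff (U t f) (U s f)) \<le> ennreal (L * \<bar>t - s\<bar>)"
  shows "(\<forall>f\<in>(FS R :: ('a, real) fseries set). \<exists>!g. has_Texp \<rho> V t1 t2 f g) \<and>
         (\<forall>f\<in>(FS R :: ('a, real) fseries set). \<forall>g\<in>FS R. \<forall>a b.
           Texp \<rho> V t1 t2 (fs_lincomb a f b g) =
             fs_lincomb a (Texp \<rho> V t1 t2 f) b (Texp \<rho> V t1 t2 g)) \<and>
         (\<forall>f\<in>(FS R :: ('a, real) fseries set).
           Texp \<rho> V t1 t2 f \<in> FS \<rho> \<and> fs_norm \<rho> (Texp \<rho> V t1 t2 f) \<le> fs_norm R f) \<and>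
         (\<forall>Rb. R < Rb \<and> ereal Rb < r0 \<longrightarrow>
           (\<forall>f\<in>(FS Rb :: ('a, real) fseries set).
              (\<forall>t\<in>closed_segment t1 t2. \<exists>!g. has_Texp \<rho> V t1 t f g) \<and>
              fs_locally_lipschitz_on \<rho> (closed_segment t1 t2) (\<lambda>t. Texp \<rho> V t1 t f)))"
proof -
  have eq: "Texp \<rho> V t1 t f = U t f" and ex: "\<exists>!g. has_Texp \<rho> V t1 t f g"
    if "t \<in> closed_segment t1 t2" "f \<in> FS R" for t f
    using Texp_eq[OF \<rho>(1)] U[OF that] by blast+
  have t2: "t2 \<in> closed_segment t1 t2" by simp
  have UF: "U t f \<in> FS \<rho>" if "t \<in> closed_segment t1 t2" "f \<in> FS R" for t f
    using U[OF that] unfolding has_Texp_def by blast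
  have lin: "Texp \<rho> V t1 t2 (fs_lincomb a f b g) = fs_lincomb a (Texp \<rho> V t1 t2 f) b (Texp \<rho> V t1 t2 g)"
    if f: "f \<in> FS R" and g: "g \<in> FS R" for f g :: "('a, real) fseries" and a b
  proof -
    have l: "fs_lincomb a f b g \<in> FS R" using f g \<rho> by (intro fs_lincomb_FS) auto
    show ?thesis
      unfolding eq[OF t2 f] eq[OF t2 g] eq[OF t2 l]
      by (rule has_Texp_lincomb[OF \<rho>(1) _ FS_formal_series[OF f] U[OF t2 f, THEN conjunct1]
            FS_formal_series[OF g] U[OF t2 g, THEN conjunct1] U[OF t2 l, THEN conjunct1]]) (rule V)
  qed
  have "fs_locally_lipschitz_on \<rho> (closed_segment t1 t2) (\<lambda>t. Texp \<rho> V t1 t f)"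
    if Rb: "R < Rb" "ereal Rb < r0" and f: "f \<in> FS Rb" for Rb and f :: "('a, real) fseries"
  proof -
    have fR: "f \<in> FS R" using FS_mono[of R Rb f] Rb \<rho> f by simp
    obtain L where L: "L \<ge> 0" "\<forall>t\<in>closed_segment t1 t2. \<forall>s\<in>closed_segment t1 t2.
        fs_norm \<rho> (fs_diff (U t f) (U s f)) \<le> ennreal (L * \<bar>t - s\<bar>)"
      using lip[OF Rb f] by blast
    show ?thesis
      unfolding fs_locally_lipschitz_on_def
    proof (intro conjI ballI)
      show "(\<lambda>t. Texp \<rho> V t1 t f) \<in> closed_segment t1 t2 \<rightarrow> FS \<rho>"
        using eq[OF _ fR] UF[OF _ fR] by auto
      show "\<exists>e>0. \<exists>L\<ge>0. \<forall>s\<in>closed_segment t1 t2 \<inter> ball t e. \<forall>s'\<in>closed_segment t1 t2 \<inter> ball t e.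
          fs_norm \<rho> (fs_diff (Texp \<rho> V t1 s f) (Texp \<rho> V t1 s' f)) \<le> ennreal (L * \<bar>s - s'\<bar>)" for t
        by (rule exI[of _ "1::real"], rule conjI[OF zero_less_one], rule exI[of _ L])
          (use L eq[OF _ fR] in auto)
    qed
  qed
  moreover have "f \<in> FS R" if "R < Rb" "f \<in> FS Rb" for Rb and f :: "('a, real) fseries"
    using FS_mono[of R Rb f] \<rho> that by simp
  ultimately have Rb: "(\<forall>t\<in>closed_segment t1 t2. \<exists>!g. has_Texp \<rho> V t1 t f g) \<and>
      fs_locally_lipschitz_on \<rho> (closed_segment t1 t2) (\<lambda>t. Texp \<rho> V t1 t f)"
    if "R < Rb" "ereal Rb < r0" "f \<in> FS Rb" for Rb and f :: "('a, real) fseries"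
    using that ex by blast
  have bound: "Texp \<rho> V t1 t2 f \<in> FS \<rho> \<and> fs_norm \<rho> (Texp \<rho> V t1 t2 f) \<le> fs_norm R f"
    if "f \<in> FS R" for f :: "('a, real) fseries"
    using eq[OF t2 that] U[OF t2 that] UF[OF t2 that] by simp
  show ?thesis
    by (intro conjI ballI allI impI ex[OF t2] lin) (use bound Rb in blast)+
qed

theorem theorem5p1:
  fixes r0 :: ereal and I :: "real set"
    and V :: "real \<Rightarrow> ('a::banach, 'a) fseries"
    and x :: "nat \<Rightarrow> real" and X :: "(real, real) fseries"
    and R t1 t2 \<rho> :: real
  assumes "0 < r0" and "is_interval I"
    and "\<forall>t\<in>I. V t \<in> FS_ext r0"
    and "X = (\<lambda>p z. x p * z ^ p)" and "X \<in> FS_ext r0"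
    and "\<forall>t\<in>I. \<forall>p. 0 \<le> tnorm p (V t p) \<and> tnorm p (V t p) \<le> x p"
    and "\<forall>r>0. ereal r < r0 \<longrightarrow>
           (\<forall>f\<in>(FSd 1 r :: ('a, real) fseries set).
              fs_measurable (lebesgue_on I) r (\<lambda>t. vf_act (V t) f))"
    and "0 < R" and "ereal R < r0"
    and "t1 \<in> I" and "t2 \<in> I"
    and "flows_to (\<lambda>z. - fs_eval X z) {z. ereal \<bar>z\<bar> < r0} \<bar>t2 - t1\<bar> R \<rho>" and "0 < \<rho>"
  shows "(\<forall>f\<in>(FS R :: ('a, real) fseries set). \<exists>!g. has_Texp \<rho> V t1 t2 f g) \<and>
         (\<forall>f\<in>(FS R :: ('a, real) fseries set). \<forall>g\<in>FS R. \<forall>a b.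
           Texp \<rho> V t1 t2 (fs_lincomb a f b g) =
             fs_lincomb a (Texp \<rho> V t1 t2 f) b (Texp \<rho> V t1 t2 g)) \<and>
         (\<forall>f\<in>(FS R :: ('a, real) fseries set).
           Texp \<rho> V t1 t2 f \<in> FS \<rho> \<and> fs_norm \<rho> (Texp \<rho> V t1 t2 f) \<le> fs_norm R f) \<and>
         (\<forall>Rb. R < Rb \<and> ereal Rb < r0 \<longrightarrow>
           (\<forall>f\<in>(FS Rb :: ('a, real) fseries set).
              (\<forall>t\<in>closed_segment t1 t2. \<exists>!g. has_Texp \<rho> V t1 t f g) \<and>
              fs_locally_lipschitz_on \<rho> (closed_segment t1 t2) (\<lambda>t. Texp \<rho> V t1 t f)))"
proof -
  note r0 = assms(1) and I = assms(2) and VI = assms(3) and X = assms(4) and XF = assms(5)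
    and Vx = assms(6) and meas = assms(7) and R = assms(8,9) and t12 = assms(10,11)
    and flow = assms(12) and \<rho>_pos = assms(13)
  have x: "0 \<le> x p" for p using Vx t12(1) by (meson order_trans)
  have summable_x: "\<forall>r\<ge>0. ereal r < r0 \<longrightarrow> summable (\<lambda>p. x p * r ^ p)"
    using summable_majorant_coefficients[of x r0] XF x unfolding X by simp
  have V: "V t \<in> formal_series" if "t \<in> I" for t
    using VI that FS_ext_formal_series by blast
  have segI: "closed_segment t1 t2 \<subseteq> I"
    using I t12 by (intro closed_segment_subset) (auto simp: is_interval_convex)
  have T: "0 \<le> \<bar>t2 - t1\<bar>" by simp
  note maj = flows_to_majorant[OF x summable_x flow[unfolded X] T \<rho>_pos]
  have le: "\<rho> \<le> R" by (rule maj(1))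
  show ?thesis
  \<comment> \<open>the flow is stationary exactly in the first case, and then \<open>\<rho> = R\<close>\<close>
  proof (cases "t1 = t2 \<or> (\<forall>p. x p = 0)")
    case True
    have trivial: "has_Texp \<rho> V t1 t f f" if t: "t \<in> closed_segment t1 t2" and f: "f \<in> FS R"
      for t and f :: "('a, real) fseries"
    proof (rule has_Texp_if_iterates_vanish[OF \<rho>_pos])
      show "f \<in> FS \<rho>" using FS_mono[of \<rho> R f] f \<rho>_pos le by simp
      fix k \<tau> assume k: "k \<noteq> 0" and \<tau>: "\<tau> \<in> time_simplex k t1 t"
      have seg: "\<tau> i \<in> open_segment t1 t" if "i \<in> {1..k}" for i
        using \<tau> that unfolding time_simplex_iff by blast
      show "vf_iter V \<tau> k f = (\<lambda>p \<phi>. 0)"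
      proof (cases "t1 = t2")
        case True
        then show ?thesis using seg[of 1] k t by simp
      next
        case False
        then have x0: "x p = 0" for p using True by blast
        have \<tau>I: "\<tau> i \<in> I" if "i \<in> {1..k}" for i
        proof -
          have "closed_segment t1 t \<subseteq> closed_segment t1 t2" using t by (simp add: subset_closed_segment)
          then show ?thesis using seg[OF that] segment_open_subset_closed segI by blast
        qed
        have fs: "vf_iter V \<tau> k f \<in> formal_series"
          using V \<tau>I FS_formal_series[OF f] by (intro vf_iter_formal_series) auto
        have "tnorm p (vf_iter V \<tau> k f p) \<le> (transport x ^^ k) (\<lambda>p. tnorm p (f p)) p" for p
          using V \<tau>I Vx FS_formal_series[OF f] by (intro tnorm_vf_iter_le) auto
        moreover have "(transport x ^^ k) F p = 0" for F p
          using k by (cases k) (simp_all add: transport_def x0)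
        ultimately have "tnorm p (vf_iter V \<tau> k f p) = 0" for p
          using tnorm_nonneg[OF formal_seriesD[OF fs, of p]] by (simp add: order_antisym)
        then show ?thesis using homog_poly_eq_zero[OF formal_seriesD[OF fs]] by blast
      qed
    qed
    show ?thesis
    proof (rule Texp_properties[OF \<rho>_pos le, where U = "\<lambda>t f. f"])
      show "V t \<in> formal_series" if "t \<in> closed_segment t1 t2" for t using V segI that by blast
      show "has_Texp \<rho> V t1 t f f \<and> fs_norm \<rho> f \<le> fs_norm R f"
        if "t \<in> closed_segment t1 t2" "f \<in> FS R" for t and f :: "('a, real) fseries"
        using trivial[OF that] fs_norm_mono[of \<rho> R f] \<rho>_pos le FS_formal_series[OF that(2)] by simp
      show "\<exists>L\<ge>0. \<forall>t\<in>closed_segment t1 t2. \<forall>s\<in>closed_segment t1 t2.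
        fs_norm \<rho> (fs_diff f f) \<le> ennreal (L * \<bar>t - s\<bar>)" for f :: "('a, real) fseries"
        by (intro exI[of _ 0]) (simp add: fs_diff_def fs_norm_zero)
    qed
  next
    case False
    then obtain l where l: "x l \<noteq> 0" and T0: "0 < \<bar>t2 - t1\<bar>" by auto
    have rR: "ereal r < r0" if "r < R" for r
      using that R(2) by (meson ereal_less_eq(3) less_imp_le order_le_less_trans)
    interpret chronological_exponential V x I R t1 t2 \<rho>
    proof
      show "I \<in> sets lebesgue"
        using real_interval_borel_measurable[OF I] by simp
      show "fs_measurable (lebesgue_on I) r (\<lambda>t. vf_act (V t) f)"
        if "0 < r" "r < R" "f \<in> FSd 1 r" for r and f :: "('a, real) fseries"
        using meas that rR by blast
      show "(\<Sum>k<n. \<bar>t2 - t1\<bar> ^ k / fact k * (\<Sum>p. (transport x ^^ k) F p * \<rho> ^ p)) \<le> (\<Sum>p. F p * R ^ p)"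
        if "\<And>p. 0 \<le> F p" "summable (\<lambda>p. F p * R ^ p)" for F n
        using maj(3)[OF T0 l that] .
    qed (use V Vx x summable_x rR segI \<rho>_pos maj(2)[OF T0 l] in auto)
    show ?thesis
    proof (rule Texp_properties[OF \<rho>_pos le, where U = "\<lambda>t f. chron_exp f t"])
      show "V t \<in> formal_series" if "t \<in> closed_segment t1 t2" for t using V segI that by blast
      show "has_Texp \<rho> V t1 t f (chron_exp f t) \<and> fs_norm \<rho> (chron_exp f t) \<le> fs_norm R f"
        if "t \<in> closed_segment t1 t2" "f \<in> FS R" for t and f :: "('a, real) fseries"
        using chron_exp(1,2)[OF that] by simp
      fix Rb and f :: "('a, real) fseries" assume Rb: "R < Rb" "ereal Rb < r0" and f: "f \<in> FS Rb"
      have "summable (\<lambda>p. x p * r ^ p)" if "0 \<le> r" "r < Rb" for r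
        using summable_x that Rb(2) by (meson ereal_less_eq(3) less_imp_le order_le_less_trans)
      then show "\<exists>L\<ge>0. \<forall>t\<in>closed_segment t1 t2. \<forall>s\<in>closed_segment t1 t2.
        fs_norm \<rho> (fs_diff (chron_exp f t) (chron_exp f s)) \<le> ennreal (L * \<bar>t - s\<bar>)"
        by (rule chron_exp_lipschitz_on_segment[OF Rb(1) _ f])
    qed
  qed
qed

end
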